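(* Let $G$ be a finite group and $R$ a faithful complex representation of $G$ of dimension $d$ whose image acts freely. Then for $1\le i,j\le n$ the entries of the inverse of the Euclidean Cartan matrix $\widetilde M[R](1)$ of $R$ are $$(\widetilde M[R](1)^{-1})^i_j=\frac{d_id_j}{\mu_0|G|}\left.\left(D[R]^0_0-\frac{D[R]^i_0}{d_i}-\frac{D[R]^0_j}{d_j}+\frac{D[R]^i_j}{d_id_j}\right)^{(d)}\right|_{q=1},$$ where $(\cdot)^{(d)}$ denotes the $d$-th derivative with respect to $q$.
   Context: The image of $R$ acts freely means: only the identity of the matrix group $R(G)$ has nonzero fixed vectors. $R_0$ (trivial), $R_1,\dots,R_n$ are the irreducible complex representations of the finite group $G$ up to isomorphism, $d_i=\dim R_i$. With $(R,Q)=\frac1{|G|}\sum_{g\in G}\chi^R(g)\overline{\chi^Q(g)}$ ($\chi^R$ the character of $R$), the Clebsch–Gordan matrix $M[Q]$ of a representation $Q$ is the matrix with entries $M[Q]^i_j=(Q\otimes R_i,R_j)$ (row $i$, column $j$), $0\le i,j\le n$; it is extended linearly to formal power series in $q$ with coefficients in the representation ring. $R_S(q)=\sum_{m\ge0}R_S^mq^m$ and $R_A(q)=\sum_{m\ge0}R_A^mq^m$, where $R_S^m$, $R_A^m$ are the $m$-th symmetric and exterior powers of $R$. The matrix $\widetilde M[R](q)$ is obtained from $M[R_A(-q)]=\sum_m(-q)^mM[R_A^m]$ by deleting the row and column with index $0$; the Euclidean Cartan matrix of $R$ is $\widetilde M[R](1)$ (it is invertible when the image of $R$ acts freely). Let $V$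 be the space of $R$ and $S=\mathrm{Sym}(V)$. Fix a homogeneous system of parameters $\theta_1,\dots,\theta_d$ of the invariant algebra $S^G$, $n_k=\deg\theta_k$. For each $j$ the graded module of covariants $\mathrm{Hom}_G(R_j,S)$ is a free $\mathbb C[\theta_1,\dots,\theta_d]$-module of finite rank $\mu_j$; let $m_{1j},\dots,m_{\mu_jj}$ be the degrees of a homogeneous basis. Put $D[R]^0_j=\sum_{k=1}^{\mu_j}q^{m_{kj}}$ and $(1-q)^dD(R)=\prod_{k=1}^d(1-q^{n_k})$, so that $M[R_S(q)]^0_j=\frac{1}{(1-q)^d}\frac{D[R]^0_j}{D(R)}$ and $\mu_0|G|=n_1\cdots n_d$. Put $D[R]^i_j=\sum_{k=0}^n(R_i\otimes R_k,R_j)\,D[R]^0_k$ for $0\le i,j\le n$.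
   Formalization: The printed formula is off by a constant factor (for G = Z/2 with R the sign representation it gives -1 instead of 1); the formal statement multiplies the d-th derivative at q = 1 by (-1)^d/d!. *)

theory Defs
  imports
    "HOL-Algebra.Coset"
    "HOL-Computational_Algebra.Polynomial"
    "HOL-Library.Poly_Mapping"
    "Jordan_Normal_Form.Matrix"
    "Jordan_Normal_Form.Determinant"
    "Jordan_Normal_Form.VS_Connect"
    "Jordan_Normal_Form.DL_Submatrix"
begin

section \<open>Complex matrix representations of a finite group\<close>

definition is_rep :: "('g, 'b) monoid_scheme \<Rightarrow> nat \<Rightarrow> ('g \<Rightarrow> complex mat) \<Rightarrow> bool" where
  "is_rep G d \<rho> \<longleftrightarrow>
     (\<forall>g\<in>carrier G. \<rho> g \<in> carrier_mat d d) \<and>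
     \<rho> \<one>\<^bsub>G\<^esub> = 1\<^sub>m d \<and>
     (\<forall>g\<in>carrier G. \<forall>h\<in>carrier G. \<rho> (g \<otimes>\<^bsub>G\<^esub> h) = \<rho> g * \<rho> h)"

definition faithful_rep :: "('g, 'b) monoid_scheme \<Rightarrow> ('g \<Rightarrow> complex mat) \<Rightarrow> bool" where
  "faithful_rep G \<rho> \<longleftrightarrow> inj_on \<rho> (carrier G)"

definition image_acts_freely :: "('g, 'b) monoid_scheme \<Rightarrow> nat \<Rightarrow> ('g \<Rightarrow> complex mat) \<Rightarrow> bool" where
  "image_acts_freely G d \<rho> \<longleftrightarrow>
     (\<forall>A\<in>\<rho> ` carrier G. (\<exists>v\<in>carrier_vec d. v \<noteq> 0\<^sub>v d \<and> A *\<^sub>v v = v) \<longrightarrow> A = 1\<^sub>m d)"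

definition irreducible_rep :: "('g, 'b) monoid_scheme \<Rightarrow> nat \<Rightarrow> ('g \<Rightarrow> complex mat) \<Rightarrow> bool" where
  "irreducible_rep G d \<rho> \<longleftrightarrow>
     is_rep G d \<rho> \<and> d \<noteq> 0 \<and>
     (\<forall>W. VectorSpace.subspace class_ring W (module_vec TYPE(complex) d) \<longrightarrow>
        (\<forall>g\<in>carrier G. \<forall>w\<in>W. \<rho> g *\<^sub>v w \<in> W) \<longrightarrow> W = {0\<^sub>v d} \<or> W = carrier_vec d)"

definition rep_iso ::
  "('g, 'b) monoid_scheme \<Rightarrow> nat \<Rightarrow> ('g \<Rightarrow> complex mat) \<Rightarrow> nat \<Rightarrow> ('g \<Rightarrow> complex mat) \<Rightarrow> bool" where
  "rep_iso G d \<rho> d' \<sigma> \<longleftrightarrow> d = d' \<and>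
     (\<exists>P\<in>carrier_mat d d. invertible_mat P \<and> (\<forall>g\<in>carrier G. P * \<rho> g = \<sigma> g * P))"

text \<open>\<open>irr 0, \<dots>, irr n\<close> represent each isomorphism class of irreducible representations
  exactly once, \<open>irr 0\<close> is trivial, and \<open>dm i\<close> is the dimension of \<open>irr i\<close>.\<close>

definition irreducible_system ::
  "('g, 'b) monoid_scheme \<Rightarrow> nat \<Rightarrow> (nat \<Rightarrow> nat) \<Rightarrow> (nat \<Rightarrow> 'g \<Rightarrow> complex mat) \<Rightarrow> bool" where
  "irreducible_system G n dm irr \<longleftrightarrow>
     (\<forall>i\<le>n. irreducible_rep G (dm i) (irr i)) \<and>
     dm 0 = 1 \<and> (\<forall>g\<in>carrier G. irr 0 g = 1\<^sub>m 1) \<and>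
     (\<forall>i\<le>n. \<forall>j\<le>n. rep_iso G (dm i) (irr i) (dm j) (irr j) \<longrightarrow> i = j) \<and>
     (\<forall>m \<sigma>. irreducible_rep G m \<sigma> \<longrightarrow> (\<exists>i\<le>n. rep_iso G m \<sigma> (dm i) (irr i)))"


section \<open>Characters, tensor and exterior powers, Clebsch--Gordan matrices\<close>

definition rep_char :: "('g \<Rightarrow> complex mat) \<Rightarrow> 'g \<Rightarrow> complex" where
  "rep_char \<rho> g = (\<Sum>i<dim_row (\<rho> g). \<rho> g $$ (i, i))"

definition rep_inner ::
  "('g, 'b) monoid_scheme \<Rightarrow> ('g \<Rightarrow> complex mat) \<Rightarrow> ('g \<Rightarrow> complex mat) \<Rightarrow> complex" where
  "rep_inner G \<rho> \<sigma> =
     (\<Sum>g\<in>carrier G. rep_char \<rho> g * cnj (rep_char \<sigma> g)) / of_nat (Coset.order G)"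

definition kronecker_mat :: "complex mat \<Rightarrow> complex mat \<Rightarrow> complex mat" where
  "kronecker_mat A B = mat (dim_row A * dim_row B) (dim_col A * dim_col B)
     (\<lambda>(i, j). A $$ (i div dim_row B, j div dim_col B) * B $$ (i mod dim_row B, j mod dim_col B))"

definition tensor_rep :: "('g \<Rightarrow> complex mat) \<Rightarrow> ('g \<Rightarrow> complex mat) \<Rightarrow> 'g \<Rightarrow> complex mat" where
  "tensor_rep \<rho> \<sigma> g = kronecker_mat (\<rho> g) (\<sigma> g)"

text \<open>The matrix of the \<open>m\<close>-th exterior power in the basis of wedge products
  \<open>e\<^sub>I\<close>, where \<open>I\<close> runs over the \<open>m\<close>-element subsets of \<open>{0..<d}\<close>: the entry at
  \<open>(I, J)\<close> is the minor with rows \<open>I\<close> and columns \<open>J\<close>.  For \<open>m > d\<close> it is the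
  \<open>0 \<times> 0\<close> matrix.\<close>

definition wedge_basis :: "nat \<Rightarrow> nat \<Rightarrow> nat set list" where
  "wedge_basis d m = map set (filter (\<lambda>xs. length xs = m) (subseqs [0..<d]))"

definition exterior_rep :: "nat \<Rightarrow> ('g \<Rightarrow> complex mat) \<Rightarrow> nat \<Rightarrow> 'g \<Rightarrow> complex mat" where
  "exterior_rep d \<rho> m g =
     (let Is = wedge_basis d m in
      mat (length Is) (length Is) (\<lambda>(a, b). det (submatrix (\<rho> g) (Is ! a) (Is ! b))))"

definition cg_matrix ::
  "('g, 'b) monoid_scheme \<Rightarrow> nat \<Rightarrow> (nat \<Rightarrow> 'g \<Rightarrow> complex mat) \<Rightarrow> ('g \<Rightarrow> complex mat) \<Rightarrow> complex mat" where
  "cg_matrix G n irr Q =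
     mat (Suc n) (Suc n) (\<lambda>(i, j). rep_inner G (tensor_rep Q (irr i)) (irr j))"

text \<open>The matrix \<open>M[R\<^sub>A(-q)]\<close>, with entries in \<open>\<complex>[q]\<close>; the exterior powers of degree
  above \<open>d\<close> vanish, so the sum stops at \<open>d\<close>.\<close>

definition cg_exterior ::
  "('g, 'b) monoid_scheme \<Rightarrow> nat \<Rightarrow> (nat \<Rightarrow> 'g \<Rightarrow> complex mat) \<Rightarrow> nat \<Rightarrow> ('g \<Rightarrow> complex mat)
     \<Rightarrow> complex poly mat" where
  "cg_exterior G n irr d \<rho> = mat (Suc n) (Suc n)
     (\<lambda>ij. \<Sum>m\<le>d. monom ((-1) ^ m * cg_matrix G n irr (exterior_rep d \<rho> m) $$ ij) m)"

definition euclidean_cartan ::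
  "('g, 'b) monoid_scheme \<Rightarrow> nat \<Rightarrow> (nat \<Rightarrow> 'g \<Rightarrow> complex mat) \<Rightarrow> nat \<Rightarrow> ('g \<Rightarrow> complex mat)
     \<Rightarrow> complex mat" where
  "euclidean_cartan G n irr d \<rho> =
     map_mat (\<lambda>p. poly p 1) (mat_delete (cg_exterior G n irr d \<rho>) 0 0)"


section \<open>The symmetric algebra, invariants and covariants\<close>

text \<open>\<open>Sym(V)\<close> for \<open>V = \<complex>\<^sup>d\<close> is the polynomial ring in variables \<open>x\<^sub>0, \<dots>, x\<^sub>d\<^sub>-\<^sub>1\<close>, where
  \<open>x\<^sub>k\<close> is the \<open>k\<close>-th standard basis vector of \<open>V\<close> itself (not of its dual).\<close>

type_synonym mpol = "(nat \<Rightarrow>\<^sub>0 nat) \<Rightarrow>\<^sub>0 complex"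

definition mpol_const :: "complex \<Rightarrow> mpol" where
  "mpol_const c = Poly_Mapping.single 0 c"

definition mpol_var :: "nat \<Rightarrow> mpol" where
  "mpol_var k = Poly_Mapping.single (Poly_Mapping.single k 1) 1"

definition sym_alg :: "nat \<Rightarrow> mpol set" where
  "sym_alg d = {p. \<forall>m\<in>Poly_Mapping.keys p. Poly_Mapping.keys m \<subseteq> {..<d}}"

definition homogeneous :: "nat \<Rightarrow> mpol \<Rightarrow> bool" where
  "homogeneous e p \<longleftrightarrow>
     (\<forall>m\<in>Poly_Mapping.keys p. (\<Sum>k\<in>Poly_Mapping.keys m. Poly_Mapping.lookup m k) = e)"

definition mpol_subst :: "(nat \<Rightarrow> mpol) \<Rightarrow> mpol \<Rightarrow> mpol" where
  "mpol_subst y p = (\<Sum>m\<in>Poly_Mapping.keys p. mpol_const (Poly_Mapping.lookup p m) *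
     (\<Prod>k\<in>Poly_Mapping.keys m. y k ^ Poly_Mapping.lookup m k))"

text \<open>The algebra endomorphism of \<open>Sym(V)\<close> extending \<open>A\<close>: the basis vector \<open>x\<^sub>k\<close> goes to
  the \<open>k\<close>-th column of \<open>A\<close>.\<close>

definition sym_act :: "complex mat \<Rightarrow> mpol \<Rightarrow> mpol" where
  "sym_act A = mpol_subst (\<lambda>k. \<Sum>l<dim_row A. mpol_const (A $$ (l, k)) * mpol_var l)"

definition invariant_algebra ::
  "('g, 'b) monoid_scheme \<Rightarrow> nat \<Rightarrow> ('g \<Rightarrow> complex mat) \<Rightarrow> mpol set" where
  "invariant_algebra G d \<rho> = {f \<in> sym_alg d. \<forall>g\<in>carrier G. sym_act (\<rho> g) f = f}"

definition subalg :: "nat \<Rightarrow> (nat \<Rightarrow> mpol) \<Rightarrow> mpol set" where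
  "subalg d \<theta> = mpol_subst \<theta> ` sym_alg d"

text \<open>Homogeneous system of parameters \<open>\<theta> 0, \<dots>, \<theta> (d - 1)\<close> of the invariant algebra, with
  degrees \<open>deg k\<close>: homogeneous invariants of positive degree, algebraically independent, over
  which the invariant algebra is a finitely generated module.\<close>

definition invariant_hsop ::
  "('g, 'b) monoid_scheme \<Rightarrow> nat \<Rightarrow> ('g \<Rightarrow> complex mat) \<Rightarrow> (nat \<Rightarrow> mpol) \<Rightarrow> (nat \<Rightarrow> nat) \<Rightarrow> bool" where
  "invariant_hsop G d \<rho> \<theta> deg \<longleftrightarrow>
     (\<forall>k<d. \<theta> k \<in> invariant_algebra G d \<rho> \<and> homogeneous (deg k) (\<theta> k) \<and> deg k > 0) \<and>
     (\<forall>p\<in>sym_alg d. mpol_subst \<theta> p = 0 \<longrightarrow> p = 0) \<and>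
     (\<exists>B. finite B \<and> B \<subseteq> invariant_algebra G d \<rho> \<and>
        (\<forall>f\<in>invariant_algebra G d \<rho>. \<exists>c. (\<forall>b\<in>B. c b \<in> subalg d \<theta>) \<and> f = (\<Sum>b\<in>B. c b * b)))"

text \<open>\<open>Hom\<^sub>G(Q, Sym V)\<close> for a representation \<open>Q = (m, \<sigma>)\<close>; only the values of a covariant on
  \<open>carrier_vec m\<close> are relevant.\<close>

definition covariants ::
  "('g, 'b) monoid_scheme \<Rightarrow> nat \<Rightarrow> ('g \<Rightarrow> complex mat) \<Rightarrow> nat \<Rightarrow> ('g \<Rightarrow> complex mat)
     \<Rightarrow> (complex vec \<Rightarrow> mpol) set" where
  "covariants G d \<rho> m \<sigma> = {\<phi>.
     (\<forall>v\<in>carrier_vec m. \<phi> v \<in> sym_alg d) \<and>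
     (\<forall>v\<in>carrier_vec m. \<forall>w\<in>carrier_vec m. \<phi> (v + w) = \<phi> v + \<phi> w) \<and>
     (\<forall>c. \<forall>v\<in>carrier_vec m. \<phi> (c \<cdot>\<^sub>v v) = mpol_const c * \<phi> v) \<and>
     (\<forall>g\<in>carrier G. \<forall>v\<in>carrier_vec m. \<phi> (\<sigma> g *\<^sub>v v) = sym_act (\<rho> g) (\<phi> v))}"

text \<open>\<open>\<beta> 0, \<dots>, \<beta> (\<mu> - 1)\<close> is a homogeneous basis, with degrees \<open>e k\<close>, of the module of
  covariants over the polynomial algebra generated by \<open>\<theta>\<close>.\<close>

definition homogeneous_covariant_basis ::
  "('g, 'b) monoid_scheme \<Rightarrow> nat \<Rightarrow> ('g \<Rightarrow> complex mat) \<Rightarrow> (nat \<Rightarrow> mpol) \<Rightarrow> nat \<Rightarrow>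
     ('g \<Rightarrow> complex mat) \<Rightarrow> nat \<Rightarrow> (nat \<Rightarrow> complex vec \<Rightarrow> mpol) \<Rightarrow> (nat \<Rightarrow> nat) \<Rightarrow> bool" where
  "homogeneous_covariant_basis G d \<rho> \<theta> m \<sigma> \<mu> \<beta> e \<longleftrightarrow>
     (\<forall>k<\<mu>. \<beta> k \<in> covariants G d \<rho> m \<sigma> \<and> (\<forall>v\<in>carrier_vec m. homogeneous (e k) (\<beta> k v))) \<and>
     (\<forall>\<phi>\<in>covariants G d \<rho> m \<sigma>. \<exists>c. (\<forall>k<\<mu>. c k \<in> subalg d \<theta>) \<and>
        (\<forall>v\<in>carrier_vec m. \<phi> v = (\<Sum>k<\<mu>. c k * \<beta> k v))) \<and>
     (\<forall>c. (\<forall>k<\<mu>. c k \<in> subalg d \<theta>) \<longrightarrow>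
        (\<forall>v\<in>carrier_vec m. (\<Sum>k<\<mu>. c k * \<beta> k v) = 0) \<longrightarrow> (\<forall>k<\<mu>. c k = 0))"


section \<open>The polynomials \<open>D[R]\<^sup>i\<^sub>j\<close>\<close>

definition D_row0 :: "(nat \<Rightarrow> nat) \<Rightarrow> (nat \<Rightarrow> nat \<Rightarrow> nat) \<Rightarrow> nat \<Rightarrow> complex poly" where
  "D_row0 \<mu> e j = (\<Sum>k<\<mu> j. monom 1 (e j k))"

definition D_poly ::
  "('g, 'b) monoid_scheme \<Rightarrow> nat \<Rightarrow> (nat \<Rightarrow> 'g \<Rightarrow> complex mat) \<Rightarrow> (nat \<Rightarrow> nat) \<Rightarrow>
     (nat \<Rightarrow> nat \<Rightarrow> nat) \<Rightarrow> nat \<Rightarrow> nat \<Rightarrow> complex poly" where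
  "D_poly G n irr \<mu> e i j =
     (\<Sum>k\<le>n. Polynomial.smult (rep_inner G (tensor_rep (irr i) (irr k)) (irr j)) (D_row0 \<mu> e k))"

text \<open>The combination of the \<open>D[R]\<^sup>i\<^sub>j\<close> whose \<open>d\<close>-th derivative at \<open>q = 1\<close> gives the entries
  of the inverse Euclidean Cartan matrix.  It vanishes to order \<open>d\<close> at \<open>q = 1\<close>; the
  relevant quantity is its coefficient at \<open>(1 - q)\<^sup>d\<close>, which is the \<open>d\<close>-th derivative at
  \<open>1\<close> times \<open>(-1)\<^sup>d / d!\<close>.\<close>

definition D_comb ::
  "('g, 'b) monoid_scheme \<Rightarrow> nat \<Rightarrow> (nat \<Rightarrow> nat) \<Rightarrow> (nat \<Rightarrow> 'g \<Rightarrow> complex mat) \<Rightarrow> (nat \<Rightarrow> nat) \<Rightarrow>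
     (nat \<Rightarrow> nat \<Rightarrow> nat) \<Rightarrow> nat \<Rightarrow> nat \<Rightarrow> complex poly" where
  "D_comb G n dm irr \<mu> e i j =
     D_row0 \<mu> e 0
     - Polynomial.smult (1 / of_nat (dm i)) (D_poly G n irr \<mu> e i 0)
     - Polynomial.smult (1 / of_nat (dm j)) (D_row0 \<mu> e j)
     + Polynomial.smult (1 / (of_nat (dm i) * of_nat (dm j))) (D_poly G n irr \<mu> e i j)"

end

theory Submission
  imports Defs
    "Jordan_Normal_Form.Jordan_Normal_Form_Existence"
    "Jordan_Normal_Form.Spectral_Radius"
    "HOL-Computational_Algebra.Polynomial_FPS"
begin

text \<open>
Put \<open>f(g) = det (1 - R(g))\<close>. Since \<open>f(g)\<close> is the alternating sum of the characters of the
  exterior powers of \<open>R\<close> at \<open>g\<close> (\<open>alternating_exterior_char\<close>), the Euclidean Cartan matrix has the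
  entries \<open>1/|G| \<Sum>\<^sub>g f(g) \<chi>\<^sub>i(g) cnj (\<chi>\<^sub>j(g))\<close> with \<open>i, j \<ge> 1\<close>, where \<open>\<chi>\<^sub>i\<close> is the character of
  \<open>R\<^sub>i\<close>. Here \<open>f(1) = 0\<close> for \<open>d > 0\<close>, and \<open>f(g) \<noteq> 0\<close> for \<open>g \<noteq> 1\<close> because the image of \<open>R\<close> acts
  freely and \<open>R\<close> is faithful. The inverse matrix is
  \<open>N\<^sub>i\<^sub>j = 1/|G| \<Sum>\<^bsub>g \<noteq> 1\<^esub> (\<chi>\<^sub>i(g) - d\<^sub>i) (cnj (\<chi>\<^sub>j(g)) - d\<^sub>j) / f(g)\<close>:
  subtracting the dimensions makes row and column \<open>0\<close> of \<open>N\<close> vanish, so that deleting the index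
  \<open>0\<close> does no harm, and in the product of the two matrices the sum over the middle index is the
  expansion of the class function \<open>f \<chi>\<^sub>i\<close> in irreducible characters, evaluated at \<open>g\<close> minus
  evaluated at \<open>1\<close>, which is just \<open>f(g) \<chi>\<^sub>i(g)\<close> (\<open>cartan_times_inverse\<close>, based on
  \<open>class_fun_expansion\<close>).

  The polynomials \<open>D[R]\<close> enter through Molien's formula. The Hilbert series of the covariants of
  type \<open>R\<^sub>j\<close> is \<open>1/|G| \<Sum>\<^sub>g cnj (\<chi>\<^sub>j(g)) / det (1 - q R(g))\<close>, and it is also \<open>D[R]\<^sup>0\<^sub>j\<close> divided by
  \<open>P(q) = \<Prod>\<^sub>l (1 - q^deg l)\<close>, because the module of covariants is free over the parameters
  (\<open>covariant_hilbert_series\<close>). Expanding \<open>cnj (\<chi>\<^sub>i) \<chi>\<^sub>j\<close> in irreducible characters yields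
  \<open>D[R]\<^sup>i\<^sub>j = P(q)/|G| \<Sum>\<^sub>g \<chi>\<^sub>i(g) cnj (\<chi>\<^sub>j(g)) / det (1 - q R(g))\<close> (\<open>D_poly_series\<close>), so the combination
  in the theorem is
  \<open>P(q)/|G| \<Sum>\<^sub>g (1 - \<chi>\<^sub>i(g)/d\<^sub>i) (1 - cnj (\<chi>\<^sub>j(g))/d\<^sub>j) / det (1 - q R(g))\<close>
  (\<open>D_comb_series\<close>). Its summand at \<open>g = 1\<close>, the only one with a pole at \<open>q = 1\<close>, is zero. Hence it
  vanishes to order \<open>d\<close> there, as \<open>P\<close> does, and its coefficient at \<open>(1 - q)^d\<close> is \<open>N\<^sub>i\<^sub>j\<close> up to
  the factor \<open>d\<^sub>i d\<^sub>j\<close> and the product of the degrees \<open>deg l\<close> (\<open>leading_coefficient_at_one\<close>). For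
  \<open>D[R]\<^sup>0\<^sub>0\<close> the summand at \<open>g = 1\<close> survives, and the value at \<open>q = 1\<close> shows that this product
  equals \<open>\<mu>\<^sub>0 |G|\<close> (\<open>value_at_one\<close>).

  Molien's formula itself is an equality of two traces. Averaging over the group is a projection
  of the degree \<open>m\<close> maps \<open>R\<^sub>j \<rightarrow> Sym(V)\<close> onto the covariants; its trace is on the one hand
  an average of products of characters, on the other hand the number of basis elements
  \<open>\<theta>\<^sup>a \<beta>\<^sub>k\<close> of degree \<open>m\<close> (\<open>covariant_count\<close>). Both the traces of \<open>R(g)\<close> on symmetric powers, computed
  in an eigenbasis, and the number of monomials in the parameters of a given degree are then
  summed by \<open>exponents_generating_function\<close>.
\<close>


section \<open>Subspaces and injective matrices\<close>

text \<open>Being a subspace of \<open>\<complex>\<^sup>n\<close>, stated elementwise. The two lemmas below translate to and from the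
  locale predicate in which irreducibility is expressed.\<close>

definition lin_closed :: "nat \<Rightarrow> complex vec set \<Rightarrow> bool" where
  "lin_closed n W \<longleftrightarrow> W \<subseteq> carrier_vec n \<and> 0\<^sub>v n \<in> W \<and>
     (\<forall>v\<in>W. \<forall>w\<in>W. v + w \<in> W) \<and> (\<forall>c. \<forall>v\<in>W. c \<cdot>\<^sub>v v \<in> W)"

lemma lin_closed_subspace:
  assumes "lin_closed n W"
  shows "VectorSpace.subspace class_ring W (module_vec TYPE(complex) n)"
proof -
  interpret vec_space "TYPE(complex)" n .
  show ?thesis
    using assms unfolding lin_closed_def
    by (unfold_locales) (auto simp: module_vec_simps)
qed

lemma subspace_lin_closed:
  assumes "VectorSpace.subspace class_ring W (module_vec TYPE(complex) n)"
  shows "lin_closed n W"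
proof -
  interpret S: VectorSpace.subspace class_ring W "module_vec TYPE(complex) n" by fact
  interpret submodule class_ring W "module_vec TYPE(complex) n" by (rule S.submod)
  show ?thesis unfolding lin_closed_def
    using subset m_closed zero_closed smult_closed by (auto simp: module_vec_simps)
qed

lemma mult_mat_vec_entry:
  assumes "A \<in> carrier_mat n m" "v \<in> carrier_vec m" "i < n"
  shows "(A *\<^sub>v v) $ i = (\<Sum>j<m. A $$ (i, j) * v $ j)"
  using assms by (auto simp: scalar_prod_def atLeast0LessThan intro!: sum.cong)

lemma mult_mat_entry:
  assumes "A \<in> carrier_mat n m" "B \<in> carrier_mat m r" "i < n" "k < r"
  shows "(A * B) $$ (i, k) = (\<Sum>j<m. A $$ (i, j) * B $$ (j, k))"
  using assms by (auto simp: scalar_prod_def atLeast0LessThan intro!: sum.cong)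

lemma mult_mat_unit_vec:
  fixes A :: "complex mat"
  assumes "A \<in> carrier_mat n m" "j < m"
  shows "A *\<^sub>v unit_vec m j = col A j"
  using assms by (intro eq_vecI) (auto simp: mult_mat_vec_entry if_distrib cong: if_cong)

definition inj_mat :: "complex mat \<Rightarrow> bool" where
  "inj_mat B \<longleftrightarrow> (\<forall>v\<in>carrier_vec (dim_col B). B *\<^sub>v v = 0\<^sub>v (dim_row B) \<longrightarrow> v = 0\<^sub>v (dim_col B))"

lemma inj_matD:
  assumes "inj_mat B" "B \<in> carrier_mat n r" "v \<in> carrier_vec r" "B *\<^sub>v v = 0\<^sub>v n"
  shows "v = 0\<^sub>v r"
  using assms unfolding inj_mat_def by auto

lemma mat_eq_iff_mult_vec:
  fixes A B :: "complex mat"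
  assumes A: "A \<in> carrier_mat n m" and B: "B \<in> carrier_mat n m"
    and eq: "\<And>v. v \<in> carrier_vec m \<Longrightarrow> A *\<^sub>v v = B *\<^sub>v v"
  shows "A = B"
proof (rule mat_col_eqI)
  fix j assume j: "j < dim_col B"
  have "A *\<^sub>v unit_vec m j = col A j" "B *\<^sub>v unit_vec m j = col B j"
    using A B j by (auto simp: mult_mat_unit_vec)
  then show "col A j = col B j" using eq[of "unit_vec m j"] by simp
qed (use A B in auto)

lemma vec_diff_zero_imp_eq:
  fixes u w :: "complex vec"
  assumes "u \<in> carrier_vec n" "w \<in> carrier_vec n" "u - w = 0\<^sub>v n"
  shows "u = w"
proof (rule eq_vecI)
  fix i assume i: "i < dim_vec w"
  have "(u - w) $ i = 0" using assms i by simp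
  then show "u $ i = w $ i" using i by simp
qed (use assms in auto)

lemma inj_mat_cancel:
  assumes inj: "inj_mat B" and B: "B \<in> carrier_mat n r"
    and X: "X \<in> carrier_mat r m" and Y: "Y \<in> carrier_mat r m" and eq: "B * X = B * Y"
  shows "X = Y"
proof (rule mat_eq_iff_mult_vec[OF X Y])
  fix v :: "complex vec" assume v: "v \<in> carrier_vec m"
  have c: "X *\<^sub>v v \<in> carrier_vec r" "Y *\<^sub>v v \<in> carrier_vec r" using X Y v by auto
  have "B *\<^sub>v (X *\<^sub>v v) = B *\<^sub>v (Y *\<^sub>v v)"
    using assoc_mult_mat_vec[OF B X v] assoc_mult_mat_vec[OF B Y v] eq by simp
  then have "B *\<^sub>v (X *\<^sub>v v - Y *\<^sub>v v) = 0\<^sub>v n"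
    using B c by (auto simp: mult_minus_distrib_mat_vec)
  then have "X *\<^sub>v v - Y *\<^sub>v v = 0\<^sub>v r"
    using inj_matD[OF inj B] c by auto
  then show "X *\<^sub>v v = Y *\<^sub>v v" by (rule vec_diff_zero_imp_eq[OF c])
qed

lemma inj_mat_mult:
  assumes "inj_mat B" "B \<in> carrier_mat n r" "inj_mat C" "C \<in> carrier_mat r s"
  shows "inj_mat (B * C)"
  unfolding inj_mat_def
proof (intro ballI impI)
  fix v assume v: "v \<in> carrier_vec (dim_col (B * C))" and eq: "B * C *\<^sub>v v = 0\<^sub>v (dim_row (B * C))"
  then have v': "v \<in> carrier_vec s" and "B *\<^sub>v (C *\<^sub>v v) = 0\<^sub>v n"
    using assms by (auto simp: assoc_mult_mat_vec[of B n r C s v])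
  then have "C *\<^sub>v v = 0\<^sub>v r"
    using inj_matD[OF assms(1,2)] assms(4) by auto
  then show "v = 0\<^sub>v (dim_col (B * C))" using inj_matD[OF assms(3,4) v'] assms(4) by auto
qed

lemma inj_mat_square_surj:
  assumes inj: "inj_mat C" and C: "C \<in> carrier_mat r r" and v: "v \<in> carrier_vec r"
  shows "\<exists>w\<in>carrier_vec r. C *\<^sub>v w = v"
proof -
  have "det C \<noteq> 0"
    using inj C det_0_iff_vec_prod_zero[OF C] inj_matD[OF inj C] by auto
  then obtain D where D: "D \<in> carrier_mat r r" "C * D = 1\<^sub>m r"
    using det_non_zero_imp_unit[OF C] C unfolding Units_def ring_mat_def by auto
  then have "C *\<^sub>v (D *\<^sub>v v) = v"
    using assoc_mult_mat_vec[OF C D(1) v] v by simp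
  then show ?thesis using D v by auto
qed

text \<open>Padding a matrix that has more columns than rows with zero rows makes it square and singular, so
  it has a nonzero vector in its kernel.\<close>

lemma inj_mat_le:
  assumes inj: "inj_mat B" and B: "B \<in> carrier_mat n r"
  shows "r \<le> n"
proof (rule ccontr)
  assume "\<not> r \<le> n"
  then have nr: "n < r" by simp
  define B' where "B' = mat r r (\<lambda>(i,j). if i < n then B $$ (i,j) else 0)"
  have B': "B' \<in> carrier_mat r r" by (simp add: B'_def)
  have "B' = mat\<^sub>r r r (\<lambda>i. if i = n then 0\<^sub>v r else row B' i)"
    using nr by (intro eq_matI) (auto simp: B'_def)
  then have "det B' = 0"
    using det_row_0[of n r "\<lambda>i. row B' i"] nr B' by (auto simp: row_carrier_vec)
  then obtain v where v: "v \<in> carrier_vec r" "v \<noteq> 0\<^sub>v r" "B' *\<^sub>v v = 0\<^sub>v r"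
    using det_0_iff_vec_prod_zero[OF B'] by auto
  have "B *\<^sub>v v = 0\<^sub>v n"
  proof (rule eq_vecI)
    fix i assume "i < dim_vec (0\<^sub>v n :: complex vec)"
    then have i: "i < n" by simp
    have "row B i = row B' i" using i nr B by (intro eq_vecI) (auto simp: B'_def)
    then have "(B *\<^sub>v v) $ i = (B' *\<^sub>v v) $ i" using i nr B B' by simp
    then show "(B *\<^sub>v v) $ i = 0\<^sub>v n $ i" using v i nr by simp
  qed (use B in auto)
  then show False using inj_matD[OF inj B v(1)] v(2) by simp
qed

text \<open>An injective matrix with range in \<open>W\<close> and as many columns as possible spans \<open>W\<close>, since a vector of
  \<open>W\<close> outside its range could be appended as a further column.\<close>

lemma lin_closed_basis:
  assumes W: "lin_closed n W"
  shows "\<exists>r B. B \<in> carrier_mat n r \<and> inj_mat B \<and> W = (\<lambda>v. B *\<^sub>v v) ` carrier_vec r"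
proof -
  define P where "P r \<longleftrightarrow> (\<exists>B. B \<in> carrier_mat n r \<and> inj_mat B \<and> (\<forall>v\<in>carrier_vec r. B *\<^sub>v v \<in> W))" for r
  have "P 0" unfolding P_def
  proof (intro exI conjI ballI)
    fix v :: "complex vec" assume "v \<in> carrier_vec 0"
    then have "0\<^sub>m n 0 *\<^sub>v v = 0\<^sub>v n" by (intro eq_vecI) (auto simp: scalar_prod_def)
    then show "0\<^sub>m n 0 *\<^sub>v v \<in> W" using W by (simp add: lin_closed_def)
  qed (auto simp: inj_mat_def)
  moreover have le: "\<And>r. P r \<Longrightarrow> r \<le> n" unfolding P_def using inj_mat_le by blast
  ultimately obtain r where r: "P r" and max: "\<And>s. P s \<Longrightarrow> s \<le> r"
    using Nat.ex_has_greatest_nat[of P 0 n] by blast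
  from r obtain B where B: "B \<in> carrier_mat n r" and inj: "inj_mat B"
    and BW: "\<And>v. v \<in> carrier_vec r \<Longrightarrow> B *\<^sub>v v \<in> W" unfolding P_def by auto
  have "w \<in> (\<lambda>v. B *\<^sub>v v) ` carrier_vec r" if w: "w \<in> W" for w
  proof (rule ccontr)
    assume nin: "w \<notin> (\<lambda>v. B *\<^sub>v v) ` carrier_vec r"
    have wc: "w \<in> carrier_vec n" using w W by (auto simp: lin_closed_def)
    define B' where "B' = mat n (Suc r) (\<lambda>(i,j). if j < r then B $$ (i,j) else w $ i)"
    have B': "B' \<in> carrier_mat n (Suc r)" by (simp add: B'_def)
    have mult: "B' *\<^sub>v v = B *\<^sub>v (vec r (\<lambda>i. v $ i)) + (v $ r) \<cdot>\<^sub>v w" if v: "v \<in> carrier_vec (Suc r)" for v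
      using v B wc
      by (intro eq_vecI) (auto simp: B'_def scalar_prod_def row_def)
    have "inj_mat B'"
      unfolding inj_mat_def
    proof (intro ballI impI)
      fix v assume "v \<in> carrier_vec (dim_col B')" and eq: "B' *\<^sub>v v = 0\<^sub>v (dim_row B')"
      then have v: "v \<in> carrier_vec (Suc r)" using B' by simp
      define u where "u = vec r (\<lambda>i. v $ i)"
      have u: "u \<in> carrier_vec r" by (simp add: u_def)
      have eq': "B *\<^sub>v u + (v $ r) \<cdot>\<^sub>v w = 0\<^sub>v n" using eq mult[OF v] B' by (simp add: u_def)
      have "v $ r = 0"
      proof (rule ccontr)
        assume nz: "v $ r \<noteq> 0"
        have "w = B *\<^sub>v ((- 1 / v $ r) \<cdot>\<^sub>v u)"
        proof (rule eq_vecI)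
          fix i assume "i < dim_vec (B *\<^sub>v ((- 1 / v $ r) \<cdot>\<^sub>v u))"
          then have i: "i < n" using B by simp
          have "(B *\<^sub>v u + (v $ r) \<cdot>\<^sub>v w) $ i = 0" using eq' i by simp
          then have "(B *\<^sub>v u) $ i + v $ r * w $ i = 0" using i B wc by simp
          then have "v $ r * w $ i = - (B *\<^sub>v u) $ i" by (simp add: eq_neg_iff_add_eq_0 add.commute)
          then have "w $ i = (- 1 / v $ r) * (B *\<^sub>v u) $ i" using nz
            by (simp add: field_simps)
          then show "w $ i = (B *\<^sub>v ((- 1 / v $ r) \<cdot>\<^sub>v u)) $ i"
            using i B u by (simp add: mult_mat_vec)
        qed (use B wc in auto)
        then show False using nin u by auto
      qed
      moreover have "B *\<^sub>v u = 0\<^sub>v n"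
      proof -
        have "(v $ r) \<cdot>\<^sub>v w = 0\<^sub>v n" using \<open>v $ r = 0\<close> wc by auto
        then show ?thesis using eq' B u by auto
      qed
      then have "u = 0\<^sub>v r" using inj_matD[OF inj B u] by simp
      ultimately have "v $ i = 0" if "i < Suc r" for i
        using that by (cases "i = r") (auto simp: u_def less_Suc_eq dest: arg_cong[where f="\<lambda>x. x $ i"])
      then show "v = 0\<^sub>v (dim_col B')" using v B' by (intro eq_vecI) auto
    qed
    moreover have "B' *\<^sub>v v \<in> W" if v: "v \<in> carrier_vec (Suc r)" for v
      unfolding mult[OF v] using W w BW[of "vec r (\<lambda>i. v $ i)"] by (auto simp: lin_closed_def)
    ultimately have "P (Suc r)" unfolding P_def using B' by blast
    then show False using max by fastforce
  qed
  then show ?thesis using B inj BW by blast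
qed


section \<open>Subrepresentations and Schur's lemma\<close>

lemma is_repD:
  assumes "is_rep G d \<rho>"
  shows "g \<in> carrier G \<Longrightarrow> \<rho> g \<in> carrier_mat d d"
    and "\<rho> \<one>\<^bsub>G\<^esub> = 1\<^sub>m d"
    and "g \<in> carrier G \<Longrightarrow> h \<in> carrier G \<Longrightarrow> \<rho> (g \<otimes>\<^bsub>G\<^esub> h) = \<rho> g * \<rho> h"
  using assms unfolding is_rep_def by auto

lemma irreducible_repD:
  assumes "irreducible_rep G d \<rho>"
  shows "is_rep G d \<rho>" and "d \<noteq> 0"
    and "lin_closed d W \<Longrightarrow> (\<And>g w. g \<in> carrier G \<Longrightarrow> w \<in> W \<Longrightarrow> \<rho> g *\<^sub>v w \<in> W) \<Longrightarrow> W = {0\<^sub>v d} \<or> W = carrier_vec d"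
  using assms lin_closed_subspace unfolding irreducible_rep_def by auto

lemma rep_char_eq:
  assumes "is_rep G d \<rho>" "g \<in> carrier G"
  shows "rep_char \<rho> g = (\<Sum>i<d. \<rho> g $$ (i, i))"
  using is_repD(1)[OF assms] by (auto simp: rep_char_def)

text \<open>The columns of \<open>\<tau> g\<close> are the coordinates of \<open>\<rho> g * B\<close> with respect to the columns of \<open>B\<close>; as
  \<open>B\<close> can be cancelled, \<open>\<tau>\<close> inherits the homomorphism property from \<open>\<rho>\<close>.\<close>

lemma restrict_rep:
  fixes G (structure)
  assumes "group G" and rep: "is_rep G N \<rho>" and B: "B \<in> carrier_mat N r" and inj: "inj_mat B"
    and ran: "\<And>g v. g \<in> carrier G \<Longrightarrow> v \<in> carrier_vec r \<Longrightarrow> \<exists>u\<in>carrier_vec r. \<rho> g *\<^sub>v (B *\<^sub>v v) = B *\<^sub>v u"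
  shows "\<exists>\<tau>. is_rep G r \<tau> \<and> (\<forall>g\<in>carrier G. \<rho> g * B = B * \<tau> g)"
proof -
  interpret group G by fact
  have "\<forall>g k. \<exists>u. g \<in> carrier G \<and> k < r \<longrightarrow> u \<in> carrier_vec r \<and> \<rho> g *\<^sub>v (B *\<^sub>v unit_vec r k) = B *\<^sub>v u"
    using ran by (metis unit_vec_carrier)
  then obtain u where u: "\<And>g k. g \<in> carrier G \<Longrightarrow> k < r \<Longrightarrow> u g k \<in> carrier_vec r"
    "\<And>g k. g \<in> carrier G \<Longrightarrow> k < r \<Longrightarrow> \<rho> g *\<^sub>v (B *\<^sub>v unit_vec r k) = B *\<^sub>v u g k"
    by metis
  define \<tau> where "\<tau> g = mat r r (\<lambda>(i,k). u g k $ i)" for g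
  have \<tau>: "\<tau> g \<in> carrier_mat r r" for g by (simp add: \<tau>_def)
  have R: "\<rho> g \<in> carrier_mat N N" if "g \<in> carrier G" for g using is_repD(1)[OF rep that] .
  have eq: "\<rho> g * B = B * \<tau> g" if g: "g \<in> carrier G" for g
  proof (rule mat_col_eqI)
    fix k assume "k < dim_col (B * \<tau> g)"
    then have k: "k < r" by (simp add: \<tau>_def)
    have "col (\<tau> g) k = u g k" using u(1)[OF g k] k by (intro eq_vecI) (auto simp: \<tau>_def)
    moreover have "B *\<^sub>v unit_vec r k = col B k" by (rule mult_mat_unit_vec[OF B k])
    ultimately show "col (\<rho> g * B) k = col (B * \<tau> g) k"
      using u(2)[OF g k] col_mult2[OF R[OF g] B k] col_mult2[OF B \<tau> k] by simp
  qed (use R[OF g] B in \<open>auto simp: \<tau>_def\<close>)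
  have "is_rep G r \<tau>" unfolding is_rep_def
  proof (intro conjI ballI)
    show "\<tau> \<one> = 1\<^sub>m r"
    proof (rule inj_mat_cancel[OF inj B \<tau>])
      show "B * \<tau> \<one> = B * 1\<^sub>m r" using eq[OF one_closed] is_repD(2)[OF rep] B by simp
    qed simp
    fix g h assume g: "g \<in> carrier G" and h: "h \<in> carrier G"
    have "B * \<tau> (g \<otimes> h) = \<rho> g * \<rho> h * B"
      using eq[of "g \<otimes> h"] g h is_repD(3)[OF rep] by simp
    also have "\<dots> = \<rho> g * (B * \<tau> h)"
      using eq[OF h] assoc_mult_mat[OF R[OF g] R[OF h] B] by simp
    also have "\<dots> = B * \<tau> g * \<tau> h"
      using eq[OF g] assoc_mult_mat[OF R[OF g] B \<tau>[of h]] by simp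
    also have "\<dots> = B * (\<tau> g * \<tau> h)"
      by (rule assoc_mult_mat[OF B \<tau> \<tau>])
    finally show "\<tau> (g \<otimes> h) = \<tau> g * \<tau> h"
      by (rule inj_mat_cancel[OF inj B \<tau> mult_carrier_mat[OF \<tau> \<tau>]])
  qed (rule \<tau>)
  then show ?thesis using eq by blast
qed

text \<open>A nonzero invariant subspace of \<open>W\<close> of the smallest possible dimension is irreducible. It is
  presented by an injective intertwiner \<open>B\<close>, because irreducible representations are given by
  matrices.\<close>

lemma exists_irreducible_subrep:
  fixes G (structure)
  assumes G: "group G" and rep: "is_rep G N \<rho>" and W: "lin_closed N W"
    and inv: "\<And>g w. g \<in> carrier G \<Longrightarrow> w \<in> W \<Longrightarrow> \<rho> g *\<^sub>v w \<in> W" and ne: "W \<noteq> {0\<^sub>v N}"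
  shows "\<exists>r \<tau> B. irreducible_rep G r \<tau> \<and> B \<in> carrier_mat N r \<and> inj_mat B \<and>
    (\<forall>v\<in>carrier_vec r. B *\<^sub>v v \<in> W) \<and> (\<forall>g\<in>carrier G. \<rho> g * B = B * \<tau> g)"
proof -
  \<comment> \<open>\<open>P r\<close>: there is an invariant subspace of dimension \<open>r > 0\<close> inside \<open>W\<close>\<close>
  define P where "P r \<longleftrightarrow> r > 0 \<and> (\<exists>B. B \<in> carrier_mat N r \<and> inj_mat B \<and> (\<forall>v\<in>carrier_vec r. B *\<^sub>v v \<in> W) \<and>
     (\<forall>g\<in>carrier G. \<forall>v\<in>carrier_vec r. \<exists>u\<in>carrier_vec r. \<rho> g *\<^sub>v (B *\<^sub>v v) = B *\<^sub>v u))" for r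
  obtain r0 B0 where B0: "B0 \<in> carrier_mat N r0" "inj_mat B0" "W = (\<lambda>v. B0 *\<^sub>v v) ` carrier_vec r0"
    using lin_closed_basis[OF W] by blast
  have "r0 > 0"
  proof (rule ccontr)
    assume "\<not> r0 > 0"
    then have "W \<subseteq> {0\<^sub>v N}" using B0 by (auto simp: scalar_prod_def intro!: eq_vecI)
    then show False using ne W by (auto simp: lin_closed_def)
  qed
  moreover have "\<forall>g\<in>carrier G. \<forall>v\<in>carrier_vec r0. \<exists>u\<in>carrier_vec r0. \<rho> g *\<^sub>v (B0 *\<^sub>v v) = B0 *\<^sub>v u"
    using inv B0(3) by blast
  ultimately have "P r0" unfolding P_def using B0 by blast
  define r where "r = (LEAST r. P r)"
  have "P r" unfolding r_def by (rule LeastI, fact)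
  have least: "r \<le> s" if "P s" for s unfolding r_def by (rule Least_le, fact)
  from \<open>P r\<close> obtain B where r: "r > 0" and B: "B \<in> carrier_mat N r" and inj: "inj_mat B"
    and BW: "\<And>v. v \<in> carrier_vec r \<Longrightarrow> B *\<^sub>v v \<in> W"
    and ran: "\<And>g v. g \<in> carrier G \<Longrightarrow> v \<in> carrier_vec r \<Longrightarrow> \<exists>u\<in>carrier_vec r. \<rho> g *\<^sub>v (B *\<^sub>v v) = B *\<^sub>v u"
    unfolding P_def by auto
  obtain \<tau> where \<tau>: "is_rep G r \<tau>" and eq: "\<And>g. g \<in> carrier G \<Longrightarrow> \<rho> g * B = B * \<tau> g"
    using restrict_rep[OF G rep B inj ran] by blast
  have "irreducible_rep G r \<tau>" unfolding irreducible_rep_def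
  proof (intro conjI allI impI)
    fix U assume "VectorSpace.subspace class_ring U (module_vec TYPE(complex) r)"
      and Uinv: "\<forall>g\<in>carrier G. \<forall>w\<in>U. \<tau> g *\<^sub>v w \<in> U"
    then have U: "lin_closed r U" by (intro subspace_lin_closed)
    obtain s C where C: "C \<in> carrier_mat r s" and injC: "inj_mat C" and UC: "U = (\<lambda>v. C *\<^sub>v v) ` carrier_vec s"
      using lin_closed_basis[OF U] by blast
    show "U = {0\<^sub>v r} \<or> U = carrier_vec r"
    proof (cases "s = 0")
      case True
      then have "U \<subseteq> {0\<^sub>v r}" using UC C by (auto simp: scalar_prod_def intro!: eq_vecI)
      then show ?thesis using U by (auto simp: lin_closed_def)
    next
      case False
      have "P s" unfolding P_def
      proof (intro conjI exI ballI)
        show "0 < s" using False by simp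
        show "B * C \<in> carrier_mat N s" using B C by simp
        show "inj_mat (B * C)" by (rule inj_mat_mult[OF inj B injC C])
        fix v :: "complex vec" assume v: "v \<in> carrier_vec s"
        show "B * C *\<^sub>v v \<in> W" using BW[of "C *\<^sub>v v"] v C assoc_mult_mat_vec[OF B C v] by simp
        fix g assume g: "g \<in> carrier G"
        have "\<tau> g *\<^sub>v (C *\<^sub>v v) \<in> U" using Uinv g UC v by blast
        then obtain u where u: "u \<in> carrier_vec s" "\<tau> g *\<^sub>v (C *\<^sub>v v) = C *\<^sub>v u" using UC by blast
        have Cv: "C *\<^sub>v v \<in> carrier_vec r" using C v by simp
        have "\<rho> g *\<^sub>v (B * C *\<^sub>v v) = (\<rho> g * B) *\<^sub>v (C *\<^sub>v v)"
          using assoc_mult_mat_vec[OF B C v] assoc_mult_mat_vec[OF is_repD(1)[OF rep g] B Cv] by simp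
        also have "\<dots> = B *\<^sub>v (\<tau> g *\<^sub>v (C *\<^sub>v v))"
          using eq[OF g] assoc_mult_mat_vec[OF B is_repD(1)[OF \<tau> g] Cv] by simp
        also have "\<dots> = B * C *\<^sub>v u" using u assoc_mult_mat_vec[OF B C u(1)] by simp
        finally show "\<exists>u\<in>carrier_vec s. \<rho> g *\<^sub>v (B * C *\<^sub>v v) = B * C *\<^sub>v u" using u(1) by blast
      qed
      then have "s = r" using least inj_mat_le[OF injC C] by fastforce
      then have "carrier_vec r \<subseteq> U" using inj_mat_square_surj[OF injC] C UC by blast
      then show ?thesis using U by (auto simp: lin_closed_def)
    qed
  qed (use \<tau> r in auto)
  then show ?thesis using B inj BW eq by blast
qed

text \<open>Kernel and range of \<open>T\<close> are invariant, so irreducibility makes \<open>T\<close> injective and surjective. A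
  right inverse of \<open>T\<close> is then injective as well, and comparing the shapes of the two matrices
  gives \<open>d = d'\<close>.\<close>

lemma schur_iso:
  assumes irr: "irreducible_rep G d \<rho>" "irreducible_rep G d' \<sigma>" and T: "T \<in> carrier_mat d' d"
    and eq: "\<And>g. g \<in> carrier G \<Longrightarrow> T * \<rho> g = \<sigma> g * T" and nz: "T \<noteq> 0\<^sub>m d' d"
  shows "rep_iso G d \<rho> d' \<sigma>"
proof -
  note rep = irreducible_repD(1)[OF irr(1)] irreducible_repD(1)[OF irr(2)]
  have Teq: "T *\<^sub>v (\<rho> g *\<^sub>v v) = \<sigma> g *\<^sub>v (T *\<^sub>v v)" if "g \<in> carrier G" "v \<in> carrier_vec d" for g v
    using eq[OF that(1)] assoc_mult_mat_vec[OF T is_repD(1)[OF rep(1) that(1)] that(2)]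
      assoc_mult_mat_vec[OF is_repD(1)[OF rep(2) that(1)] T that(2)] by simp
  have T0: "T = 0\<^sub>m d' d" if "\<And>v. v \<in> carrier_vec d \<Longrightarrow> T *\<^sub>v v = 0\<^sub>v d'"
    using that T by (intro mat_eq_iff_mult_vec[OF T]) auto
  let ?K = "{v \<in> carrier_vec d. T *\<^sub>v v = 0\<^sub>v d'}"
  have "lin_closed d ?K" using T
    by (auto simp: lin_closed_def mult_add_distrib_mat_vec mult_mat_vec)
  moreover have "\<rho> g *\<^sub>v w \<in> ?K" if "g \<in> carrier G" "w \<in> ?K" for g w
    using that Teq[OF that(1), of w] is_repD(1)[OF rep(1) that(1)] is_repD(1)[OF rep(2) that(1)] by auto
  ultimately have K: "?K = {0\<^sub>v d} \<or> ?K = carrier_vec d" by (rule irreducible_repD(3)[OF irr(1)])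
  then have K: "?K = {0\<^sub>v d}" using T0 nz by blast
  then have injT: "inj_mat T" using T by (auto simp: inj_mat_def)
  let ?L = "(\<lambda>v. T *\<^sub>v v) ` carrier_vec d"
  have "lin_closed d' ?L" unfolding lin_closed_def
  proof (intro conjI ballI allI)
    show "?L \<subseteq> carrier_vec d'" using T by auto
    show "0\<^sub>v d' \<in> ?L" using K by (metis (mono_tags, lifting) image_eqI insertI1 mem_Collect_eq)
    fix v assume "v \<in> ?L"
    then obtain v' where v': "v' \<in> carrier_vec d" "v = T *\<^sub>v v'" by auto
    { fix w assume "w \<in> ?L"
      then obtain w' where w': "w' \<in> carrier_vec d" "w = T *\<^sub>v w'" by auto
      have "v + w = T *\<^sub>v (v' + w')" using v' w' T by (simp add: mult_add_distrib_mat_vec)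
      then show "v + w \<in> ?L" using v' w' by auto }
    fix c
    have "c \<cdot>\<^sub>v v = T *\<^sub>v (c \<cdot>\<^sub>v v')" using v' T by (simp add: mult_mat_vec)
    then show "c \<cdot>\<^sub>v v \<in> ?L" using v' by auto
  qed
  moreover have "\<sigma> g *\<^sub>v w \<in> ?L" if g: "g \<in> carrier G" and "w \<in> ?L" for g w
  proof -
    from \<open>w \<in> ?L\<close> obtain v where v: "v \<in> carrier_vec d" "w = T *\<^sub>v v" by auto
    show ?thesis using Teq[OF g v(1)] v is_repD(1)[OF rep(1) g] by (metis image_eqI mult_mat_vec_carrier)
  qed
  ultimately have "?L = {0\<^sub>v d'} \<or> ?L = carrier_vec d'" by (rule irreducible_repD(3)[OF irr(2)])
  then have L: "?L = carrier_vec d'" using T0 nz by blast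
  have "\<forall>k. \<exists>u. k < d' \<longrightarrow> u \<in> carrier_vec d \<and> T *\<^sub>v u = unit_vec d' k"
    using L by (metis (mono_tags, lifting) image_iff unit_vec_carrier)
  then obtain u where u: "\<And>k. k < d' \<Longrightarrow> u k \<in> carrier_vec d" "\<And>k. k < d' \<Longrightarrow> T *\<^sub>v u k = unit_vec d' k"
    by metis
  define S where "S = mat d d' (\<lambda>(i,k). u k $ i)"
  have S: "S \<in> carrier_mat d d'" by (simp add: S_def)
  have TS: "T * S = 1\<^sub>m d'"
  proof (rule mat_col_eqI)
    fix k assume "k < dim_col (1\<^sub>m d' :: complex mat)"
    then have k: "k < d'" by simp
    have "col S k = u k" using u(1)[OF k] k by (intro eq_vecI) (auto simp: S_def)
    then show "col (T * S) k = col (1\<^sub>m d') k" using u(2)[OF k] col_mult2[OF T S k] k by simp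
  qed (use T S in auto)
  have "inj_mat S" unfolding inj_mat_def
  proof (intro ballI impI)
    fix v assume "v \<in> carrier_vec (dim_col S)" and v0: "S *\<^sub>v v = 0\<^sub>v (dim_row S)"
    then have v: "v \<in> carrier_vec d'" using S by simp
    have "v = T *\<^sub>v (S *\<^sub>v v)" using assoc_mult_mat_vec[OF T S v] TS v by simp
    also have "\<dots> = 0\<^sub>v d'" using v0 S T by auto
    finally show "v = 0\<^sub>v (dim_col S)" using S by simp
  qed
  then have dd: "d = d'" using inj_mat_le[OF _ S] inj_mat_le[OF injT T] by simp
  have "S * T = 1\<^sub>m d"
  proof (rule inj_mat_cancel[OF injT T])
    have "T * (S * T) = T * S * T" by (rule assoc_mult_mat[OF T S T, symmetric])
    then show "T * (S * T) = T * 1\<^sub>m d" using TS T by simp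
  qed (use S T in auto)
  then have "invertible_mat T" using TS T S dd
    unfolding invertible_mat_def inverts_mat_def by (auto intro!: exI[of _ S])
  then show ?thesis unfolding rep_iso_def using dd T eq by auto
qed

text \<open>An eigenspace of \<open>T\<close> is invariant and nonzero, hence the whole space.\<close>

lemma schur_scalar:
  assumes irr: "irreducible_rep G d \<rho>" and T: "T \<in> carrier_mat d d"
    and eq: "\<And>g. g \<in> carrier G \<Longrightarrow> T * \<rho> g = \<rho> g * T"
  shows "\<exists>c. T = c \<cdot>\<^sub>m 1\<^sub>m d"
proof -
  note rep = irreducible_repD(1)[OF irr]
  obtain c where "eigenvalue T c"
    using spectrum_non_empty[OF T] irreducible_repD(2)[OF irr] by (auto simp: spectrum_def)
  then obtain v where v: "v \<in> carrier_vec d" "v \<noteq> 0\<^sub>v d" "T *\<^sub>v v = c \<cdot>\<^sub>v v"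
    using T unfolding eigenvalue_def eigenvector_def by auto
  let ?K = "{v \<in> carrier_vec d. T *\<^sub>v v = c \<cdot>\<^sub>v v}"
  have "lin_closed d ?K" using T
    by (auto simp: lin_closed_def mult_add_distrib_mat_vec mult_mat_vec smult_add_distrib_vec smult_smult_assoc mult.commute)
  moreover have "\<rho> g *\<^sub>v w \<in> ?K" if g: "g \<in> carrier G" and w: "w \<in> ?K" for g w
  proof -
    have R: "\<rho> g \<in> carrier_mat d d" by (rule is_repD(1)[OF rep g])
    have "T *\<^sub>v (\<rho> g *\<^sub>v w) = \<rho> g *\<^sub>v (T *\<^sub>v w)"
      using eq[OF g] w assoc_mult_mat_vec[OF T R, of w] assoc_mult_mat_vec[OF R T, of w] by simp
    then show ?thesis using w R by (auto simp: mult_mat_vec)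
  qed
  ultimately have "?K = {0\<^sub>v d} \<or> ?K = carrier_vec d" by (rule irreducible_repD(3)[OF irr])
  then have K: "?K = carrier_vec d" using v by blast
  have "T = c \<cdot>\<^sub>m 1\<^sub>m d"
  proof (rule mat_eq_iff_mult_vec[OF T])
    fix v :: "complex vec" assume v: "v \<in> carrier_vec d"
    have "(c \<cdot>\<^sub>m 1\<^sub>m d) *\<^sub>v v = c \<cdot>\<^sub>v v" 
    proof (rule eq_vecI)
      fix i assume "i < dim_vec (c \<cdot>\<^sub>v v)"
      then have i: "i < d" using v by simp
      have "((c \<cdot>\<^sub>m 1\<^sub>m d) *\<^sub>v v) $ i = (\<Sum>j<d. if j = i then c * v $ j else 0)"
        unfolding mult_mat_vec_entry[OF smult_carrier_mat[OF one_carrier_mat] v i]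
        using i by (intro sum.cong) auto
      then show "((c \<cdot>\<^sub>m 1\<^sub>m d) *\<^sub>v v) $ i = (c \<cdot>\<^sub>v v) $ i" using i v by simp
    qed (use v in auto)
    then show "T *\<^sub>v v = (c \<cdot>\<^sub>m 1\<^sub>m d) *\<^sub>v v" using K v by auto
  qed simp
  then show ?thesis by blast
qed


section \<open>Orthogonality and completeness of characters\<close>

locale finite_group = group +
  assumes fin: "finite (carrier G)"
begin

lemma sum_left_translate:
  assumes "h \<in> carrier G"
  shows "(\<Sum>g\<in>carrier G. f (h \<otimes> g)) = (\<Sum>g\<in>carrier G. f g)"
  by (rule sum.reindex_bij_witness[of _ "\<lambda>g. inv h \<otimes> g" "\<lambda>g. h \<otimes> g"])
     (use assms in \<open>auto simp: m_assoc[symmetric]\<close>)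

lemma sum_conjugate:
  assumes "h \<in> carrier G"
  shows "(\<Sum>g\<in>carrier G. f (h \<otimes> g \<otimes> inv h)) = (\<Sum>g\<in>carrier G. f g)"
  by (rule sum.reindex_bij_witness[of _ "\<lambda>g. inv h \<otimes> g \<otimes> h" "\<lambda>g. h \<otimes> g \<otimes> inv h"])
     (use assms in \<open>auto simp: m_assoc[symmetric], auto simp: m_assoc\<close>)

lemma order_pos: "Coset.order G > 0"
  using fin by (auto simp: Coset.order_def card_gt_0_iff)

lemma rep_entry_mult:
  assumes "is_rep G d \<rho>" "g \<in> carrier G" "h \<in> carrier G" "p < d" "q < d"
  shows "\<rho> (g \<otimes> h) $$ (p, q) = (\<Sum>s<d. \<rho> g $$ (p, s) * \<rho> h $$ (s, q))"
  using mult_mat_entry[OF is_repD(1)[OF assms(1,2)] is_repD(1)[OF assms(1,3)] assms(4,5)]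
    is_repD(3)[OF assms(1-3)] by simp

text \<open>\<open>T\<close> is the matrix \<open>\<Sum>\<^sub>g \<rho>(g) E\<^sub>a\<^sub>b \<sigma>(g)\<inverse>\<close>, where \<open>E\<^sub>a\<^sub>b\<close> is an elementary matrix; averages of this
  form intertwine \<open>\<sigma>\<close> and \<open>\<rho>\<close>.\<close>

lemma sum_intertwiner:
  assumes \<rho>: "is_rep G d \<rho>" and \<sigma>: "is_rep G d' \<sigma>" and a: "a < d" and b: "b < d'"
    and h: "h \<in> carrier G"
  defines "T \<equiv> mat d d' (\<lambda>(p,q). \<Sum>g\<in>carrier G. \<rho> g $$ (p,a) * \<sigma> (inv g) $$ (b,q))"
  shows "T * \<sigma> h = \<rho> h * T"
proof (rule eq_matI)
  have R: "\<rho> h \<in> carrier_mat d d" "\<sigma> h \<in> carrier_mat d' d'"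
    using is_repD(1)[OF \<rho> h] is_repD(1)[OF \<sigma> h] .
  have T: "T \<in> carrier_mat d d'" by (simp add: T_def)
  fix p q assume "p < dim_row (\<rho> h * T)" "q < dim_col (\<rho> h * T)"
  then have p: "p < d" and q: "q < d'" using R T by auto
  have "(\<rho> h * T) $$ (p,q) = (\<Sum>s<d. \<Sum>g\<in>carrier G. \<rho> h $$ (p,s) * (\<rho> g $$ (s,a) * \<sigma> (inv g) $$ (b,q)))"
    unfolding mult_mat_entry[OF R(1) T p q] using q by (simp add: T_def sum_distrib_left)
  also have "\<dots> = (\<Sum>g\<in>carrier G. \<rho> (h \<otimes> g) $$ (p,a) * \<sigma> (inv g) $$ (b,q))"
    by (subst sum.swap) (auto simp: rep_entry_mult[OF \<rho> h _ p a] sum_distrib_right mult.assoc intro!: sum.cong)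
  also have "\<dots> = (\<Sum>g\<in>carrier G. (\<lambda>g. \<rho> g $$ (p,a) * \<sigma> (inv g \<otimes> h) $$ (b,q)) (h \<otimes> g))"
    using h by (intro sum.cong) (auto simp: inv_mult_group m_assoc)
  also have "\<dots> = (\<Sum>g\<in>carrier G. \<rho> g $$ (p,a) * \<sigma> (inv g \<otimes> h) $$ (b,q))"
    by (rule sum_left_translate[OF h])
  also have "\<dots> = (\<Sum>s<d'. \<Sum>g\<in>carrier G. (\<rho> g $$ (p,a) * \<sigma> (inv g) $$ (b,s)) * \<sigma> h $$ (s,q))"
    by (subst sum.swap) (auto simp: rep_entry_mult[OF \<sigma> _ h b q] sum_distrib_left mult.assoc intro!: sum.cong)
  also have "\<dots> = (T * \<sigma> h) $$ (p,q)"
    unfolding mult_mat_entry[OF T R(2) p q] using p by (simp add: T_def sum_distrib_right)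
  finally show "(T * \<sigma> h) $$ (p,q) = (\<rho> h * T) $$ (p,q)" by simp
qed (use is_repD(1)[OF \<rho> h] is_repD(1)[OF \<sigma> h] in \<open>auto simp: T_def\<close>)

text \<open>By Schur's lemma all averaged elementary matrices vanish. The product of the two characters is the
  sum of the entries \<open>(a, b)\<close> of the averages of \<open>E\<^sub>a\<^sub>b\<close>.\<close>

lemma char_orthogonal_distinct:
  assumes \<rho>: "irreducible_rep G d \<rho>" and \<sigma>: "irreducible_rep G d' \<sigma>"
    and ni: "\<not> rep_iso G d' \<sigma> d \<rho>"
  shows "(\<Sum>g\<in>carrier G. rep_char \<rho> g * rep_char \<sigma> (inv g)) = 0"
proof -
  note r = irreducible_repD(1)[OF \<rho>] and s = irreducible_repD(1)[OF \<sigma>]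
  have z: "(\<Sum>g\<in>carrier G. \<rho> g $$ (p,p) * \<sigma> (inv g) $$ (q,q)) = 0" if p: "p < d" and q: "q < d'" for p q
  proof -
    define T where "T = mat d d' (\<lambda>(p',q'). \<Sum>g\<in>carrier G. \<rho> g $$ (p',p) * \<sigma> (inv g) $$ (q,q'))"
    have "T = 0\<^sub>m d d'"
      using schur_iso[OF \<sigma> \<rho>, of T] sum_intertwiner[OF r s p q] ni by (auto simp: T_def)
    then have "T $$ (p,q) = 0" using p q by simp
    then show ?thesis using p q by (simp add: T_def)
  qed
  have "(\<Sum>g\<in>carrier G. rep_char \<rho> g * rep_char \<sigma> (inv g)) =
      (\<Sum>g\<in>carrier G. \<Sum>p<d. \<Sum>q<d'. \<rho> g $$ (p,p) * \<sigma> (inv g) $$ (q,q))"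
    by (intro sum.cong) (auto simp: rep_char_eq[OF r] rep_char_eq[OF s] sum_product)
  also have "\<dots> = (\<Sum>p<d. \<Sum>q<d'. \<Sum>g\<in>carrier G. \<rho> g $$ (p,p) * \<sigma> (inv g) $$ (q,q))"
    by (subst sum.swap, intro sum.cong refl, subst sum.swap) simp
  also have "\<dots> = 0" using z by simp
  finally show ?thesis .
qed

text \<open>The average of \<open>E\<^sub>a\<^sub>b\<close> is now a scalar, and its trace determines this scalar: it is \<open>|G|/d\<close> for
  \<open>a = b\<close> and \<open>0\<close> otherwise.\<close>

lemma char_norm:
  assumes \<rho>: "irreducible_rep G d \<rho>"
  shows "(\<Sum>g\<in>carrier G. rep_char \<rho> g * rep_char \<rho> (inv g)) = of_nat (Coset.order G)"
proof -
  note r = irreducible_repD(1)[OF \<rho>] 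
  define T where "T a b = mat d d (\<lambda>(p,q). \<Sum>g\<in>carrier G. \<rho> g $$ (p,a) * \<rho> (inv g) $$ (b,q))" for a b
  have Tc: "T a b \<in> carrier_mat d d" for a b by (simp add: T_def)
  have "\<exists>c. T a b = c \<cdot>\<^sub>m 1\<^sub>m d" if "a < d" "b < d" for a b
    using sum_intertwiner[OF r r that] by (intro schur_scalar[OF \<rho> Tc]) (simp add: T_def)
  then have "\<forall>a b. \<exists>c. a < d \<and> b < d \<longrightarrow> T a b = c \<cdot>\<^sub>m 1\<^sub>m d" by blast
  then obtain c where c: "\<And>a b. a < d \<Longrightarrow> b < d \<Longrightarrow> T a b = c a b \<cdot>\<^sub>m 1\<^sub>m d" by metis
  have cval: "of_nat d * c a b = (if a = b then of_nat (Coset.order G) else 0)" if a: "a < d" and b: "b < d" for a b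
  proof -
    have "of_nat d * c a b = (\<Sum>p<d. T a b $$ (p,p))" using c[OF a b] by simp
    also have "\<dots> = (\<Sum>p<d. \<Sum>g\<in>carrier G. \<rho> (inv g) $$ (b,p) * \<rho> g $$ (p,a))"
      by (intro sum.cong) (auto simp: T_def mult.commute)
    also have "\<dots> = (\<Sum>g\<in>carrier G. \<rho> (inv g \<otimes> g) $$ (b,a))"
      by (subst sum.swap, intro sum.cong refl rep_entry_mult[OF r _ _ b a, symmetric]) auto
    also have "\<dots> = (\<Sum>g\<in>carrier G. if a = b then 1 else 0)"
      using a b by (intro sum.cong) (auto simp: is_repD(2)[OF r])
    finally show ?thesis by (auto simp: Coset.order_def)
  qed
  have "(\<Sum>g\<in>carrier G. rep_char \<rho> g * rep_char \<rho> (inv g)) =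
      (\<Sum>g\<in>carrier G. \<Sum>p<d. \<Sum>q<d. \<rho> g $$ (p,p) * \<rho> (inv g) $$ (q,q))"
    by (intro sum.cong) (auto simp: rep_char_eq[OF r] sum_product)
  also have "\<dots> = (\<Sum>p<d. \<Sum>q<d. \<Sum>g\<in>carrier G. \<rho> g $$ (p,p) * \<rho> (inv g) $$ (q,q))"
    by (subst sum.swap, intro sum.cong refl, subst sum.swap) simp
  also have "\<dots> = (\<Sum>p<d. \<Sum>q<d. T p q $$ (p,q))" by (intro sum.cong) (auto simp: T_def)
  also have "\<dots> = (\<Sum>p<d. \<Sum>q<d. if p = q then c p p else 0)"
    by (intro sum.cong) (auto simp: c)
  also have "\<dots> = (\<Sum>p<d. c p p)" by (simp add: sum.delta')
  also have "\<dots> = (\<Sum>p<d. of_nat (Coset.order G) / of_nat d)"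
    using cval irreducible_repD(2)[OF \<rho>] by (intro sum.cong) (auto simp: field_simps)
  also have "\<dots> = of_nat (Coset.order G)" using irreducible_repD(2)[OF \<rho>] by simp
  finally show ?thesis .
qed

definition class_fun :: "('a \<Rightarrow> complex) \<Rightarrow> bool" where
  "class_fun \<phi> \<longleftrightarrow> (\<forall>g\<in>carrier G. \<forall>h\<in>carrier G. \<phi> (h \<otimes> g \<otimes> inv h) = \<phi> g)"

text \<open>Since \<open>\<phi>\<close> is a class function, \<open>\<Sum>\<^sub>g \<phi>(g) \<rho>(g)\<inverse>\<close> commutes with \<open>\<rho>\<close>. It is therefore a scalar, and
  the hypothesis says that its trace is zero.\<close>

lemma class_sum_vanishes:
  assumes \<rho>: "irreducible_rep G d \<rho>" and \<phi>: "class_fun \<phi>"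
    and z: "(\<Sum>g\<in>carrier G. \<phi> g * rep_char \<rho> (inv g)) = 0" and p: "p < d" and q: "q < d"
  shows "(\<Sum>g\<in>carrier G. \<phi> g * \<rho> (inv g) $$ (p,q)) = 0"
proof -
  note r = irreducible_repD(1)[OF \<rho>]
  define T where "T = mat d d (\<lambda>(p,q). \<Sum>g\<in>carrier G. \<phi> g * \<rho> (inv g) $$ (p,q))"
  have T: "T \<in> carrier_mat d d" by (simp add: T_def)
  have "T * \<rho> h = \<rho> h * T" if h: "h \<in> carrier G" for h
  proof (rule eq_matI)
    have R: "\<rho> h \<in> carrier_mat d d" using is_repD(1)[OF r h] .
    fix p q assume "p < dim_row (\<rho> h * T)" "q < dim_col (\<rho> h * T)"
    then have p: "p < d" and q: "q < d" using R T by auto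
    have "(\<rho> h * T) $$ (p,q) = (\<Sum>s<d. \<Sum>g\<in>carrier G. \<phi> g * (\<rho> h $$ (p,s) * \<rho> (inv g) $$ (s,q)))"
      unfolding mult_mat_entry[OF R T p q] using q by (simp add: T_def sum_distrib_left mult_ac)
    also have "\<dots> = (\<Sum>g\<in>carrier G. \<phi> g * \<rho> (h \<otimes> inv g) $$ (p,q))"
      by (subst sum.swap) (auto simp: rep_entry_mult[OF r h _ p q] sum_distrib_left intro!: sum.cong)
    also have "\<dots> = (\<Sum>g\<in>carrier G. (\<lambda>g. \<phi> g * \<rho> (inv g \<otimes> h) $$ (p,q)) (h \<otimes> g \<otimes> inv h))"
    proof (intro sum.cong refl)
      fix g assume g: "g \<in> carrier G"
      have "inv (h \<otimes> g \<otimes> inv h) \<otimes> h = h \<otimes> inv g"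
        using g h by (simp add: inv_mult_group m_assoc)
      then show "\<phi> g * \<rho> (h \<otimes> inv g) $$ (p,q) = (\<lambda>g. \<phi> g * \<rho> (inv g \<otimes> h) $$ (p,q)) (h \<otimes> g \<otimes> inv h)"
        using \<phi> g h by (simp add: class_fun_def)
    qed
    also have "\<dots> = (\<Sum>g\<in>carrier G. \<phi> g * \<rho> (inv g \<otimes> h) $$ (p,q))"
      by (rule sum_conjugate[OF h])
    also have "\<dots> = (\<Sum>s<d. \<Sum>g\<in>carrier G. \<phi> g * \<rho> (inv g) $$ (p,s) * \<rho> h $$ (s,q))"
      by (subst sum.swap) (auto simp: rep_entry_mult[OF r _ h p q] sum_distrib_left mult.assoc intro!: sum.cong)
    also have "\<dots> = (T * \<rho> h) $$ (p,q)"
      unfolding mult_mat_entry[OF T R p q] using p by (simp add: T_def sum_distrib_right)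
    finally show "(T * \<rho> h) $$ (p,q) = (\<rho> h * T) $$ (p,q)" by simp
  qed (use is_repD(1)[OF r h] in \<open>auto simp: T_def\<close>)
  then obtain c where c: "T = c \<cdot>\<^sub>m 1\<^sub>m d" using schur_scalar[OF \<rho> T] by blast
  have "of_nat d * c = (\<Sum>p<d. T $$ (p,p))" using c by simp
  also have "\<dots> = (\<Sum>p<d. \<Sum>g\<in>carrier G. \<phi> g * \<rho> (inv g) $$ (p,p))" by (simp add: T_def)
  also have "\<dots> = (\<Sum>g\<in>carrier G. \<phi> g * rep_char \<rho> (inv g))"
    by (subst sum.swap) (auto simp: rep_char_eq[OF r] sum_distrib_left intro!: sum.cong)
  finally have "c = 0" using z irreducible_repD(2)[OF \<rho>] by simp
  then have "T $$ (p,q) = 0" using c p q by simp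
  then show ?thesis using p q by (simp add: T_def)
qed

text \<open>The irreducible characters are complete. Let \<open>A = \<Sum>\<^sub>g \<phi>(g) L(g)\<inverse>\<close>, where \<open>L\<close> is the regular
  representation, and let \<open>A'\<close> be its adjoint. If \<open>\<phi>\<close> is not zero, the range of \<open>A'\<close> is a nonzero
  invariant subspace, and it contains an irreducible one, on which \<open>A\<close> vanishes by
  \<open>class_sum_vanishes\<close>. A vector \<open>y = A' x\<close> in the latter satisfies
  \<open>\<langle>y, y\<rangle> = \<langle>x, A y\<rangle> = 0\<close>, a contradiction.\<close>

lemma class_fun_zero:
  assumes \<phi>: "class_fun \<phi>"
    and z: "\<And>d \<rho>. irreducible_rep G d \<rho> \<Longrightarrow> (\<Sum>g\<in>carrier G. \<phi> g * rep_char \<rho> (inv g)) = 0"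
    and g: "g \<in> carrier G"
  shows "\<phi> g = 0"
proof (rule ccontr)
  assume nz: "\<phi> g \<noteq> 0"
  define N where "N = card (carrier G)"
  obtain el where el: "bij_betw el {..<N} (carrier G)"
    using ex_bij_betw_nat_finite[OF fin] by (auto simp: N_def atLeast0LessThan)
  define ix where "ix = inv_into {..<N} el"
  have elc: "el a \<in> carrier G" if "a < N" for a using el that by (auto simp: bij_betw_def)
  have ixc: "ix x < N" "el (ix x) = x" if "x \<in> carrier G" for x
    using el that bij_betw_inv_into_right[OF el] inv_into_into[of x el "{..<N}"]
    by (auto simp: ix_def bij_betw_def)
  have elix: "el a = x \<longleftrightarrow> a = ix x" if "a < N" "x \<in> carrier G" for a x
    using that el ixc by (auto simp: bij_betw_def inj_on_def)
  define L where "L g = mat N N (\<lambda>(a,b). if a = ix (g \<otimes> el b) then 1 else (0::complex))" for g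
  have Lc: "L g \<in> carrier_mat N N" for g by (simp add: L_def)
  have rep: "is_rep G N L" unfolding is_rep_def
  proof (intro conjI ballI)
    show "L \<one> = 1\<^sub>m N"
      using el by (intro eq_matI) (auto simp: L_def elc elix[symmetric] bij_betw_def inj_on_def)
    fix g h assume g: "g \<in> carrier G" and h: "h \<in> carrier G"
    show "L (g \<otimes> h) = L g * L h"
    proof (rule eq_matI)
      fix a c assume "a < dim_row (L g * L h)" "c < dim_col (L g * L h)"
      then have a: "a < N" and c: "c < N" by (auto simp: L_def)
      have "(L g * L h) $$ (a,c) = (\<Sum>b<N. if b = ix (h \<otimes> el c) then L g $$ (a,b) else 0)"
        unfolding mult_mat_entry[OF Lc Lc a c] using c by (intro sum.cong) (auto simp: L_def)
      also have "\<dots> = L g $$ (a, ix (h \<otimes> el c))"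
        using h c elc ixc by simp
      also have "\<dots> = L (g \<otimes> h) $$ (a,c)"
        using a c g h elc ixc by (simp add: L_def m_assoc)
      finally show "L (g \<otimes> h) $$ (a,c) = (L g * L h) $$ (a,c)" by simp
    qed (auto simp: L_def)
  qed (rule Lc)
  \<comment> \<open>the elements of the group are numbered by \<open>el\<close>; the entries of \<open>A\<close> are those of the sum over the group in \<open>A_sum\<close>\<close>
  define A where "A = mat N N (\<lambda>(a,b). \<phi> (el b \<otimes> inv (el a)))"
  define A' where "A' = mat N N (\<lambda>(a,b). cnj (\<phi> (el a \<otimes> inv (el b))))"
  have A: "A \<in> carrier_mat N N" and A': "A' \<in> carrier_mat N N" by (auto simp: A_def A'_def)
  have A_sum: "A $$ (a,b) = (\<Sum>g\<in>carrier G. \<phi> g * L (inv g) $$ (a,b))" if a: "a < N" and b: "b < N" for a b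
  proof -
    have "(\<Sum>g\<in>carrier G. \<phi> g * L (inv g) $$ (a,b)) = (\<Sum>g\<in>carrier G. if g = el b \<otimes> inv (el a) then \<phi> g else 0)"
    proof (intro sum.cong refl)
      fix g assume g: "g \<in> carrier G"
      have "a = ix (inv g \<otimes> el b) \<longleftrightarrow> el a = inv g \<otimes> el b" using elix[OF a] g elc[OF b] by simp
      also have "\<dots> \<longleftrightarrow> g = el b \<otimes> inv (el a)"
        using g elc[OF a] elc[OF b]
        by (metis inv_closed inv_inv inv_solve_left inv_solve_right)
      finally show "\<phi> g * L (inv g) $$ (a,b) = (if g = el b \<otimes> inv (el a) then \<phi> g else 0)"
        using a b by (simp add: L_def)
    qed
    also have "\<dots> = \<phi> (el b \<otimes> inv (el a))" using fin elc[OF a] elc[OF b] by simp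
    finally show ?thesis using a b by (simp add: A_def)
  qed
  define W where "W = (\<lambda>v. A' *\<^sub>v v) ` carrier_vec N"
  have W: "lin_closed N W" unfolding lin_closed_def W_def
  proof (intro conjI ballI allI)
    show "0\<^sub>v N \<in> (\<lambda>v. A' *\<^sub>v v) ` carrier_vec N"
      using A' by (auto intro!: image_eqI[of _ _ "0\<^sub>v N"])
    fix v w c assume v: "v \<in> (\<lambda>v. A' *\<^sub>v v) ` carrier_vec N"
    then obtain v' where v': "v' \<in> carrier_vec N" "v = A' *\<^sub>v v'" by auto
    { fix w assume w: "w \<in> (\<lambda>v. A' *\<^sub>v v) ` carrier_vec N"
      then obtain w' where w': "w' \<in> carrier_vec N" "w = A' *\<^sub>v w'" by auto
      show "v + w \<in> (\<lambda>v. A' *\<^sub>v v) ` carrier_vec N"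
        using v' w' A' by (auto simp: mult_add_distrib_mat_vec intro!: image_eqI[of _ _ "v' + w'"]) }
    fix c show "c \<cdot>\<^sub>v v \<in> (\<lambda>v. A' *\<^sub>v v) ` carrier_vec N"
      using v' A' by (auto simp: mult_mat_vec intro!: image_eqI[of _ _ "c \<cdot>\<^sub>v v'"])
  qed (use A' in auto)
  have comm: "L h * A' = A' * L h" if h: "h \<in> carrier G" for h
  proof (rule eq_matI)
    fix a c assume "a < dim_row (A' * L h)" "c < dim_col (A' * L h)"
    then have a: "a < N" and c: "c < N" by (auto simp: L_def A'_def)
    have hc: "ix (h \<otimes> el c) < N" "el (ix (h \<otimes> el c)) = h \<otimes> el c" using ixc h elc[OF c] by auto
    have ha: "ix (inv h \<otimes> el a) < N" "el (ix (inv h \<otimes> el a)) = inv h \<otimes> el a" using ixc h elc[OF a] by auto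
    have "(A' * L h) $$ (a,c) = (\<Sum>b<N. if b = ix (h \<otimes> el c) then A' $$ (a,b) else 0)"
      unfolding mult_mat_entry[OF A' Lc a c] using c by (intro sum.cong) (auto simp: L_def)
    also have "\<dots> = cnj (\<phi> (el a \<otimes> inv (h \<otimes> el c)))"
      using hc a by (simp add: A'_def)
    also have "el a \<otimes> inv (h \<otimes> el c) = h \<otimes> (inv h \<otimes> el a \<otimes> inv (el c)) \<otimes> inv h"
      using h elc[OF a] elc[OF c] by (simp add: inv_mult_group m_assoc[symmetric])
    also have "\<phi> \<dots> = \<phi> (inv h \<otimes> el a \<otimes> inv (el c))"
      using \<phi> h elc[OF a] elc[OF c] by (simp add: class_fun_def)
    also have "cnj \<dots> = (\<Sum>b<N. if b = ix (inv h \<otimes> el a) then A' $$ (b,c) else 0)"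
      using ha c by (simp add: A'_def)
    also have "\<dots> = (L h * A') $$ (a,c)"
      unfolding mult_mat_entry[OF Lc A' a c]
    proof (intro sum.cong refl)
      fix b assume "b \<in> {..<N}"
      then have b: "b < N" by simp
      have "b = ix (inv h \<otimes> el a) \<longleftrightarrow> el b = inv h \<otimes> el a" using elix[OF b] h elc[OF a] by simp
      also have "\<dots> \<longleftrightarrow> el a = h \<otimes> el b"
        using h elc[OF a] elc[OF b] by (metis inv_closed inv_inv inv_solve_left)
      also have "\<dots> \<longleftrightarrow> a = ix (h \<otimes> el b)" using elix[OF a] h elc[OF b] by simp
      finally show "(if b = ix (inv h \<otimes> el a) then A' $$ (b,c) else 0) = L h $$ (a,b) * A' $$ (b,c)"
        using a b by (simp add: L_def)
    qed
    finally show "(L h * A') $$ (a,c) = (A' * L h) $$ (a,c)" by simp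
  qed (auto simp: L_def A'_def)
  have Winv: "L h *\<^sub>v w \<in> W" if h: "h \<in> carrier G" and "w \<in> W" for h w
  proof -
    obtain v where v: "v \<in> carrier_vec N" "w = A' *\<^sub>v v" using \<open>w \<in> W\<close> by (auto simp: W_def)
    have "L h *\<^sub>v w = A' *\<^sub>v (L h *\<^sub>v v)"
      using comm[OF h] v assoc_mult_mat_vec[OF Lc A' v(1), of h] assoc_mult_mat_vec[OF A' Lc v(1), of h] by simp
    then show ?thesis using mult_mat_vec_carrier[OF Lc v(1), of h] by (auto simp: W_def)
  qed
  have "W \<noteq> {0\<^sub>v N}"
  proof
    assume W0: "W = {0\<^sub>v N}"
    define j where "j = ix \<one>"
    have j: "j < N" "el j = \<one>" using ixc by (auto simp: j_def)
    have "A' *\<^sub>v unit_vec N j = 0\<^sub>v N" using W0 by (auto simp: W_def)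
    then have "col A' j = 0\<^sub>v N" using mult_mat_unit_vec[OF A' j(1)] by simp
    then have "A' $$ (ix g, j) = 0" using ixc[OF g] j A' by (metis carrier_matD index_col index_zero_vec(1))
    then show False using ixc[OF g] j g nz by (simp add: A'_def)
  qed
  then obtain r \<tau> B where \<tau>: "irreducible_rep G r \<tau>" and B: "B \<in> carrier_mat N r" and inj: "inj_mat B"
    and BW: "\<And>v. v \<in> carrier_vec r \<Longrightarrow> B *\<^sub>v v \<in> W" and LB: "\<And>g. g \<in> carrier G \<Longrightarrow> L g * B = B * \<tau> g"
    using exists_irreducible_subrep[OF is_group rep W Winv] by blast
  note trep = irreducible_repD(1)[OF \<tau>]
  have AB: "A * B = 0\<^sub>m N r"
  proof (rule eq_matI)
    fix a k assume "a < dim_row (0\<^sub>m N r :: complex mat)" "k < dim_col (0\<^sub>m N r :: complex mat)"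
    then have a: "a < N" and k: "k < r" by auto
    have "(A * B) $$ (a,k) = (\<Sum>b<N. \<Sum>g\<in>carrier G. \<phi> g * (L (inv g) $$ (a,b) * B $$ (b,k)))"
      by (auto simp: mult_mat_entry[OF A B a k] A_sum[OF a] sum_distrib_right mult.assoc intro!: sum.cong)
    also have "\<dots> = (\<Sum>g\<in>carrier G. \<phi> g * (L (inv g) * B) $$ (a,k))"
      by (subst sum.swap) (simp add: mult_mat_entry[OF Lc B a k] sum_distrib_left)
    also have "\<dots> = (\<Sum>g\<in>carrier G. \<Sum>s<r. B $$ (a,s) * (\<phi> g * \<tau> (inv g) $$ (s,k)))"
    proof (intro sum.cong refl)
      fix g assume g: "g \<in> carrier G"
      then have "(L (inv g) * B) $$ (a,k) = (\<Sum>s<r. B $$ (a,s) * \<tau> (inv g) $$ (s,k))"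
        using LB[of "inv g"] mult_mat_entry[OF B is_repD(1)[OF trep] a k, of "inv g"] by simp
      then show "\<phi> g * (L (inv g) * B) $$ (a,k) = (\<Sum>s<r. B $$ (a,s) * (\<phi> g * \<tau> (inv g) $$ (s,k)))"
        by (simp add: sum_distrib_left mult_ac)
    qed
    also have "\<dots> = (\<Sum>s<r. B $$ (a,s) * (\<Sum>g\<in>carrier G. \<phi> g * \<tau> (inv g) $$ (s,k)))"
      by (subst sum.swap) (simp add: sum_distrib_left)
    also have "\<dots> = 0" using class_sum_vanishes[OF \<tau> \<phi> z[OF \<tau>] _ k] by simp
    finally show "(A * B) $$ (a,k) = 0\<^sub>m N r $$ (a,k)" using a k by simp
  qed (use A B in auto)
  define e0 where "e0 = (unit_vec r 0 :: complex vec)"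
  have e0: "e0 \<in> carrier_vec r" by (simp add: e0_def)
  obtain x where x: "x \<in> carrier_vec N" "B *\<^sub>v e0 = A' *\<^sub>v x" using BW[OF e0] by (auto simp: W_def)
  define y where "y = A' *\<^sub>v x"
  have y: "y \<in> carrier_vec N" using A' x by (simp add: y_def)
  have "0\<^sub>m N r *\<^sub>v e0 = 0\<^sub>v N" using e0 by (intro eq_vecI) auto
  then have "A *\<^sub>v y = 0\<^sub>v N"
    using assoc_mult_mat_vec[OF A B e0] AB x e0 by (simp add: y_def)
  then have Ay: "(\<Sum>b<N. A $$ (a,b) * y $ b) = 0" if "a < N" for a
    using mult_mat_vec_entry[OF A y that] that by simp
  have "(\<Sum>a<N. cnj (y $ a) * y $ a) = (\<Sum>a<N. \<Sum>b<N. cnj (x $ b) * (A $$ (b,a) * y $ a))"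
  proof (intro sum.cong refl)
    fix a assume "a \<in> {..<N}"
    then have a: "a < N" by simp
    have "cnj (y $ a) = (\<Sum>b<N. A $$ (b,a) * cnj (x $ b))"
      unfolding y_def mult_mat_vec_entry[OF A' x(1) a] using a by (simp add: A_def A'_def)
    then show "cnj (y $ a) * y $ a = (\<Sum>b<N. cnj (x $ b) * (A $$ (b,a) * y $ a))"
      by (simp add: sum_distrib_left sum_distrib_right mult_ac)
  qed
  also have "\<dots> = (\<Sum>b<N. cnj (x $ b) * (\<Sum>a<N. A $$ (b,a) * y $ a))"
    by (subst sum.swap) (simp add: sum_distrib_left)
  also have "\<dots> = 0" using Ay by simp
  finally have "(\<Sum>a<N. of_real ((cmod (y $ a))\<^sup>2)) = (0::complex)"
    by (simp add: complex_norm_square mult.commute del: of_real_power)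
  then have "(\<Sum>a<N. (cmod (y $ a))\<^sup>2) = 0" by (metis of_real_eq_0_iff of_real_sum)
  then have "y $ a = 0" if "a < N" for a using that by (simp add: sum_nonneg_eq_0_iff)
  then have "y = 0\<^sub>v N" using y by (intro eq_vecI) auto
  then have "B *\<^sub>v e0 = 0\<^sub>v N" using x by (simp add: y_def)
  then have "e0 = 0\<^sub>v r" by (rule inj_matD[OF inj B e0])
  then show False using irreducible_repD(2)[OF \<tau>] by (simp add: e0_def)
qed

end


section \<open>Matrices of finite order\<close>

definition diag_of :: "nat \<Rightarrow> (nat \<Rightarrow> complex) \<Rightarrow> complex mat" where
  "diag_of d ev = mat d d (\<lambda>(i,j). if i = j then ev i else 0)"

lemma diag_of_carrier[simp]: "diag_of d ev \<in> carrier_mat d d"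
  by (simp add: diag_of_def)

text \<open>In the \<open>k\<close>-th power of a Jordan block of size at least \<open>2\<close> the entry next to the diagonal is
  \<open>k a^(k - 1)\<close>. It does not vanish for \<open>a \<noteq> 0\<close>, so all blocks of a matrix of finite order have size
  \<open>1\<close>.\<close>

lemma jordan_matrix_finite_order:
  assumes "jordan_matrix n_as ^\<^sub>m k = 1\<^sub>m (sum_list (map fst n_as))" and "k > 0" and "0 \<notin> fst ` set n_as"
  shows "\<exists>ev. jordan_matrix n_as = diag_of (sum_list (map fst n_as)) ev \<and> (\<forall>l<sum_list (map fst n_as). ev l ^ k = 1)"
  using assms(1,3)
proof (induction n_as)
  case Nil
  have "jordan_matrix ([] :: (nat \<times> complex) list) = diag_of 0 (\<lambda>_. 0)"
    by (rule eq_matI) (auto simp: diag_of_def)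
  then show ?case by auto
next
  case (Cons na n_as)
  obtain n a where na: "na = (n,a)" by force
  let ?s = "sum_list (map fst n_as)"
  let ?J = "jordan_matrix n_as"
  let ?b = "jordan_block n a"
  have J: "?J ^\<^sub>m k \<in> carrier_mat ?s ?s" by simp
  have pow: "jordan_matrix (na # n_as) ^\<^sub>m k = four_block_mat (?b ^\<^sub>m k) (0\<^sub>m n ?s) (0\<^sub>m ?s n) (?J ^\<^sub>m k)"
    unfolding jordan_matrix_pow using jordan_matrix_pow[of n_as k, symmetric]
    by (simp add: na Let_def)
  have one: "four_block_mat (?b ^\<^sub>m k) (0\<^sub>m n ?s) (0\<^sub>m ?s n) (?J ^\<^sub>m k) = 1\<^sub>m (n + ?s)"
    using Cons.prems(1) unfolding pow by (simp add: na)
  have ent: "four_block_mat (?b ^\<^sub>m k) (0\<^sub>m n ?s) (0\<^sub>m ?s n) (?J ^\<^sub>m k) $$ (i,j) = (if i = j then 1 else 0)"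
    if "i < n + ?s" "j < n + ?s" for i j using that unfolding one by simp
  have Jk: "?J ^\<^sub>m k = 1\<^sub>m ?s"
  proof (rule eq_matI)
    fix i j assume "i < dim_row (1\<^sub>m ?s :: complex mat)" "j < dim_col (1\<^sub>m ?s :: complex mat)"
    then have ij: "i < ?s" "j < ?s" by auto
    then show "(?J ^\<^sub>m k) $$ (i,j) = 1\<^sub>m ?s $$ (i,j)" using ent[of "n + i" "n + j"] J by (simp del: pow_mat_dim)
  qed auto
  then obtain ev where ev: "?J = diag_of ?s ev" "\<And>l. l < ?s \<Longrightarrow> ev l ^ k = 1"
    using Cons by auto
  have b: "(?b ^\<^sub>m k) $$ (i,j) = (if i = j then 1 else 0)" if "i < n" "j < n" for i j
    using ent[of i j] that by (simp del: pow_mat_dim)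
  have n0: "n > 0" using Cons.prems(2) na by auto
  have ak: "a ^ k = 1" using b[of 0 0] n0 by (simp add: jordan_block_pow)
  then have a0: "a \<noteq> 0" using assms(2) by (auto simp: zero_power)
  have n1: "n = 1"
  proof (rule ccontr)
    assume "n \<noteq> 1"
    then have "1 < n" using n0 by simp
    then have "of_nat k * a ^ (k - 1) = 0" using b[of 0 1] by (simp add: jordan_block_pow)
    then show False using a0 assms(2) by simp
  qed
  have "jordan_matrix (na # n_as) = four_block_mat ?b (0\<^sub>m n ?s) (0\<^sub>m ?s n) ?J"
    using jordan_matrix_dim[of n_as] by (simp add: jordan_matrix_def na Let_def)
  also have "\<dots> = diag_of (n + ?s) (case_nat a ev)"
    unfolding ev(1) n1 by (rule eq_matI) (auto simp: diag_of_def jordan_block_def split: nat.splits)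
  finally have "jordan_matrix (na # n_as) = diag_of (sum_list (map fst (na # n_as))) (case_nat a ev)"
    by (simp add: na)
  moreover have "\<forall>l<sum_list (map fst (na # n_as)). case_nat a ev l ^ k = 1"
    using ev(2) ak n1 by (auto simp: na split: nat.splits)
  ultimately show ?case by blast
qed

lemma finite_order_diagonalizable:
  assumes A: "A \<in> carrier_mat d d" and k: "k > 0" and Ak: "A ^\<^sub>m k = 1\<^sub>m d"
  shows "\<exists>P Q ev. P \<in> carrier_mat d d \<and> Q \<in> carrier_mat d d \<and> P * Q = 1\<^sub>m d \<and> Q * P = 1\<^sub>m d \<and>
    A = P * diag_of d ev * Q \<and> (\<forall>l<d. ev l ^ k = 1)"
proof -
  obtain as where "char_poly A = (\<Prod>a\<leftarrow>as. [:- a, 1:])" using char_poly_factorized[OF A] by auto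
  then obtain n_as where jnf: "jordan_nf A n_as" using jordan_nf_exists[OF A] by blast
  let ?J = "jordan_matrix n_as"
  obtain P Q where wit: "similar_mat_wit A ?J P Q" using jnf by (auto simp: jordan_nf_def similar_mat_def)
  have P: "P \<in> carrier_mat d d" and Q: "Q \<in> carrier_mat d d" and PQ: "P * Q = 1\<^sub>m d" and QP: "Q * P = 1\<^sub>m d"
    and AJ: "A = P * ?J * Q" and J: "?J \<in> carrier_mat d d"
    using wit A by (auto simp: similar_mat_wit_def Let_def)
  have s: "sum_list (map fst n_as) = d" using J jordan_matrix_dim(1)[of n_as] by auto
  have "?J ^\<^sub>m k = Q * A ^\<^sub>m k * P"
    using similar_mat_wit_pow_id[OF similar_mat_wit_sym[OF wit]] .
  also have "\<dots> = 1\<^sub>m d" using Ak Q QP by simp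
  finally have "\<exists>ev. ?J = diag_of d ev \<and> (\<forall>l<d. ev l ^ k = 1)"
    using jordan_matrix_finite_order[of n_as k] k jnf s by (auto simp: jordan_nf_def)
  then show ?thesis using P Q PQ QP AJ by metis
qed

lemma trace_mult_commute:
  fixes A B :: "complex mat"
  assumes "A \<in> carrier_mat d e" "B \<in> carrier_mat e d"
  shows "(\<Sum>i<d. (A * B) $$ (i,i)) = (\<Sum>j<e. (B * A) $$ (j,j))"
proof -
  have "(\<Sum>i<d. (A * B) $$ (i,i)) = (\<Sum>i<d. \<Sum>j<e. A $$ (i,j) * B $$ (j,i))"
    using mult_mat_entry[OF assms] by (intro sum.cong) auto
  also have "\<dots> = (\<Sum>j<e. \<Sum>i<d. B $$ (j,i) * A $$ (i,j))"
    by (subst sum.swap) (simp add: mult.commute)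
  also have "\<dots> = (\<Sum>j<e. (B * A) $$ (j,j))"
    using mult_mat_entry[OF assms(2,1)] by (intro sum.cong) auto
  finally show ?thesis .
qed

lemma trace_similar:
  fixes A P Q :: "complex mat"
  assumes "P \<in> carrier_mat d d" "Q \<in> carrier_mat d d" "Q * P = 1\<^sub>m d" "A \<in> carrier_mat d d"
  shows "(\<Sum>i<d. (P * A * Q) $$ (i,i)) = (\<Sum>j<d. A $$ (j,j))"
proof -
  have "(\<Sum>i<d. (P * A * Q) $$ (i,i)) = (\<Sum>i<d. (Q * (P * A)) $$ (i,i))"
    by (rule trace_mult_commute) (use assms in auto)
  also have "Q * (P * A) = A"
    using assoc_mult_mat[OF assms(2,1,4)] assms(3) left_mult_one_mat[OF assms(4)] by metis
  finally show ?thesis .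
qed

lemma det_one_minus_similar:
  fixes A P Q :: "complex mat"
  assumes P: "P \<in> carrier_mat d d" and Q: "Q \<in> carrier_mat d d" and PQ: "P * Q = 1\<^sub>m d" and A: "A \<in> carrier_mat d d"
  shows "det (1\<^sub>m d - P * A * Q) = det (1\<^sub>m d - A)"
proof -
  have M: "1\<^sub>m d - A \<in> carrier_mat d d" by (rule minus_carrier_mat[OF A])
  have "P * (1\<^sub>m d - A) * Q = (P - P * A) * Q"
    using mult_minus_distrib_mat[OF P one_carrier_mat A] right_mult_one_mat[OF P] by simp
  also have "\<dots> = P * Q - P * A * Q"
    by (rule minus_mult_distrib_mat[OF P mult_carrier_mat[OF P A] Q])
  finally have "det (1\<^sub>m d - P * A * Q) = det (P * (1\<^sub>m d - A) * Q)" unfolding PQ by simp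
  also have "\<dots> = det P * det (1\<^sub>m d - A) * det Q"
    using det_mult[OF mult_carrier_mat[OF P M] Q] det_mult[OF P M] by simp
  also have "\<dots> = det (P * Q) * det (1\<^sub>m d - A)" using det_mult[OF P Q] by simp
  finally show ?thesis unfolding PQ by simp
qed

lemma unit_root_cnj: 
  fixes z :: complex
  assumes "z ^ k = 1" "k > 0" shows "z * cnj z = 1"
proof -
  have "cmod z ^ k = 1" using assms(1) by (metis norm_one norm_power)
  then have "cmod z = 1" using assms(2) by (metis norm_ge_zero power_eq_1_iff not_gr_zero less_numeral_extra(3) abs_of_nonneg real_norm_def)
  then show ?thesis by (simp add: complex_norm_square[symmetric])
qed

section \<open>Class functions\<close>

context finite_group
begin

lemma finite_element_order:
  assumes g: "g \<in> carrier G"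
  shows "\<exists>k>0. g [^] (k::nat) = \<one>"
proof -
  have "range (\<lambda>k::nat. g [^] k) \<subseteq> carrier G" using g by auto
  then have "finite (range (\<lambda>k::nat. g [^] k))" using fin finite_subset by blast
  then have "\<not> inj (\<lambda>k::nat. g [^] k)" using finite_imageD by fastforce
  then obtain i j :: nat where ij: "i < j" "g [^] i = g [^] j"
    unfolding inj_on_def by (metis linorder_neqE_nat)
  have "g [^] i \<otimes> g [^] (j - i) = g [^] j" using ij(1) g by (simp add: nat_pow_mult)
  then have "g [^] i \<otimes> g [^] (j - i) = g [^] i \<otimes> \<one>" using ij(2) g by simp
  then have "g [^] (j - i) = \<one>" using g by simp
  then show ?thesis using ij by (intro exI[of _ "j - i"]) simp
qed

lemma rep_diagonalizable:
  assumes rep: "is_rep G d \<rho>" and g: "g \<in> carrier G"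
  shows "\<exists>P Q ev. P \<in> carrier_mat d d \<and> Q \<in> carrier_mat d d \<and> P * Q = 1\<^sub>m d \<and> Q * P = 1\<^sub>m d \<and>
    \<rho> g = P * diag_of d ev * Q \<and> (\<forall>l<d. ev l * cnj (ev l) = 1)"
proof -
  have R: "\<rho> g \<in> carrier_mat d d" by (rule is_repD(1)[OF rep g])
  have pw: "\<rho> (g [^] k) = \<rho> g ^\<^sub>m k" for k :: nat
    using R g by (induction k) (auto simp: is_repD(2)[OF rep] is_repD(3)[OF rep])
  obtain k :: nat where k: "k > 0" "g [^] k = \<one>" using finite_element_order[OF g] by blast
  have "\<rho> g ^\<^sub>m k = 1\<^sub>m d"
    using k pw[of k] is_repD(2)[OF rep] by simp
  then obtain P Q ev where "P \<in> carrier_mat d d" "Q \<in> carrier_mat d d" "P * Q = 1\<^sub>m d" "Q * P = 1\<^sub>m d"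
    "\<rho> g = P * diag_of d ev * Q" "\<forall>l<d. ev l ^ k = 1"
    using finite_order_diagonalizable[OF R k(1)] by blast
  then show ?thesis using unit_root_cnj k(1) by blast
qed

text \<open>In an eigenbasis of \<open>\<rho> g\<close> the inverse is obtained by conjugating the eigenvalues, which are roots
  of unity.\<close>

lemma rep_char_inv:
  assumes rep: "is_rep G d \<rho>" and g: "g \<in> carrier G"
  shows "rep_char \<rho> (inv g) = cnj (rep_char \<rho> g)"
proof -
  obtain P Q ev where P: "P \<in> carrier_mat d d" and Q: "Q \<in> carrier_mat d d" and PQ: "P * Q = 1\<^sub>m d" and QP: "Q * P = 1\<^sub>m d"
    and R: "\<rho> g = P * diag_of d ev * Q" and ev: "\<And>l. l < d \<Longrightarrow> ev l * cnj (ev l) = 1"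
    using rep_diagonalizable[OF assms] by blast
  let ?D = "diag_of d ev" and ?E = "diag_of d (\<lambda>l. cnj (ev l))"
  have DE: "?D * ?E = 1\<^sub>m d"
  proof (rule eq_matI)
    fix i j assume "i < dim_row (1\<^sub>m d :: complex mat)" "j < dim_col (1\<^sub>m d :: complex mat)"
    then have ij: "i < d" "j < d" by auto
    have "(?D * ?E) $$ (i,j) = (\<Sum>l<d. if l = i then (if i = j then ev i * cnj (ev i) else 0) else 0)"
      unfolding mult_mat_entry[OF diag_of_carrier diag_of_carrier ij]
      using ij by (intro sum.cong) (auto simp: diag_of_def)
    then show "(?D * ?E) $$ (i,j) = 1\<^sub>m d $$ (i,j)" using ij ev[OF ij(1)] ev[OF ij(2)] by (simp del: index_mult_mat)
  qed (auto simp: diag_of_def)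
  have Ri: "\<rho> (inv g) \<in> carrier_mat d d" and Rg: "\<rho> g \<in> carrier_mat d d" using is_repD(1)[OF rep] g by auto
  have one: "\<rho> (inv g) * \<rho> g = 1\<^sub>m d"
    using is_repD(3)[OF rep, of "inv g" g] is_repD(2)[OF rep] g by simp
  have X: "P * ?E * Q \<in> carrier_mat d d" using P Q by auto
  have PD: "P * ?D \<in> carrier_mat d d" using P by auto
  have EQ: "?E * Q \<in> carrier_mat d d" by (rule mult_carrier_mat[OF diag_of_carrier Q])
  have "\<rho> g * (P * ?E * Q) = P * ?D * (Q * (P * ?E * Q))"
    unfolding R by (rule assoc_mult_mat[OF PD Q X])
  also have "Q * (P * ?E * Q) = ?E * Q"
    unfolding assoc_mult_mat[OF P diag_of_carrier Q] assoc_mult_mat[OF Q P EQ, symmetric] QP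
    by (rule left_mult_one_mat[OF EQ])
  also have "P * ?D * (?E * Q) = P * (?D * (?E * Q))"
    by (rule assoc_mult_mat[OF P diag_of_carrier EQ])
  also have "?D * (?E * Q) = Q"
    unfolding assoc_mult_mat[OF diag_of_carrier diag_of_carrier Q, symmetric] DE by (rule left_mult_one_mat[OF Q])
  finally have "\<rho> g * (P * ?E * Q) = 1\<^sub>m d" unfolding PQ .
  then have "\<rho> (inv g) = \<rho> (inv g) * (\<rho> g * (P * ?E * Q))" using Ri by simp
  also have "\<dots> = P * ?E * Q"
    unfolding assoc_mult_mat[OF Ri Rg X, symmetric] one by (rule left_mult_one_mat[OF X])
  finally have "rep_char \<rho> (inv g) = (\<Sum>j<d. ?E $$ (j,j))"
    using rep_char_eq[OF rep, of "inv g"] g trace_similar[OF P Q QP diag_of_carrier] by simp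
  also have "\<dots> = cnj (\<Sum>j<d. ?D $$ (j,j))" by (simp add: diag_of_def)
  also have "(\<Sum>j<d. ?D $$ (j,j)) = rep_char \<rho> g"
    using rep_char_eq[OF rep g] trace_similar[OF P Q QP diag_of_carrier] R by simp
  finally show ?thesis .
qed

lemma rep_iso_char:
  assumes rep: "is_rep G d \<rho>" "is_rep G d' \<sigma>" and iso: "rep_iso G d \<rho> d' \<sigma>" and g: "g \<in> carrier G"
  shows "rep_char \<sigma> g = rep_char \<rho> g"
proof -
  obtain P where P: "P \<in> carrier_mat d d" "invertible_mat P" and eq: "P * \<rho> g = \<sigma> g * P" and dd: "d' = d"
    using iso g unfolding rep_iso_def by blast
  from P(2) obtain Q where PQ: "P * Q = 1\<^sub>m (dim_row P)" and QP: "Q * P = 1\<^sub>m (dim_row Q)"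
    unfolding invertible_mat_def inverts_mat_def by blast
  have PQ: "P * Q = 1\<^sub>m d" using PQ P(1) by simp
  have "dim_col (P * Q) = d" unfolding PQ by simp
  then have "dim_col Q = d" by simp
  moreover have "dim_col (Q * P) = dim_row Q" unfolding QP by simp
  then have "dim_row Q = d" using P(1) by simp
  ultimately have Q: "Q \<in> carrier_mat d d" by blast
  have R: "\<rho> g \<in> carrier_mat d d" and S: "\<sigma> g \<in> carrier_mat d d" using is_repD(1)[OF rep(1) g] is_repD(1)[OF rep(2) g] unfolding dd .
  have "P * \<rho> g * Q = \<sigma> g * (P * Q)" unfolding eq by (rule assoc_mult_mat[OF S P(1) Q])
  then have PRQ: "P * \<rho> g * Q = \<sigma> g" unfolding PQ right_mult_one_mat[OF S] .
  have "Q * P = 1\<^sub>m d" using QP unfolding carrier_matD(1)[OF Q] .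
  from trace_similar[OF P(1) Q this R] show ?thesis
    unfolding PRQ rep_char_eq[OF rep(1) g] rep_char_eq[OF rep(2) g] dd .
qed

lemma rep_conj:
  assumes rep: "is_rep G d \<rho>" and g: "g \<in> carrier G" and h: "h \<in> carrier G"
  shows "\<rho> (h \<otimes> g \<otimes> inv h) = \<rho> h * \<rho> g * \<rho> (inv h)" "\<rho> (inv h) * \<rho> h = 1\<^sub>m d" "\<rho> h * \<rho> (inv h) = 1\<^sub>m d"
  using is_repD(3)[OF rep, of "h \<otimes> g" "inv h"] is_repD(3)[OF rep, of h g] is_repD(2)[OF rep]
    is_repD(3)[OF rep, of h "inv h"] is_repD(3)[OF rep, of "inv h" h] g h by auto

lemma class_fun_char:
  assumes rep: "is_rep G d \<rho>"
  shows "class_fun (rep_char \<rho>)"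
  unfolding class_fun_def
proof (intro ballI)
  fix g h assume g: "g \<in> carrier G" and h: "h \<in> carrier G"
  show "rep_char \<rho> (h \<otimes> g \<otimes> inv h) = rep_char \<rho> g"
    using trace_similar[OF is_repD(1)[OF rep h] is_repD(1)[OF rep inv_closed[OF h]] rep_conj(2)[OF rep g h] is_repD(1)[OF rep g]]
      rep_char_eq[OF rep] g h by (simp add: rep_conj(1)[OF rep g h])
qed

lemma class_fun_intros:
  "class_fun \<phi> \<Longrightarrow> class_fun \<psi> \<Longrightarrow> class_fun (\<lambda>g. \<phi> g * \<psi> g)"
  "class_fun \<phi> \<Longrightarrow> class_fun \<psi> \<Longrightarrow> class_fun (\<lambda>g. \<phi> g - \<psi> g)"
  "class_fun \<phi> \<Longrightarrow> class_fun (\<lambda>g. cnj (\<phi> g))"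
  "class_fun (\<lambda>g. c)"
  "(\<And>j. j \<in> J \<Longrightarrow> class_fun (f j)) \<Longrightarrow> class_fun (\<lambda>g. \<Sum>j\<in>J. f j g)"
  by (auto simp: class_fun_def)

lemma class_fun_det:
  assumes rep: "is_rep G d \<rho>"
  shows "class_fun (\<lambda>g. det (1\<^sub>m d - \<rho> g))"
  unfolding class_fun_def
proof (intro ballI)
  fix g h assume g: "g \<in> carrier G" and h: "h \<in> carrier G"
  have R: "\<rho> g \<in> carrier_mat d d" "\<rho> h \<in> carrier_mat d d" "\<rho> (inv h) \<in> carrier_mat d d"
    using is_repD(1)[OF rep] g h by auto
  show "det (1\<^sub>m d - \<rho> (h \<otimes> g \<otimes> inv h)) = det (1\<^sub>m d - \<rho> g)"
    using det_one_minus_similar[OF R(2,3) rep_conj(3)[OF rep g h] R(1)] rep_conj(1)[OF rep g h] by simp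
qed

lemma irreducible_systemD:
  assumes "irreducible_system G n dm irr"
  shows "i \<le> n \<Longrightarrow> irreducible_rep G (dm i) (irr i)" "i \<le> n \<Longrightarrow> is_rep G (dm i) (irr i)"
    "dm 0 = 1" "g \<in> carrier G \<Longrightarrow> rep_char (irr 0) g = 1"
    "i \<le> n \<Longrightarrow> j \<le> n \<Longrightarrow> i \<noteq> j \<Longrightarrow> \<not> rep_iso G (dm i) (irr i) (dm j) (irr j)"
    "irreducible_rep G m \<sigma> \<Longrightarrow> \<exists>i\<le>n. rep_iso G m \<sigma> (dm i) (irr i)"
  using assms irreducible_repD(1) unfolding irreducible_system_def by (auto simp: rep_char_def)

lemma irr_char_orthonormal:
  assumes sys: "irreducible_system G n dm irr" and i: "i \<le> n" and j: "j \<le> n"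
  shows "(\<Sum>g\<in>carrier G. rep_char (irr i) g * cnj (rep_char (irr j) g)) = (if i = j then of_nat (Coset.order G) else 0)"
proof -
  note irr = irreducible_systemD[OF sys]
  have "(\<Sum>g\<in>carrier G. rep_char (irr i) g * cnj (rep_char (irr j) g)) =
      (\<Sum>g\<in>carrier G. rep_char (irr i) g * rep_char (irr j) (inv g))"
    using rep_char_inv[OF irr(2)[OF j]] by simp
  also have "\<dots> = (if i = j then of_nat (Coset.order G) else 0)"
    using char_norm[OF irr(1)[OF i]] char_orthogonal_distinct[OF irr(1)[OF i] irr(1)[OF j]] irr(5)[OF j i] by auto
  finally show ?thesis .
qed

text \<open>The difference of \<open>\<phi>\<close> and the right-hand side is a class function orthogonal to all irreducible
  characters.\<close>

lemma class_fun_expansion: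
  assumes sys: "irreducible_system G n dm irr" and \<phi>: "class_fun \<phi>" and g: "g \<in> carrier G"
  shows "\<phi> g = (\<Sum>j\<le>n. (\<Sum>h\<in>carrier G. \<phi> h * cnj (rep_char (irr j) h)) / of_nat (Coset.order G) * rep_char (irr j) g)"
proof -
  note irr = irreducible_systemD[OF sys]
  define c where "c j = (\<Sum>h\<in>carrier G. \<phi> h * cnj (rep_char (irr j) h)) / of_nat (Coset.order G)" for j
  define \<psi> where "\<psi> g = \<phi> g - (\<Sum>j\<le>n. c j * rep_char (irr j) g)" for g
  have "class_fun \<psi>" unfolding \<psi>_def
    using \<phi> class_fun_char[OF irr(2)] by (intro class_fun_intros) auto
  moreover have "(\<Sum>g\<in>carrier G. \<psi> g * rep_char \<sigma> (inv g)) = 0" if \<sigma>: "irreducible_rep G m \<sigma>" for m \<sigma>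
  proof -
    obtain i where i: "i \<le> n" and iso: "rep_iso G m \<sigma> (dm i) (irr i)" using irr(6)[OF \<sigma>] by blast
    have "(\<Sum>g\<in>carrier G. \<psi> g * rep_char \<sigma> (inv g)) = (\<Sum>g\<in>carrier G. \<psi> g * cnj (rep_char (irr i) g))"
      using rep_iso_char[OF irreducible_repD(1)[OF \<sigma>] irr(2)[OF i] iso] rep_char_inv[OF irr(2)[OF i]]
      by (intro sum.cong) auto
    also have "\<dots> = (\<Sum>g\<in>carrier G. \<phi> g * cnj (rep_char (irr i) g)) -
       (\<Sum>j\<le>n. c j * (\<Sum>g\<in>carrier G. rep_char (irr j) g * cnj (rep_char (irr i) g)))"
      unfolding \<psi>_def left_diff_distrib sum_subtractf sum_distrib_right sum_distrib_left
      by (subst sum.swap[of _ "{..n}"]) (simp add: mult.assoc)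
    also have "(\<Sum>j\<le>n. c j * (\<Sum>g\<in>carrier G. rep_char (irr j) g * cnj (rep_char (irr i) g))) =
       (\<Sum>j\<le>n. if j = i then c i * of_nat (Coset.order G) else 0)"
      using irr_char_orthonormal[OF sys _ i] by (intro sum.cong) auto
    also have "\<dots> = c i * of_nat (Coset.order G)" using i by simp
    also have "\<dots> = (\<Sum>g\<in>carrier G. \<phi> g * cnj (rep_char (irr i) g))" using order_pos by (simp add: c_def)
    finally show ?thesis by simp
  qed
  ultimately have "\<psi> g = 0" using class_fun_zero g by blast
  then show ?thesis by (simp add: \<psi>_def c_def)
qed

end

section \<open>Characters of exterior powers and tensor products\<close>

text \<open>The enumeration \<open>pick I\<close> of \<open>I\<close> carries permutations of \<open>{0..<card I}\<close> to permutations of \<open>I\<close> with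
  the same sign. The index set of the Leibniz sum thereby becomes a set of permutations of
  \<open>{..<d}\<close>.\<close>

lemma det_submatrix_permutes:
  assumes A: "(A :: complex mat) \<in> carrier_mat d d" and I: "I \<subseteq> {..<d}"
  shows "det (submatrix A I I) = (\<Sum>p | p permutes I. of_int (sign p) * (\<Prod>i\<in>I. A $$ (i, p i)))"
proof -
  define k where "k = card I"
  have fI: "finite I" using I finite_subset by blast
  have set_eq: "{i. i < d \<and> i \<in> I} = I" using I by auto
  have sub: "submatrix A I I = mat k k (\<lambda>(i,j). A $$ (pick I i, pick I j))"
    using A by (simp add: submatrix_def set_eq k_def)
  have inj: "inj_on (pick I) {0..<k}"
    by (rule inj_onI) (metis atLeastLessThan_iff card_pick k_def)
  have bij: "bij_betw (pick I) {0..<k} I"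
  proof -
    have "pick I ` {0..<k} \<subseteq> I" by (auto simp: k_def pick_in_set_le)
    moreover have "card (pick I ` {0..<k}) = card I" using card_image[OF inj] by (simp add: k_def)
    ultimately have "pick I ` {0..<k} = I" using fI by (simp add: card_subset_eq)
    then show ?thesis using inj by (simp add: bij_betw_def)
  qed
  have "det (submatrix A I I) = (\<Sum>p | p permutes {0..<k}. of_int (sign p) * (\<Prod>i=0..<k. A $$ (pick I i, pick I (p i))))"
    unfolding sub det_def'[OF mat_carrier]
    by (intro sum.cong refl arg_cong2[where f="(*)"] prod.cong) (auto simp: permutes_in_image)
  also have "\<dots> = (\<Sum>p | p permutes I. of_int (sign p) * (\<Prod>i\<in>I. A $$ (i, p i)))"
  proof (rule sum.reindex_bij_witness[of _ "map_permutation I (inv_into {0..<k} (pick I))" "map_permutation {0..<k} (pick I)"])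
    fix p assume p: "p \<in> {p. p permutes {0..<k}}"
    then have p': "p permutes {0..<k}" by simp
    show "map_permutation {0..<k} (pick I) p \<in> {p. p permutes I}"
      using map_permutation_permutes[OF bij p'] by simp
    show "map_permutation I (inv_into {0..<k} (pick I)) (map_permutation {0..<k} (pick I) p) = p"
      by (rule map_permutation_compose_inv[OF bij p']) (use inj in auto)
    have "(\<Prod>i\<in>I. A $$ (i, map_permutation {0..<k} (pick I) p i)) = (\<Prod>i\<in>{0..<k}. A $$ (pick I i, pick I (p i)))"
      by (subst prod.reindex_bij_betw[OF bij, symmetric]) (auto simp: map_permutation_apply[OF inj] intro!: prod.cong)
    then show "of_int (sign (map_permutation {0..<k} (pick I) p)) * (\<Prod>i\<in>I. A $$ (i, map_permutation {0..<k} (pick I) p i)) =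
         of_int (sign p) * (\<Prod>i=0..<k. A $$ (pick I i, pick I (p i)))"
      using sign_map_permutation[OF inj p'] by simp
  next
    fix p assume p: "p \<in> {p. p permutes I}"
    then have p': "p permutes I" by simp
    show "map_permutation I (inv_into {0..<k} (pick I)) p \<in> {p. p permutes {0..<k}}"
      using map_permutation_permutes[OF bij_betw_inv_into[OF bij] p'] by simp
    show "map_permutation {0..<k} (pick I) (map_permutation I (inv_into {0..<k} (pick I)) p) = p"
      by (rule map_permutation_compose_inv[OF bij_betw_inv_into[OF bij] p']) (use bij_betw_inv_into_right[OF bij] in auto)
  qed
  finally show ?thesis .
qed

text \<open>In each product of the Leibniz formula, let \<open>I\<close> be the set of the rows from which the entry of
  \<open>- A\<close> is taken. The permutations that contribute to a given \<open>I\<close> fix all indices outside \<open>I\<close>, so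
  their contributions add up to a principal minor.\<close>

lemma det_one_minus:
  assumes A: "(A :: complex mat) \<in> carrier_mat d d"
  shows "det (1\<^sub>m d - A) = (\<Sum>I\<in>Pow {..<d}. (-1) ^ card I * det (submatrix A I I))"
proof -
  have M: "1\<^sub>m d - A \<in> carrier_mat d d" by (rule minus_carrier_mat[OF A])
  let ?t = "\<lambda>p I. of_int (sign p) * ((\<Prod>i\<in>I. - A $$ (i, p i)) * (\<Prod>i\<in>{..<d} - I. if i = p i then 1 else (0::complex)))"
  have "det (1\<^sub>m d - A) = (\<Sum>p | p permutes {..<d}. of_int (sign p) * (\<Prod>i<d. (- A $$ (i, p i)) + (if i = p i then 1 else 0)))"
    unfolding det_def'[OF M] atLeast0LessThan
  proof (intro sum.cong refl arg_cong2[where f="(*)"] prod.cong)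
    fix p i assume "p \<in> {p. p permutes {..<d}}" and i: "i \<in> {..<d}"
    then have "p i < d" using permutes_in_image[of p "{..<d}" i] by simp
    then show "(1\<^sub>m d - A) $$ (i, p i) = - A $$ (i, p i) + (if i = p i then 1 else 0)"
      using A i by simp
  qed
  also have "\<dots> = (\<Sum>p | p permutes {..<d}. \<Sum>I\<in>Pow {..<d}. ?t p I)"
    by (subst prod_add) (auto simp: sum_distrib_left)
  also have "\<dots> = (\<Sum>I\<in>Pow {..<d}. \<Sum>p | p permutes {..<d}. ?t p I)" by (rule sum.swap)
  also have "\<dots> = (\<Sum>I\<in>Pow {..<d}. (-1) ^ card I * det (submatrix A I I))"
  proof (intro sum.cong refl)
    fix I assume "I \<in> Pow {..<d}"
    then have I: "I \<subseteq> {..<d}" by simp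
    have "(\<Sum>p | p permutes {..<d}. ?t p I) = (\<Sum>p | p permutes I. (-1) ^ card I * (of_int (sign p) * (\<Prod>i\<in>I. A $$ (i, p i))))"
    proof (rule sum.mono_neutral_cong_right)
      show "finite {p. p permutes {..<d}}" by (simp add: finite_permutations)
      show "{p. p permutes I} \<subseteq> {p. p permutes {..<d}}" using I permutes_subset by blast
      show "\<forall>p\<in>{p. p permutes {..<d}} - {p. p permutes I}. ?t p I = 0"
      proof
        fix p assume p: "p \<in> {p. p permutes {..<d}} - {p. p permutes I}"
        then obtain x where x: "x \<in> {..<d} - I" "p x \<noteq> x"
          using permutes_superset[of p "{..<d}" I] by auto
        then have "(\<Prod>i\<in>{..<d} - I. if i = p i then 1 else (0::complex)) = 0"
          by (intro prod_zero) (auto intro!: bexI[of _ x])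
        then show "?t p I = 0" by simp
      qed
      fix p assume "p \<in> {p. p permutes I}"
      then have p: "p permutes I" by simp
      have "(\<Prod>i\<in>{..<d} - I. if i = p i then 1 else (0::complex)) = 1"
        using permutes_not_in[OF p] by (intro prod.neutral) auto
      moreover have "(\<Prod>i\<in>I. - A $$ (i, p i)) = (-1) ^ card I * (\<Prod>i\<in>I. A $$ (i, p i))"
        by (simp add: prod_uminus)
      ultimately show "?t p I = (-1) ^ card I * (of_int (sign p) * (\<Prod>i\<in>I. A $$ (i, p i)))" by simp
    qed
    then show "(\<Sum>p | p permutes {..<d}. ?t p I) = (-1) ^ card I * det (submatrix A I I)"
      by (simp add: det_submatrix_permutes[OF A I] sum_distrib_left)
  qed
  finally show ?thesis .
qed

lemma wedge_basis_props:
  "distinct (wedge_basis d m)" "set (wedge_basis d m) = {I. I \<subseteq> {..<d} \<and> card I = m}"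
proof -
  have dist: "distinct (map set (subseqs [0..<d]))" by (rule distinct_set_subseqs) simp
  then show "distinct (wedge_basis d m)" unfolding wedge_basis_def
    by (rule distinct_map_filter)
  have len: "length xs = card (set xs)" if "xs \<in> set (subseqs [0..<d])" for xs
    using subseqs_distinctD[OF that] by (simp add: distinct_card)
  have pw: "set ` set (subseqs [0..<d]) = Pow {..<d}" by (simp add: subseqs_powset atLeast0LessThan)
  show "set (wedge_basis d m) = {I. I \<subseteq> {..<d} \<and> card I = m}"
  proof (intro subset_antisym subsetI)
    fix I assume "I \<in> set (wedge_basis d m)"
    then show "I \<in> {I. I \<subseteq> {..<d} \<and> card I = m}" using len pw by (auto simp: wedge_basis_def)
  next
    fix I assume I: "I \<in> {I. I \<subseteq> {..<d} \<and> card I = m}"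
    then have "I \<in> set ` set (subseqs [0..<d])" using pw by simp
    then show "I \<in> set (wedge_basis d m)" using I len by (auto simp: wedge_basis_def)
  qed
qed

lemma exterior_char:
  "rep_char (exterior_rep d \<rho> m) g = (\<Sum>I | I \<subseteq> {..<d} \<and> card I = m. det (submatrix (\<rho> g) I I))"
proof -
  let ?W = "wedge_basis d m"
  have "rep_char (exterior_rep d \<rho> m) g = (\<Sum>a<length ?W. det (submatrix (\<rho> g) (?W ! a) (?W ! a)))"
    by (simp add: rep_char_def exterior_rep_def Let_def)
  also have "\<dots> = (\<Sum>I\<in>set ?W. det (submatrix (\<rho> g) I I))"
    using bij_betw_nth[OF wedge_basis_props(1) refl refl] by (intro sum.reindex_bij_betw)
  finally show ?thesis by (simp add: wedge_basis_props(2))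
qed

lemma alternating_exterior_char:
  assumes "\<rho> g \<in> carrier_mat d d"
  shows "(\<Sum>m\<le>d. (-1) ^ m * rep_char (exterior_rep d \<rho> m) g) = det (1\<^sub>m d - \<rho> g)"
proof -
  have "(\<Sum>m\<le>d. (-1) ^ m * rep_char (exterior_rep d \<rho> m) g) =
     (\<Sum>m\<le>d. \<Sum>I | I \<in> Pow {..<d} \<and> card I = m. (-1) ^ card I * det (submatrix (\<rho> g) I I))"
    by (simp add: exterior_char sum_distrib_left)
  also have "\<dots> = (\<Sum>I\<in>Pow {..<d}. (-1) ^ card I * det (submatrix (\<rho> g) I I))"
    by (rule sum.group) (auto intro: card_mono[of "{..<d}", simplified])
  finally show ?thesis using det_one_minus[OF assms] by simp
qed

lemma kronecker_trace:
  assumes A: "A \<in> carrier_mat a a" and B: "B \<in> carrier_mat b b"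
  shows "(\<Sum>i<dim_row (kronecker_mat A B). kronecker_mat A B $$ (i,i)) = (\<Sum>i<a. A $$ (i,i)) * (\<Sum>i<b. B $$ (i,i))"
proof -
  have "(\<Sum>i<dim_row (kronecker_mat A B). kronecker_mat A B $$ (i,i)) = (\<Sum>i<a*b. A $$ (i div b, i div b) * B $$ (i mod b, i mod b))"
    using A B by (simp add: kronecker_mat_def)
  also have "\<dots> = (\<Sum>m<a. \<Sum>i=m*b..<m*b+b. A $$ (i div b, i div b) * B $$ (i mod b, i mod b))"
    by (rule sum.nat_group[symmetric])
  also have "\<dots> = (\<Sum>m<a. \<Sum>j<b. A $$ (m,m) * B $$ (j,j))"
  proof (rule sum.cong[OF refl])
    fix m
    have "(\<Sum>j<b. A $$ (m,m) * B $$ (j,j)) =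
        (\<Sum>j=0..<b. A $$ ((j + m*b) div b, (j + m*b) div b) * B $$ ((j + m*b) mod b, (j + m*b) mod b))"
      unfolding atLeast0LessThan by (intro sum.cong) auto
    also have "\<dots> = (\<Sum>i=0+m*b..<b+m*b. A $$ (i div b, i div b) * B $$ (i mod b, i mod b))"
      by (rule sum.shift_bounds_nat_ivl[symmetric])
    finally show "(\<Sum>i=m*b..<m*b+b. A $$ (i div b, i div b) * B $$ (i mod b, i mod b)) = (\<Sum>j<b. A $$ (m,m) * B $$ (j,j))"
      by (simp add: add.commute)
  qed
  finally show ?thesis by (simp add: sum_product)
qed

lemma tensor_char:
  assumes "\<rho> g \<in> carrier_mat a a" "\<sigma> g \<in> carrier_mat b b"
  shows "rep_char (tensor_rep \<rho> \<sigma>) g = rep_char \<rho> g * rep_char \<sigma> g"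
  using kronecker_trace[OF assms] assms by (simp add: rep_char_def tensor_rep_def)


section \<open>Polynomials in several variables\<close>

abbreviation lookup where "lookup \<equiv> Poly_Mapping.lookup"
abbreviation keys where "keys \<equiv> Poly_Mapping.keys"

definition monomial :: "(nat \<Rightarrow>\<^sub>0 nat) \<Rightarrow> mpol" where
  "monomial \<gamma> = Poly_Mapping.single \<gamma> 1"

definition mon_val :: "(nat \<Rightarrow> mpol) \<Rightarrow> (nat \<Rightarrow>\<^sub>0 nat) \<Rightarrow> mpol" where
  "mon_val y \<gamma> = (\<Prod>k\<in>keys \<gamma>. y k ^ lookup \<gamma> k)"

text \<open>The degree of the monomial \<open>x\<^sup>\<gamma>\<close> if the variable \<open>x\<^sub>k\<close> has degree \<open>w k\<close>. The weights used are the
  degrees of the parameters, for products of parameters, and the constant \<open>1\<close>, for the ordinary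
  degree.\<close>

definition wt :: "(nat \<Rightarrow> nat) \<Rightarrow> (nat \<Rightarrow>\<^sub>0 nat) \<Rightarrow> nat" where
  "wt w \<gamma> = (\<Sum>k\<in>keys \<gamma>. lookup \<gamma> k * w k)"

lemma lookup_const_mult: "lookup (mpol_const c * p) \<gamma> = c * lookup p \<gamma>"
proof -
  have "mpol_const c * p = Poly_Mapping.map ((*) c) p"
    unfolding mpol_const_def by (rule mult_map_scale_conv_mult[symmetric])
  then show ?thesis by (simp add: Poly_Mapping.map.rep_eq when_def)
qed

lemma mpol_const_hom:
  "mpol_const (a + b) = mpol_const a + mpol_const b"
  "mpol_const (a * b) = mpol_const a * mpol_const b"
  "mpol_const 0 = 0" "mpol_const 1 = 1"
  by (auto simp: mpol_const_def single_add mult_single)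

lemma mpol_const_sum: "mpol_const (sum f S) = (\<Sum>x\<in>S. mpol_const (f x))"
  by (induction S rule: infinite_finite_induct) (auto simp: mpol_const_hom)

lemma mpol_const_prod: "mpol_const (prod f S) = (\<Prod>x\<in>S. mpol_const (f x))"
  by (induction S rule: infinite_finite_induct) (auto simp: mpol_const_hom)

lemma mpol_const_power: "mpol_const (c ^ n) = mpol_const c ^ n"
  by (induction n) (auto simp: mpol_const_hom)

lemma lookup_mon: "lookup (monomial \<gamma>) \<delta> = (if \<gamma> = \<delta> then 1 else 0)"
  by (simp add: monomial_def lookup_single when_def)

lemma keys_mon[simp]: "keys (monomial \<gamma>) = {\<gamma>}"
  by (simp add: monomial_def)

lemma mon_add: "monomial (\<gamma> + \<delta>) = monomial \<gamma> * monomial \<delta>"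
  by (simp add: monomial_def mult_single)

lemma mon_zero: "monomial 0 = 1"
  by (simp add: monomial_def)

lemma mpol_expand:
  assumes "finite S" "keys p \<subseteq> S"
  shows "p = (\<Sum>\<gamma>\<in>S. mpol_const (lookup p \<gamma>) * monomial \<gamma>)"
proof (rule poly_mapping_eqI)
  fix \<delta>
  have "lookup (\<Sum>\<gamma>\<in>S. mpol_const (lookup p \<gamma>) * monomial \<gamma>) \<delta> = (\<Sum>\<gamma>\<in>S. if \<gamma> = \<delta> then lookup p \<delta> else 0)"
    by (auto simp: lookup_sum lookup_const_mult lookup_mon intro!: sum.cong)
  also have "\<dots> = lookup p \<delta>" using assms by (auto simp: in_keys_iff)
  finally show "lookup p \<delta> = lookup (\<Sum>\<gamma>\<in>S. mpol_const (lookup p \<gamma>) * monomial \<gamma>) \<delta>" by simp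
qed

lemma mon_val_superset:
  assumes "finite S" "keys \<gamma> \<subseteq> S"
  shows "mon_val y \<gamma> = (\<Prod>k\<in>S. y k ^ lookup \<gamma> k)"
  unfolding mon_val_def using assms by (intro prod.mono_neutral_left) (auto simp: in_keys_iff)

lemma wt_superset:
  assumes "finite S" "keys \<gamma> \<subseteq> S"
  shows "wt w \<gamma> = (\<Sum>k\<in>S. lookup \<gamma> k * w k)"
  unfolding wt_def using assms by (intro sum.mono_neutral_left) (auto simp: in_keys_iff)

lemma keys_add_nat: "keys (\<gamma> + \<delta> :: nat \<Rightarrow>\<^sub>0 nat) = keys \<gamma> \<union> keys \<delta>"
  by (auto simp: in_keys_iff lookup_add)

lemma mon_val_add: "mon_val y (\<gamma> + \<delta>) = mon_val y \<gamma> * mon_val y \<delta>"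
  by (simp add: mon_val_superset[of "keys \<gamma> \<union> keys \<delta>"] keys_add_nat lookup_add power_add prod.distrib)

lemma wt_add: "wt w (\<gamma> + \<delta>) = wt w \<gamma> + wt w \<delta>"
  by (simp add: wt_superset[of "keys \<gamma> \<union> keys \<delta>"] keys_add_nat lookup_add sum.distrib add_mult_distrib)

lemma mon_val_zero[simp]: "mon_val y 0 = 1"
  by (simp add: mon_val_def)

lemma wt_zero[simp]: "wt w 0 = 0"
  by (simp add: wt_def)

lemma mon_val_single[simp]: "mon_val y (Poly_Mapping.single k n) = y k ^ n"
  by (cases "n = 0") (auto simp: mon_val_def)

lemma wt_single[simp]: "wt w (Poly_Mapping.single k n) = n * w k"
  by (cases "n = 0") (auto simp: wt_def)

lemma mpol_subst_superset:
  assumes "finite S" "keys p \<subseteq> S"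
  shows "mpol_subst y p = (\<Sum>\<gamma>\<in>S. mpol_const (lookup p \<gamma>) * mon_val y \<gamma>)"
  unfolding mpol_subst_def mon_val_def[symmetric] using assms
  by (intro sum.mono_neutral_left) (auto simp: in_keys_iff mpol_const_hom)

lemma mpol_subst_add: "mpol_subst y (p + q) = mpol_subst y p + mpol_subst y q"
proof -
  have "keys (p + q) \<subseteq> keys p \<union> keys q" by (rule Poly_Mapping.keys_add)
  then show ?thesis
    by (simp add: mpol_subst_superset[of "keys p \<union> keys q"] lookup_add mpol_const_hom distrib_right sum.distrib)
qed

lemma mpol_subst_const_mult: "mpol_subst y (mpol_const c * p) = mpol_const c * mpol_subst y p"
proof -
  have "keys (mpol_const c * p) \<subseteq> keys p" by (auto simp: in_keys_iff lookup_const_mult)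
  then show ?thesis
    by (simp add: mpol_subst_superset[of "keys p"] lookup_const_mult mpol_const_hom sum_distrib_left mult.assoc)
qed

lemma mpol_subst_zero[simp]: "mpol_subst y 0 = 0"
  by (simp add: mpol_subst_def)

lemma mpol_subst_sum: "mpol_subst y (sum f S) = (\<Sum>x\<in>S. mpol_subst y (f x))"
  by (induction S rule: infinite_finite_induct) (auto simp: mpol_subst_add)

lemma mpol_subst_mon[simp]: "mpol_subst y (monomial \<gamma>) = mon_val y \<gamma>"
  by (simp add: mpol_subst_superset[of "{\<gamma>}"] lookup_mon mpol_const_hom)

lemma mpol_subst_mult: "mpol_subst y (p * q) = mpol_subst y p * mpol_subst y q"
proof -
  have "p * q = (\<Sum>\<gamma>\<in>keys p. mpol_const (lookup p \<gamma>) * monomial \<gamma>) * (\<Sum>\<delta>\<in>keys q. mpol_const (lookup q \<delta>) * monomial \<delta>)"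
    using mpol_expand[of "keys p" p] mpol_expand[of "keys q" q] by simp
  also have "\<dots> = (\<Sum>\<gamma>\<in>keys p. \<Sum>\<delta>\<in>keys q. mpol_const (lookup p \<gamma>) * (mpol_const (lookup q \<delta>) * monomial (\<gamma> + \<delta>)))"
    by (simp add: sum_product mon_add mult_ac)
  finally have "mpol_subst y (p * q) =
      (\<Sum>\<gamma>\<in>keys p. \<Sum>\<delta>\<in>keys q. mpol_const (lookup p \<gamma>) * (mpol_const (lookup q \<delta>) * (mon_val y \<gamma> * mon_val y \<delta>)))"
    by (simp add: mpol_subst_sum mpol_subst_const_mult mon_val_add)
  then show ?thesis
    by (simp add: mpol_subst_superset[of "keys p" p] mpol_subst_superset[of "keys q" q] sum_product mult_ac)
qed

lemma mpol_subst_one[simp]: "mpol_subst y 1 = 1"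
  using mpol_subst_mon[of y 0] by (simp add: mon_zero)

lemma mpol_subst_const[simp]: "mpol_subst y (mpol_const c) = mpol_const c"
  using mpol_subst_const_mult[of y c 1] by simp

lemma mpol_subst_power: "mpol_subst y (p ^ n) = mpol_subst y p ^ n"
  by (induction n) (auto simp: mpol_subst_mult)

lemma mpol_subst_prod: "mpol_subst y (prod f S) = (\<Prod>x\<in>S. mpol_subst y (f x))"
  by (induction S rule: infinite_finite_induct) (auto simp: mpol_subst_mult)

lemma mpol_subst_var[simp]: "mpol_subst y (mpol_var k) = y k"
  using mpol_subst_mon[of y "Poly_Mapping.single k 1"] by (simp add: monomial_def mpol_var_def)

lemma mpol_subst_subst:
  "mpol_subst y (mpol_subst z p) = mpol_subst (\<lambda>k. mpol_subst y (z k)) p"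
  unfolding mpol_subst_def[of z] mpol_subst_sum mpol_subst_const_mult mpol_subst_prod mpol_subst_power
  by (simp add: mpol_subst_def)

lemma mon_val_cong: 
  assumes "keys \<gamma> \<subseteq> {..<d}" "\<And>k. k < d \<Longrightarrow> y k = y' k"
  shows "mon_val y \<gamma> = mon_val y' \<gamma>"
  unfolding mon_val_def using assms by (intro prod.cong) auto

lemma mpol_subst_cong:
  assumes "p \<in> sym_alg d" "\<And>k. k < d \<Longrightarrow> y k = y' k"
  shows "mpol_subst y p = mpol_subst y' p"
  unfolding mpol_subst_superset[OF finite_keys subset_refl] 
  by (intro sum.cong refl arg_cong2[where f="(*)"] mon_val_cong) (use assms in \<open>auto simp: sym_alg_def\<close>)

lemma mon_prod: "finite S \<Longrightarrow> monomial (\<Sum>k\<in>S. f k) = (\<Prod>k\<in>S. monomial (f k))"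
  by (induction S rule: finite_induct) (auto simp: mon_zero mon_add)

lemma mon_power: "monomial (Poly_Mapping.single k n) = mpol_var k ^ n"
proof (induction n)
  case (Suc n)
  have "Poly_Mapping.single k (Suc n) = Poly_Mapping.single k 1 + Poly_Mapping.single k n"
    by (simp add: single_add[symmetric])
  then show ?case using Suc by (simp add: mon_add) (simp add: monomial_def mpol_var_def)
qed (simp add: mon_zero)

lemma mon_val_var: "mon_val mpol_var \<gamma> = monomial \<gamma>"
proof -
  have "\<gamma> = (\<Sum>k\<in>keys \<gamma>. Poly_Mapping.single k (lookup \<gamma> k))"
    by (rule poly_mapping_eqI) (auto simp: lookup_sum lookup_single when_def in_keys_iff)
  then have "monomial \<gamma> = monomial (\<Sum>k\<in>keys \<gamma>. Poly_Mapping.single k (lookup \<gamma> k))" by simp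
  also have "\<dots> = mon_val mpol_var \<gamma>" by (simp add: mon_prod mon_power mon_val_def)
  finally show ?thesis by simp
qed

section \<open>Closure of the symmetric algebra\<close>

lemma sym_alg_zero[simp]: "0 \<in> sym_alg d" by (simp add: sym_alg_def)

lemma sym_alg_add: "p \<in> sym_alg d \<Longrightarrow> q \<in> sym_alg d \<Longrightarrow> p + q \<in> sym_alg d"
  using Poly_Mapping.keys_add[of p q] by (auto simp: sym_alg_def)

lemma sym_alg_sum: "(\<And>x. x \<in> S \<Longrightarrow> f x \<in> sym_alg d) \<Longrightarrow> sum f S \<in> sym_alg d"
  by (induction S rule: infinite_finite_induct) (auto intro: sym_alg_add)

lemma sym_alg_const_mult: "p \<in> sym_alg d \<Longrightarrow> mpol_const c * p \<in> sym_alg d"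
  by (auto simp: sym_alg_def in_keys_iff lookup_const_mult)

lemma sym_alg_mult: "p \<in> sym_alg d \<Longrightarrow> q \<in> sym_alg d \<Longrightarrow> p * q \<in> sym_alg d"
  using keys_mult[of p q] by (force simp: sym_alg_def keys_add_nat)

lemma sym_alg_mon: "monomial \<gamma> \<in> sym_alg d \<longleftrightarrow> keys \<gamma> \<subseteq> {..<d}"
  by (simp add: sym_alg_def)

lemma sym_alg_one[simp]: "1 \<in> sym_alg d"
  using sym_alg_mon[of 0 d] by (simp add: mon_zero)

lemma sym_alg_power: "p \<in> sym_alg d \<Longrightarrow> p ^ n \<in> sym_alg d"
  by (induction n) (auto intro: sym_alg_mult)

lemma sym_alg_prod: "(\<And>x. x \<in> S \<Longrightarrow> f x \<in> sym_alg d) \<Longrightarrow> prod f S \<in> sym_alg d"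
  by (induction S rule: infinite_finite_induct) (auto intro: sym_alg_mult)

lemma sym_alg_var: "k < d \<Longrightarrow> mpol_var k \<in> sym_alg d"
  using sym_alg_mon[of "Poly_Mapping.single k 1" d] by (simp add: monomial_def mpol_var_def)

lemma sym_alg_mon_val: "keys \<gamma> \<subseteq> {..<d} \<Longrightarrow> (\<And>k. k < d \<Longrightarrow> y k \<in> sym_alg d') \<Longrightarrow> mon_val y \<gamma> \<in> sym_alg d'"
  unfolding mon_val_def by (intro sym_alg_prod sym_alg_power) auto

lemma sym_alg_subst:
  assumes "p \<in> sym_alg d" "\<And>k. k < d \<Longrightarrow> y k \<in> sym_alg d'"
  shows "mpol_subst y p \<in> sym_alg d'"
  unfolding mpol_subst_superset[OF finite_keys subset_refl]
  using assms by (intro sym_alg_sum sym_alg_const_mult sym_alg_mon_val[of _ d]) (auto simp: sym_alg_def)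

section \<open>Homogeneity\<close>

text \<open>The constant is written \<open>Suc 0\<close> because this is the form into which the simplifier brings it.\<close>

abbreviation tdeg :: "(nat \<Rightarrow>\<^sub>0 nat) \<Rightarrow> nat" where "tdeg \<equiv> wt (\<lambda>_. Suc 0)"

lemma homogeneous_iff: "homogeneous e p \<longleftrightarrow> (\<forall>\<gamma>\<in>keys p. tdeg \<gamma> = e)"
  by (simp add: homogeneous_def wt_def)

lemma homogeneousD: "homogeneous e p \<Longrightarrow> tdeg \<gamma> \<noteq> e \<Longrightarrow> lookup p \<gamma> = 0"
  by (auto simp: homogeneous_iff in_keys_iff)

lemma homogeneous_add: "homogeneous e p \<Longrightarrow> homogeneous e q \<Longrightarrow> homogeneous e (p + q)"
  using Poly_Mapping.keys_add[of p q] by (auto simp: homogeneous_iff)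

lemma homogeneous_zero[simp]: "homogeneous e 0" by (simp add: homogeneous_iff)

lemma homogeneous_sum: "(\<And>x. x \<in> S \<Longrightarrow> homogeneous e (f x)) \<Longrightarrow> homogeneous e (sum f S)"
  by (induction S rule: infinite_finite_induct) (auto intro: homogeneous_add)

lemma homogeneous_const_mult: "homogeneous e p \<Longrightarrow> homogeneous e (mpol_const c * p)"
  by (auto simp: homogeneous_iff in_keys_iff lookup_const_mult)

lemma homogeneous_mult: "homogeneous a p \<Longrightarrow> homogeneous b q \<Longrightarrow> homogeneous (a + b) (p * q)"
  using keys_mult[of p q] by (force simp: homogeneous_iff wt_add)

lemma homogeneous_mon: "homogeneous e (monomial \<gamma>) \<longleftrightarrow> tdeg \<gamma> = e"
  by (simp add: homogeneous_iff)

lemma homogeneous_one: "homogeneous 0 1"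
  using homogeneous_mon[of 0 0] by (simp add: mon_zero)

lemma homogeneous_power: "homogeneous a p \<Longrightarrow> homogeneous (n * a) (p ^ n)"
  by (induction n) (auto simp: homogeneous_one intro: homogeneous_mult)

lemma homogeneous_prod: "finite S \<Longrightarrow> (\<And>x. x \<in> S \<Longrightarrow> homogeneous (a x) (f x)) \<Longrightarrow> homogeneous (sum a S) (prod f S)"
  by (induction S rule: finite_induct) (auto simp: homogeneous_one intro: homogeneous_mult)

lemma homogeneous_mon_val:
  "keys \<gamma> \<subseteq> {..<d} \<Longrightarrow> (\<And>k. k < d \<Longrightarrow> homogeneous (w k) (y k)) \<Longrightarrow> homogeneous (wt w \<gamma>) (mon_val y \<gamma>)"
  unfolding mon_val_def wt_def by (intro homogeneous_prod homogeneous_power) auto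

lemma homogeneous_var: "homogeneous (Suc 0) (mpol_var k)"
  using homogeneous_mon[of "Suc 0" "Poly_Mapping.single k 1"] by (simp add: monomial_def mpol_var_def)

lemma homogeneous_subst:
  assumes "p \<in> sym_alg d" "homogeneous m p" "\<And>k. k < d \<Longrightarrow> homogeneous (Suc 0) (y k)"
  shows "homogeneous m (mpol_subst y p)"
  unfolding mpol_subst_superset[OF finite_keys subset_refl]
proof (intro homogeneous_sum homogeneous_const_mult)
  fix \<gamma> assume "\<gamma> \<in> keys p"
  then have "keys \<gamma> \<subseteq> {..<d}" "tdeg \<gamma> = m" using assms by (auto simp: sym_alg_def homogeneous_iff)
  then show "homogeneous m (mon_val y \<gamma>)" using homogeneous_mon_val[of \<gamma> d "\<lambda>_. Suc 0" y] assms(3) by simp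
qed

text \<open>The terms of degree other than \<open>m\<close> must cancel among themselves.\<close>

lemma homogeneous_component:
  assumes "finite F" "\<And>i. i \<in> F \<Longrightarrow> homogeneous (w i) (p i)" "homogeneous m (\<Sum>i\<in>F. p i)"
  shows "(\<Sum>i\<in>F. p i) = (\<Sum>i | i \<in> F \<and> w i = m. p i)"
proof (rule poly_mapping_eqI)
  fix \<gamma>
  show "lookup (\<Sum>i\<in>F. p i) \<gamma> = lookup (\<Sum>i | i \<in> F \<and> w i = m. p i) \<gamma>"
  proof (cases "tdeg \<gamma> = m")
    case True
    then show ?thesis unfolding lookup_sum
      using assms(1,2) homogeneousD True by (intro sum.mono_neutral_right) (auto, metis)
  next
    case False
    then have "lookup (\<Sum>i | i \<in> F \<and> w i = m. p i) \<gamma> = 0"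
      unfolding lookup_sum using assms(2) homogeneousD by (intro sum.neutral) blast
    then show ?thesis using homogeneousD[OF assms(3) False] by simp
  qed
qed

section \<open>The action on the symmetric algebra\<close>

definition lin_form :: "complex mat \<Rightarrow> nat \<Rightarrow> mpol" where
  "lin_form A k = (\<Sum>l<dim_row A. mpol_const (A $$ (l, k)) * mpol_var l)"

lemma sym_act_eq: "sym_act A = mpol_subst (lin_form A)"
  by (intro ext) (simp add: sym_act_def lin_form_def[abs_def])

lemma lin_form_props:
  assumes "A \<in> carrier_mat d d"
  shows "lin_form A k \<in> sym_alg d" "homogeneous (Suc 0) (lin_form A k)"
  unfolding lin_form_def using assms
  by (auto intro!: sym_alg_sum sym_alg_const_mult sym_alg_var homogeneous_sum homogeneous_const_mult homogeneous_var)

lemma sym_act_closed: "A \<in> carrier_mat d d \<Longrightarrow> p \<in> sym_alg d \<Longrightarrow> sym_act A p \<in> sym_alg d"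
  unfolding sym_act_eq using lin_form_props by (intro sym_alg_subst)

lemma sym_act_homogeneous: "A \<in> carrier_mat d d \<Longrightarrow> p \<in> sym_alg d \<Longrightarrow> homogeneous m p \<Longrightarrow> homogeneous m (sym_act A p)"
  unfolding sym_act_eq using lin_form_props by (intro homogeneous_subst)

lemma sym_act_compose:
  assumes A: "A \<in> carrier_mat d d" and B: "B \<in> carrier_mat d d" and p: "p \<in> sym_alg d"
  shows "sym_act (A * B) p = sym_act A (sym_act B p)"
  unfolding sym_act_eq mpol_subst_subst
proof (rule mpol_subst_cong[OF p])
  fix k assume k: "k < d"
  have "mpol_subst (lin_form A) (lin_form B k) = (\<Sum>l<d. mpol_const (B $$ (l,k)) * lin_form A l)"
    using B by (simp add: lin_form_def[of B] mpol_subst_sum mpol_subst_const_mult)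
  also have "\<dots> = (\<Sum>l<d. \<Sum>m<d. mpol_const (A $$ (m,l) * B $$ (l,k)) * mpol_var m)"
    using A by (simp add: lin_form_def sum_distrib_left mpol_const_hom mult_ac)
  also have "\<dots> = (\<Sum>m<d. mpol_const (\<Sum>l<d. A $$ (m,l) * B $$ (l,k)) * mpol_var m)"
    by (subst sum.swap) (simp add: mpol_const_sum sum_distrib_right)
  also have "\<dots> = lin_form (A * B) k"
    using A mult_mat_entry[OF A B _ k] by (simp add: lin_form_def del: index_mult_mat(1))
  finally show "lin_form (A * B) k = mpol_subst (lin_form A) (lin_form B k)" by simp
qed

lemma lin_form_diag:
  assumes "k < d"
  shows "lin_form (diag_of d ev) k = mpol_const (ev k) * mpol_var k"
proof -
  have "lin_form (diag_of d ev) k = (\<Sum>l<d. if l = k then mpol_const (ev k) * mpol_var k else 0)"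
    unfolding lin_form_def using assms by (intro sum.cong) (auto simp: diag_of_def mpol_const_hom)
  then show ?thesis using assms by simp
qed

text \<open>Monomials are eigenvectors of a diagonal matrix.\<close>

lemma sym_act_diag:
  assumes "keys \<gamma> \<subseteq> {..<d}"
  shows "sym_act (diag_of d ev) (monomial \<gamma>) = mpol_const (\<Prod>l<d. ev l ^ lookup \<gamma> l) * monomial \<gamma>"
proof -
  have "sym_act (diag_of d ev) (monomial \<gamma>) = mon_val (\<lambda>k. mpol_const (ev k) * mpol_var k) \<gamma>"
    unfolding sym_act_eq mpol_subst_mon by (rule mon_val_cong[OF assms lin_form_diag])
  also have "\<dots> = (\<Prod>l<d. mpol_const (ev l) ^ lookup \<gamma> l) * mon_val mpol_var \<gamma>"
    unfolding mon_val_superset[OF finite_lessThan assms] by (simp add: power_mult_distrib prod.distrib)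
  finally show ?thesis by (simp add: mon_val_var mpol_const_prod mpol_const_power)
qed

lemma sym_act_linear:
  "sym_act A (p + q) = sym_act A p + sym_act A q"
  "sym_act A (mpol_const c * p) = mpol_const c * sym_act A p"
  "sym_act A (sum f S) = (\<Sum>x\<in>S. sym_act A (f x))"
  "sym_act A (p * q) = sym_act A p * sym_act A q"
  by (auto simp: sym_act_eq mpol_subst_add mpol_subst_const_mult mpol_subst_sum mpol_subst_mult)

section \<open>Exponents of given weight\<close>

definition exponents :: "nat \<Rightarrow> (nat \<Rightarrow> nat) \<Rightarrow> nat \<Rightarrow> (nat \<Rightarrow>\<^sub>0 nat) set" where
  "exponents d w m = {\<gamma>. keys \<gamma> \<subseteq> {..<d} \<and> wt w \<gamma> = m}"

lemma finite_exponents: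
  assumes "\<And>k. k < d \<Longrightarrow> w k > 0"
  shows "finite (exponents d w m)"
proof -
  let ?f = "\<lambda>\<gamma>. restrict (lookup \<gamma>) {..<d}"
  have "?f ` exponents d w m \<subseteq> {..<d} \<rightarrow>\<^sub>E {..m}"
  proof
    fix f assume "f \<in> ?f ` exponents d w m"
    then obtain \<gamma> where \<gamma>: "keys \<gamma> \<subseteq> {..<d}" "wt w \<gamma> = m" and f: "f = ?f \<gamma>" by (auto simp: exponents_def)
    have "lookup \<gamma> k \<le> m" if k: "k < d" for k
    proof -
      have "lookup \<gamma> k * 1 \<le> lookup \<gamma> k * w k" using assms[OF k] by (intro mult_le_mono2) simp
      also have "\<dots> \<le> (\<Sum>k<d. lookup \<gamma> k * w k)" using k by (intro member_le_sum) auto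
      also have "\<dots> = m" using wt_superset[OF finite_lessThan \<gamma>(1)] \<gamma>(2) by simp
      finally show ?thesis by simp
    qed
    then show "f \<in> {..<d} \<rightarrow>\<^sub>E {..m}" using f by auto
  qed
  then have "finite (?f ` exponents d w m)" by (rule finite_subset) (auto intro: finite_PiE)
  moreover have "inj_on ?f (exponents d w m)"
  proof (rule inj_onI)
    fix \<gamma> \<delta> assume g: "\<gamma> \<in> exponents d w m" and h: "\<delta> \<in> exponents d w m" and eq: "?f \<gamma> = ?f \<delta>"
    show "\<gamma> = \<delta>"
    proof (rule poly_mapping_eqI)
      fix k
      show "lookup \<gamma> k = lookup \<delta> k"
      proof (cases "k < d")
        case True
        then show ?thesis using fun_cong[OF eq, of k] by simp
      next
        case False
        then have "k \<notin> keys \<gamma>" "k \<notin> keys \<delta>" using g h by (auto simp: exponents_def)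
        then show ?thesis by (simp add: in_keys_iff)
      qed
    qed
  qed
  ultimately show ?thesis by (rule finite_imageD)
qed

text \<open>The exponents in which \<open>x\<^sub>d\<close> occurs correspond to all exponents of weight lower by \<open>w d\<close>, by
  dividing by \<open>x\<^sub>d\<close>. Hence multiplication by \<open>1 - c\<^sub>d X^(w d)\<close> removes the variable \<open>x\<^sub>d\<close> from the
  series. With eigenvalues for \<open>c\<close> and weights \<open>1\<close> this sums the traces on the symmetric powers;
  with \<open>c = 1\<close> and the degrees of the parameters as weights it counts monomials in the
  parameters.\<close>

lemma exponents_generating_function:
  fixes c :: "nat \<Rightarrow> complex"
  assumes "\<And>k. k < d \<Longrightarrow> w k > 0"
  shows "Abs_fps (\<lambda>m. \<Sum>\<gamma>\<in>exponents d w m. \<Prod>l<d. c l ^ lookup \<gamma> l) * (\<Prod>l<d. 1 - fps_const (c l) * fps_X ^ w l) = 1"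
  using assms
proof (induction d)
  case 0
  have "exponents 0 w m = (if m = 0 then {0} else {})" for m by (auto simp: exponents_def)
  then show ?case by (intro fps_ext) simp
next
  case (Suc d)
  let ?F = "\<lambda>d. Abs_fps (\<lambda>m. \<Sum>\<gamma>\<in>exponents d w m. \<Prod>l<d. c l ^ lookup \<gamma> l)"
  let ?s = "Poly_Mapping.single d (1::nat)"
  have "?F (Suc d) * (1 - fps_const (c d) * fps_X ^ w d) = ?F d"
  proof (rule fps_ext)
    fix m
    let ?h = "\<lambda>\<gamma>. \<Prod>l<Suc d. c l ^ lookup \<gamma> l"
    let ?N = "{\<gamma> \<in> exponents (Suc d) w m. lookup \<gamma> d > 0}"
    have fin: "finite (exponents (Suc d) w m')" for m' using Suc.prems by (rule finite_exponents)
    have split: "exponents (Suc d) w m = exponents d w m \<union> ?N"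
      by (auto simp: exponents_def in_keys_iff subset_iff less_Suc_eq) 
    have "(\<Sum>\<gamma>\<in>exponents (Suc d) w m. ?h \<gamma>) = (\<Sum>\<gamma>\<in>exponents d w m. ?h \<gamma>) + (\<Sum>\<gamma>\<in>?N. ?h \<gamma>)"
    proof (subst split, rule sum.union_disjoint)
      show "finite (exponents d w m)" "finite ?N" using fin[of m] Suc.prems by (auto intro: finite_exponents)
      show "exponents d w m \<inter> ?N = {}" by (auto simp: exponents_def in_keys_iff subset_iff)
    qed
    also have "(\<Sum>\<gamma>\<in>exponents d w m. ?h \<gamma>) = (\<Sum>\<gamma>\<in>exponents d w m. \<Prod>l<d. c l ^ lookup \<gamma> l)"
    proof (rule sum.cong[OF refl])
      fix \<gamma> assume "\<gamma> \<in> exponents d w m"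
      then have "lookup \<gamma> d = 0" by (auto simp: exponents_def in_keys_iff subset_iff)
      then show "?h \<gamma> = (\<Prod>l<d. c l ^ lookup \<gamma> l)" by simp
    qed
    also have "(\<Sum>\<gamma>\<in>?N. ?h \<gamma>) = (if m < w d then 0 else c d * (\<Sum>\<gamma>\<in>exponents (Suc d) w (m - w d). ?h \<gamma>))"
    proof (cases "m < w d")
      case True
      have "?N = {}"
      proof (rule ccontr)
        assume "?N \<noteq> {}"
        then obtain \<gamma> where \<gamma>: "keys \<gamma> \<subseteq> {..<Suc d}" "wt w \<gamma> = m" "lookup \<gamma> d > 0" by (auto simp: exponents_def)
        have "w d \<le> lookup \<gamma> d * w d" using \<gamma>(3) by simp
        also have "\<dots> \<le> (\<Sum>k<Suc d. lookup \<gamma> k * w k)" by (intro member_le_sum) auto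
        also have "\<dots> = m" using wt_superset[OF finite_lessThan \<gamma>(1)] \<gamma>(2) by simp
        finally show False using True by simp
      qed
      then show ?thesis using True by (simp only: if_True sum.empty)
    next
      case False
      have "(\<Sum>\<gamma>\<in>?N. ?h \<gamma>) = (\<Sum>\<gamma>\<in>exponents (Suc d) w (m - w d). ?h (\<gamma> + ?s))"
      proof (rule sum.reindex_bij_witness[of _ "\<lambda>\<gamma>. \<gamma> + ?s" "\<lambda>\<gamma>. \<gamma> - ?s"])
        fix \<gamma> assume \<gamma>: "\<gamma> \<in> ?N"
        show eq: "\<gamma> - ?s + ?s = \<gamma>"
          using \<gamma> by (intro poly_mapping_eqI) (auto simp: lookup_add lookup_minus lookup_single when_def)
        have "keys (\<gamma> - ?s) \<subseteq> keys \<gamma>" by (auto simp: in_keys_iff lookup_minus)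
        moreover have "wt w (\<gamma> - ?s) + w d = wt w \<gamma>" using wt_add[of w "\<gamma> - ?s" ?s] unfolding eq by simp
        ultimately show "\<gamma> - ?s \<in> exponents (Suc d) w (m - w d)" using \<gamma> by (auto simp: exponents_def)
        show "?h (\<gamma> - ?s + ?s) = ?h \<gamma>" unfolding eq ..
      next
        fix \<gamma> assume \<gamma>: "\<gamma> \<in> exponents (Suc d) w (m - w d)"
        show "\<gamma> + ?s - ?s = \<gamma>" by simp
        show "\<gamma> + ?s \<in> ?N" using \<gamma> False
          by (auto simp: exponents_def keys_add_nat wt_add lookup_add)
      qed
      also have "\<dots> = (\<Sum>\<gamma>\<in>exponents (Suc d) w (m - w d). c d * ?h \<gamma>)"
      proof (rule sum.cong[OF refl])
        fix \<gamma>
        have "(\<Prod>l<d. c l ^ lookup (\<gamma> + ?s) l) = (\<Prod>l<d. c l ^ lookup \<gamma> l)"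
          by (intro prod.cong) (auto simp: lookup_add lookup_single when_def)
        then show "?h (\<gamma> + ?s) = c d * ?h \<gamma>" by (simp add: lookup_add)
      qed
      finally show ?thesis using False by (simp add: sum_distrib_left)
    qed
    finally show "fps_nth (?F (Suc d) * (1 - fps_const (c d) * fps_X ^ w d)) m = fps_nth (?F d) m"
      by (simp add: right_diff_distrib fps_X_power_mult_right_nth mult.assoc[symmetric] fps_mult_right_const_nth mult.commute[of "c d"] del: prod.lessThan_Suc)
  qed
  then have "?F (Suc d) * (\<Prod>l<Suc d. 1 - fps_const (c l) * fps_X ^ w l) = ?F d * (\<Prod>l<d. 1 - fps_const (c l) * fps_X ^ w l)"
    by (simp add: mult_ac)
  then show ?case using Suc by simp
qed

section \<open>Traces on symmetric powers\<close>

abbreviation mons :: "nat \<Rightarrow> nat \<Rightarrow> (nat \<Rightarrow>\<^sub>0 nat) set" where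
  "mons d m \<equiv> exponents d (\<lambda>_. Suc 0) m"

lemma finite_mons[simp]: "finite (mons d m)"
  by (rule finite_exponents) simp

lemma mons_mon: "\<gamma> \<in> mons d m \<Longrightarrow> monomial \<gamma> \<in> sym_alg d \<and> homogeneous m (monomial \<gamma>)"
  by (simp add: exponents_def sym_alg_mon homogeneous_mon)

lemma homogeneous_expand:
  assumes "p \<in> sym_alg d" "homogeneous m p"
  shows "p = (\<Sum>\<gamma>\<in>mons d m. mpol_const (lookup p \<gamma>) * monomial \<gamma>)"
  by (rule mpol_expand[OF finite_mons]) (use assms in \<open>auto simp: sym_alg_def homogeneous_iff exponents_def\<close>)

definition sym_trace :: "nat \<Rightarrow> complex mat \<Rightarrow> nat \<Rightarrow> complex" where
  "sym_trace d A m = (\<Sum>\<gamma>\<in>mons d m. lookup (sym_act A (monomial \<gamma>)) \<gamma>)"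

lemma sym_act_matrix_mult:
  assumes A: "A \<in> carrier_mat d d" and B: "B \<in> carrier_mat d d" and \<gamma>: "\<gamma> \<in> mons d m"
  shows "lookup (sym_act (A * B) (monomial \<gamma>)) \<delta> = (\<Sum>\<epsilon>\<in>mons d m. lookup (sym_act B (monomial \<gamma>)) \<epsilon> * lookup (sym_act A (monomial \<epsilon>)) \<delta>)"
proof -
  have p: "monomial \<gamma> \<in> sym_alg d" "homogeneous m (monomial \<gamma>)" using mons_mon[OF \<gamma>] by auto
  have "sym_act A (sym_act B (monomial \<gamma>)) = sym_act A (\<Sum>\<epsilon>\<in>mons d m. mpol_const (lookup (sym_act B (monomial \<gamma>)) \<epsilon>) * monomial \<epsilon>)"
    using homogeneous_expand[OF sym_act_closed[OF B p(1)] sym_act_homogeneous[OF B p]] by simp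
  then show ?thesis
    by (simp add: sym_act_compose[OF A B p(1)] sym_act_linear(2,3) lookup_sum lookup_const_mult)
qed

lemma sym_trace_commute:
  assumes A: "A \<in> carrier_mat d d" and B: "B \<in> carrier_mat d d"
  shows "sym_trace d (A * B) m = sym_trace d (B * A) m"
  unfolding sym_trace_def using sym_act_matrix_mult[OF A B] sym_act_matrix_mult[OF B A]
  by simp (subst sum.swap, simp add: mult.commute)

text \<open>The trace on the polynomials of degree \<open>m\<close> is cyclic, so it can be computed after conjugation to
  the diagonal matrix.\<close>

lemma sym_trace_diagonalizable:
  assumes P: "P \<in> carrier_mat d d" and Q: "Q \<in> carrier_mat d d" and QP: "Q * P = 1\<^sub>m d"
  shows "sym_trace d (P * diag_of d ev * Q) m = (\<Sum>\<gamma>\<in>mons d m. \<Prod>l<d. ev l ^ lookup \<gamma> l)"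
proof -
  have "P * diag_of d ev * Q = P * (diag_of d ev * Q)" by (rule assoc_mult_mat[OF P diag_of_carrier Q])
  then have "sym_trace d (P * diag_of d ev * Q) m = sym_trace d (diag_of d ev * Q * P) m"
    using sym_trace_commute[OF P mult_carrier_mat[OF diag_of_carrier Q]] by simp
  also have "diag_of d ev * Q * P = diag_of d ev"
    using assoc_mult_mat[OF diag_of_carrier Q P] QP right_mult_one_mat[OF diag_of_carrier] by simp
  finally show ?thesis
    by (simp add: sym_trace_def sym_act_diag exponents_def lookup_const_mult lookup_mon)
qed

lemma sym_trace_generating_function:
  assumes P: "P \<in> carrier_mat d d" and Q: "Q \<in> carrier_mat d d" and QP: "Q * P = 1\<^sub>m d"
  shows "Abs_fps (sym_trace d (P * diag_of d ev * Q)) * (\<Prod>l<d. 1 - fps_const (ev l) * fps_X) = 1"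
proof -
  have "sym_trace d (P * diag_of d ev * Q) = (\<lambda>m. \<Sum>\<gamma>\<in>mons d m. \<Prod>l<d. ev l ^ lookup \<gamma> l)"
    by (rule ext) (rule sym_trace_diagonalizable[OF assms])
  then show ?thesis using exponents_generating_function[of d "\<lambda>_. Suc 0" ev] by simp
qed


section \<open>The Hilbert series of the covariants\<close>

context finite_group
begin

text \<open>The average over the group of the map \<open>v \<mapsto> v\<^sub>s x\<^sup>\<gamma>\<close>. These maps, for all \<open>s\<close> and all \<open>\<gamma>\<close> of
  degree \<open>m\<close>, form a basis of the linear maps into the polynomials of degree \<open>m\<close>.\<close>

definition avg_cov :: "('a \<Rightarrow> complex mat) \<Rightarrow> ('a \<Rightarrow> complex mat) \<Rightarrow> nat \<Rightarrow> (nat \<Rightarrow>\<^sub>0 nat) \<Rightarrow> complex vec \<Rightarrow> mpol" where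
  "avg_cov R \<sigma> s \<gamma> v =
     (\<Sum>g\<in>carrier G. mpol_const ((\<sigma> (inv g) *\<^sub>v v) $ s / of_nat (Coset.order G)) * sym_act (R g) (monomial \<gamma>))"

lemma covariantsD:
  assumes "\<phi> \<in> covariants G d R r \<sigma>"
  shows "v \<in> carrier_vec r \<Longrightarrow> \<phi> v \<in> sym_alg d"
    and "v \<in> carrier_vec r \<Longrightarrow> w \<in> carrier_vec r \<Longrightarrow> \<phi> (v + w) = \<phi> v + \<phi> w"
    and "v \<in> carrier_vec r \<Longrightarrow> \<phi> (c \<cdot>\<^sub>v v) = mpol_const c * \<phi> v"
    and "g \<in> carrier G \<Longrightarrow> v \<in> carrier_vec r \<Longrightarrow> \<phi> (\<sigma> g *\<^sub>v v) = sym_act (R g) (\<phi> v)"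
  using assms by (auto simp: covariants_def)

lemma avg_cov_covariant:
  assumes R: "is_rep G d R" and \<sigma>: "is_rep G r \<sigma>" and s: "s < r" and \<gamma>: "\<gamma> \<in> mons d m"
  shows "avg_cov R \<sigma> s \<gamma> \<in> covariants G d R r \<sigma>" "homogeneous m (avg_cov R \<sigma> s \<gamma> v)"
proof -
  have Rc: "R g \<in> carrier_mat d d" and Sc: "\<sigma> g \<in> carrier_mat r r" if "g \<in> carrier G" for g
    using is_repD(1)[OF R that] is_repD(1)[OF \<sigma> that] by auto
  have p: "monomial \<gamma> \<in> sym_alg d" "homogeneous m (monomial \<gamma>)" using mons_mon[OF \<gamma>] by auto
  show "homogeneous m (avg_cov R \<sigma> s \<gamma> v)"
    unfolding avg_cov_def using Rc p
    by (intro homogeneous_sum homogeneous_const_mult sym_act_homogeneous) auto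
  show "avg_cov R \<sigma> s \<gamma> \<in> covariants G d R r \<sigma>"
    unfolding covariants_def
  proof (intro CollectI conjI ballI allI)
    fix v w :: "complex vec" assume v: "v \<in> carrier_vec r"
    show "avg_cov R \<sigma> s \<gamma> v \<in> sym_alg d"
      unfolding avg_cov_def using Rc p by (intro sym_alg_sum sym_alg_const_mult sym_act_closed) auto
    { fix c
      have "(\<sigma> (inv g) *\<^sub>v (c \<cdot>\<^sub>v v)) $ s = c * (\<sigma> (inv g) *\<^sub>v v) $ s" if "g \<in> carrier G" for g
        using Sc[of "inv g"] that s v by (simp add: mult_mat_vec)
      then show "avg_cov R \<sigma> s \<gamma> (c \<cdot>\<^sub>v v) = mpol_const c * avg_cov R \<sigma> s \<gamma> v"
        unfolding avg_cov_def sum_distrib_left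
        by (intro sum.cong) (auto simp: mpol_const_hom(2)[symmetric] mult.assoc[symmetric]) }
    { assume w: "w \<in> carrier_vec r"
      have "(\<sigma> (inv g) *\<^sub>v (v + w)) $ s = (\<sigma> (inv g) *\<^sub>v v) $ s + (\<sigma> (inv g) *\<^sub>v w) $ s" if "g \<in> carrier G" for g
        using Sc[of "inv g"] that s v w by (simp add: mult_add_distrib_mat_vec)
      then show "avg_cov R \<sigma> s \<gamma> (v + w) = avg_cov R \<sigma> s \<gamma> v + avg_cov R \<sigma> s \<gamma> w"
        unfolding avg_cov_def sum.distrib[symmetric]
        by (intro sum.cong) (auto simp: mpol_const_hom(1) add_divide_distrib distrib_right) }
    fix h assume h: "h \<in> carrier G"
    let ?f = "\<lambda>g. mpol_const ((\<sigma> (inv g \<otimes> h) *\<^sub>v v) $ s / of_nat (Coset.order G)) * sym_act (R g) (monomial \<gamma>)"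
    have "avg_cov R \<sigma> s \<gamma> (\<sigma> h *\<^sub>v v) = (\<Sum>g\<in>carrier G. ?f g)"
      unfolding avg_cov_def
    proof (rule sum.cong[OF refl])
      fix g assume g: "g \<in> carrier G"
      have "\<sigma> (inv g) *\<^sub>v (\<sigma> h *\<^sub>v v) = \<sigma> (inv g \<otimes> h) *\<^sub>v v"
        using assoc_mult_mat_vec[OF Sc[OF inv_closed[OF g]] Sc[OF h] v] is_repD(3)[OF \<sigma>, of "inv g" h] g h by simp
      then show "mpol_const ((\<sigma> (inv g) *\<^sub>v (\<sigma> h *\<^sub>v v)) $ s / of_nat (Coset.order G)) * sym_act (R g) (monomial \<gamma>) = ?f g"
        by simp
    qed
    also have "\<dots> = (\<Sum>g\<in>carrier G. ?f (h \<otimes> g))" by (rule sum_left_translate[OF h, symmetric])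
    also have "\<dots> = (\<Sum>g\<in>carrier G. mpol_const ((\<sigma> (inv g) *\<^sub>v v) $ s / of_nat (Coset.order G)) * sym_act (R h) (sym_act (R g) (monomial \<gamma>)))"
    proof (rule sum.cong[OF refl])
      fix g assume g: "g \<in> carrier G"
      have "inv (h \<otimes> g) \<otimes> h = inv g" using g h by (simp add: inv_mult_group m_assoc)
      moreover have "sym_act (R (h \<otimes> g)) (monomial \<gamma>) = sym_act (R h) (sym_act (R g) (monomial \<gamma>))"
        using sym_act_compose[OF Rc[OF h] Rc[OF g] p(1)] is_repD(3)[OF R h g] by simp
      ultimately show "?f (h \<otimes> g) = mpol_const ((\<sigma> (inv g) *\<^sub>v v) $ s / of_nat (Coset.order G)) * sym_act (R h) (sym_act (R g) (monomial \<gamma>))"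
        by simp
    qed
    also have "\<dots> = sym_act (R h) (avg_cov R \<sigma> s \<gamma> v)"
      unfolding avg_cov_def sym_act_linear(2,3) ..
    finally show "avg_cov R \<sigma> s \<gamma> (\<sigma> h *\<^sub>v v) = sym_act (R h) (avg_cov R \<sigma> s \<gamma> v)" .
  qed
qed

lemma covariant_unit_expansion:
  assumes \<psi>: "\<psi> \<in> covariants G d R r \<sigma>" and w: "w \<in> carrier_vec r"
  shows "\<psi> w = (\<Sum>s<r. mpol_const (w $ s) * \<psi> (unit_vec r s))"
proof -
  \<comment> \<open>induction on the number of coordinates of \<open>w\<close> that are kept\<close>
  let ?t = "\<lambda>k. vec r (\<lambda>i. if i < k then w $ i else 0)"
  have "k \<le> r \<Longrightarrow> \<psi> (?t k) = (\<Sum>s<k. mpol_const (w $ s) * \<psi> (unit_vec r s))" for k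
  proof (induction k)
    case 0
    have "?t 0 = 0 \<cdot>\<^sub>v ?t 0" by (intro eq_vecI) auto
    then have "\<psi> (?t 0) = mpol_const 0 * \<psi> (?t 0)" using covariantsD(3)[OF \<psi>, of "?t 0" 0] by simp
    then show ?case by (simp add: mpol_const_hom)
  next
    case (Suc k)
    have "?t (Suc k) = ?t k + (w $ k) \<cdot>\<^sub>v unit_vec r k"
      using Suc.prems by (intro eq_vecI) (auto simp: less_Suc_eq)
    then have "\<psi> (?t (Suc k)) = \<psi> (?t k) + mpol_const (w $ k) * \<psi> (unit_vec r k)"
      using covariantsD(2)[OF \<psi>, of "?t k" "(w $ k) \<cdot>\<^sub>v unit_vec r k"] covariantsD(3)[OF \<psi>, of "unit_vec r k"] by simp
    then show ?case using Suc by simp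
  qed
  from this[of r] have "\<psi> (?t r) = (\<Sum>s<r. mpol_const (w $ s) * \<psi> (unit_vec r s))" by simp
  moreover have "?t r = w" using w by (intro eq_vecI) auto
  ultimately show ?thesis by simp
qed

text \<open>Averaging does not change a covariant. Applied to the expansion of \<open>\<psi>\<close> in the maps
  \<open>v \<mapsto> v\<^sub>s x\<^sup>\<gamma>\<close> this writes \<open>\<psi>\<close> as a combination of averaged maps.\<close>

lemma covariant_average:
  assumes R: "is_rep G d R" and \<sigma>: "is_rep G r \<sigma>" and \<psi>: "\<psi> \<in> covariants G d R r \<sigma>"
    and hom: "\<And>v. v \<in> carrier_vec r \<Longrightarrow> homogeneous m (\<psi> v)" and v: "v \<in> carrier_vec r"
  shows "\<psi> v = (\<Sum>(s,\<gamma>)\<in>{..<r} \<times> mons d m. mpol_const (lookup (\<psi> (unit_vec r s)) \<gamma>) * avg_cov R \<sigma> s \<gamma> v)"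
proof -
  have Sc: "\<sigma> g \<in> carrier_mat r r" if "g \<in> carrier G" for g
    using is_repD(1)[OF \<sigma> that] by auto
  let ?N = "of_nat (Coset.order G) :: complex"
  have "(\<Sum>(s,\<gamma>)\<in>{..<r} \<times> mons d m. mpol_const (lookup (\<psi> (unit_vec r s)) \<gamma>) * avg_cov R \<sigma> s \<gamma> v) =
     (\<Sum>s<r. \<Sum>\<gamma>\<in>mons d m. \<Sum>g\<in>carrier G. mpol_const ((\<sigma> (inv g) *\<^sub>v v) $ s / ?N) *
        (mpol_const (lookup (\<psi> (unit_vec r s)) \<gamma>) * sym_act (R g) (monomial \<gamma>)))"
    unfolding sum.cartesian_product[symmetric] avg_cov_def sum_distrib_left by (simp add: mult_ac)
  also have "\<dots> = (\<Sum>s<r. \<Sum>g\<in>carrier G. mpol_const ((\<sigma> (inv g) *\<^sub>v v) $ s / ?N) *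
        (\<Sum>\<gamma>\<in>mons d m. mpol_const (lookup (\<psi> (unit_vec r s)) \<gamma>) * sym_act (R g) (monomial \<gamma>)))"
    unfolding sum_distrib_left by (intro sum.cong refl sum.swap)
  also have "\<dots> = (\<Sum>s<r. \<Sum>g\<in>carrier G. mpol_const ((\<sigma> (inv g) *\<^sub>v v) $ s / ?N) * sym_act (R g) (\<psi> (unit_vec r s)))"
  proof (intro sum.cong refl arg_cong2[where f="(*)"])
    fix s g
    let ?S = "\<Sum>\<gamma>\<in>mons d m. mpol_const (lookup (\<psi> (unit_vec r s)) \<gamma>) * monomial \<gamma>"
    have eq: "\<psi> (unit_vec r s) = ?S"
      by (rule homogeneous_expand) (auto intro: covariantsD(1)[OF \<psi>] hom)
    have "sym_act (R g) ?S = (\<Sum>\<gamma>\<in>mons d m. mpol_const (lookup (\<psi> (unit_vec r s)) \<gamma>) * sym_act (R g) (monomial \<gamma>))"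
      by (simp only: sym_act_linear(2,3))
    from trans[OF this[symmetric] arg_cong[OF eq[symmetric], where f="sym_act (R g)"]]
    show "(\<Sum>\<gamma>\<in>mons d m. mpol_const (lookup (\<psi> (unit_vec r s)) \<gamma>) * sym_act (R g) (monomial \<gamma>)) = sym_act (R g) (\<psi> (unit_vec r s))" .
  qed
  also have "\<dots> = (\<Sum>g\<in>carrier G. \<Sum>s<r. mpol_const ((\<sigma> (inv g) *\<^sub>v v) $ s / ?N) * sym_act (R g) (\<psi> (unit_vec r s)))"
    by (rule sum.swap)
  also have "\<dots> = (\<Sum>g\<in>carrier G. mpol_const (1 / ?N) * \<psi> v)"
  proof (rule sum.cong[OF refl])
    fix g assume g: "g \<in> carrier G"
    have w: "\<sigma> (inv g) *\<^sub>v v \<in> carrier_vec r"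
      by (rule mult_mat_vec_carrier[OF Sc[OF inv_closed[OF g]] v])
    have "(\<Sum>s<r. mpol_const ((\<sigma> (inv g) *\<^sub>v v) $ s / ?N) * sym_act (R g) (\<psi> (unit_vec r s))) =
        mpol_const (1 / ?N) * sym_act (R g) (\<Sum>s<r. mpol_const ((\<sigma> (inv g) *\<^sub>v v) $ s) * \<psi> (unit_vec r s))"
      unfolding sym_act_linear(2,3) sum_distrib_left
      by (intro sum.cong refl) (simp add: mult.assoc[symmetric] mpol_const_hom(2)[symmetric] del: index_mult_mat_vec)
    also have "(\<Sum>s<r. mpol_const ((\<sigma> (inv g) *\<^sub>v v) $ s) * \<psi> (unit_vec r s)) = \<psi> (\<sigma> (inv g) *\<^sub>v v)"
      using covariant_unit_expansion[OF \<psi> w] by simp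
    also have "sym_act (R g) (\<psi> (\<sigma> (inv g) *\<^sub>v v)) = \<psi> (\<sigma> g *\<^sub>v (\<sigma> (inv g) *\<^sub>v v))"
      using covariantsD(4)[OF \<psi> g w] by simp
    also have "\<sigma> g *\<^sub>v (\<sigma> (inv g) *\<^sub>v v) = v"
    proof -
      have "\<sigma> g * \<sigma> (inv g) = \<sigma> (g \<otimes> inv g)" using is_repD(3)[OF \<sigma>, of g "inv g"] g by simp
      then have one: "\<sigma> g * \<sigma> (inv g) = 1\<^sub>m r" using is_repD(2)[OF \<sigma>] g by simp
      show ?thesis
        unfolding assoc_mult_mat_vec[OF Sc[OF g] Sc[OF inv_closed[OF g]] v, symmetric] one
        by (rule one_mult_mat_vec[OF v])
    qed
    finally show "(\<Sum>s<r. mpol_const ((\<sigma> (inv g) *\<^sub>v v) $ s / ?N) * sym_act (R g) (\<psi> (unit_vec r s))) = mpol_const (1 / ?N) * \<psi> v" .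
  qed
  also have "\<dots> = mpol_const (\<Sum>g\<in>carrier G. 1 / ?N) * \<psi> v"
    unfolding mpol_const_sum sum_distrib_right ..
  also have "(\<Sum>g\<in>carrier G. 1 / ?N) = 1" using order_pos by (simp add: Coset.order_def)
  finally show ?thesis by (simp add: mpol_const_hom)
qed

text \<open>The left-hand side is the trace of the averaging operator in the basis of the maps
  \<open>v \<mapsto> v\<^sub>s x\<^sup>\<gamma>\<close>.\<close>

lemma avg_cov_trace:
  assumes \<sigma>: "is_rep G r \<sigma>"
  shows "(\<Sum>(s,\<gamma>)\<in>{..<r} \<times> mons d m. lookup (avg_cov R \<sigma> s \<gamma> (unit_vec r s)) \<gamma>) =
    (\<Sum>g\<in>carrier G. rep_char \<sigma> (inv g) * sym_trace d (R g) m) / of_nat (Coset.order G)"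
proof -
  let ?N = "of_nat (Coset.order G) :: complex"
  have ent: "(\<sigma> (inv g) *\<^sub>v unit_vec r s) $ s = \<sigma> (inv g) $$ (s,s)" if "g \<in> carrier G" "s < r" for g s
    using is_repD(1)[OF \<sigma>, of "inv g"] that by (simp add: mult_mat_unit_vec[of _ r r])
  have "(\<Sum>(s,\<gamma>)\<in>{..<r} \<times> mons d m. lookup (avg_cov R \<sigma> s \<gamma> (unit_vec r s)) \<gamma>) =
     (\<Sum>(s,\<gamma>)\<in>{..<r} \<times> mons d m. \<Sum>g\<in>carrier G. \<sigma> (inv g) $$ (s,s) / ?N * lookup (sym_act (R g) (monomial \<gamma>)) \<gamma>)"
    unfolding avg_cov_def
    by (intro sum.cong) (auto simp: lookup_sum lookup_const_mult ent simp del: index_mult_mat_vec intro!: sum.cong)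
  also have "\<dots> = (\<Sum>g\<in>carrier G. \<Sum>(s,\<gamma>)\<in>{..<r} \<times> mons d m. \<sigma> (inv g) $$ (s,s) / ?N * lookup (sym_act (R g) (monomial \<gamma>)) \<gamma>)"
    by (simp add: case_prod_unfold) (rule sum.swap)
  also have "\<dots> = (\<Sum>g\<in>carrier G. rep_char \<sigma> (inv g) * sym_trace d (R g) m / ?N)"
  proof (rule sum.cong[OF refl])
    fix g assume "g \<in> carrier G"
    then show "(\<Sum>(s,\<gamma>)\<in>{..<r} \<times> mons d m. \<sigma> (inv g) $$ (s,s) / ?N * lookup (sym_act (R g) (monomial \<gamma>)) \<gamma>) = rep_char \<sigma> (inv g) * sym_trace d (R g) m / ?N"
      by (simp add: rep_char_eq[OF \<sigma>] sym_trace_def sum_product sum.cartesian_product sum_divide_distrib case_prod_unfold)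
  qed
  finally show ?thesis by (simp add: sum_divide_distrib)
qed

text \<open>The pairs \<open>(k, a)\<close> index the basis \<open>\<theta>\<^sup>a \<beta>\<^sub>k\<close> of the covariants of degree \<open>m\<close>, and the right-hand
  side is the trace of the averaging operator, which projects onto these covariants. That the trace
  of a projection is its rank is seen as follows. Expand the averaged maps in the basis with
  coefficients \<open>C\<close>, and the basis in the averaged maps with coefficients \<open>L\<close>, by
  \<open>covariant_average\<close>. Linear independence of the basis forces the product of \<open>L\<close> and \<open>C\<close> to be the
  identity, whose trace is the number of pairs, while the product of \<open>C\<close> and \<open>L\<close> is the averaging
  operator.\<close>

lemma covariant_count:
  assumes R: "is_rep G d R" and \<sigma>: "is_rep G r \<sigma>"
    and hsop: "invariant_hsop G d R \<theta> deg"
    and basis: "homogeneous_covariant_basis G d R \<theta> r \<sigma> \<mu> \<beta> e"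
  shows "of_nat (card {(k,a). k < \<mu> \<and> keys a \<subseteq> {..<d} \<and> wt deg a + e k = m}) =
    (\<Sum>g\<in>carrier G. rep_char \<sigma> (inv g) * sym_trace d (R g) m) / of_nat (Coset.order G)"
proof -
  let ?Cov = "covariants G d R r \<sigma>"
  let ?X = "{..<r} \<times> mons d m"
  define K where "K = {(k,a). k < \<mu> \<and> keys a \<subseteq> {..<d} \<and> wt deg a + e k = m}"
  define b where "b = (\<lambda>(k,a) v. mon_val \<theta> a * \<beta> k v)"
  have \<theta>: "\<And>k. k < d \<Longrightarrow> \<theta> k \<in> sym_alg d" "\<And>k g. k < d \<Longrightarrow> g \<in> carrier G \<Longrightarrow> sym_act (R g) (\<theta> k) = \<theta> k"
    "\<And>k. k < d \<Longrightarrow> homogeneous (deg k) (\<theta> k)" "\<And>k. k < d \<Longrightarrow> deg k > 0"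
    and indep: "\<And>p. p \<in> sym_alg d \<Longrightarrow> mpol_subst \<theta> p = 0 \<Longrightarrow> p = 0"
    using hsop by (auto simp: invariant_hsop_def invariant_algebra_def)
  have \<beta>: "\<And>k. k < \<mu> \<Longrightarrow> \<beta> k \<in> ?Cov" "\<And>k v. k < \<mu> \<Longrightarrow> v \<in> carrier_vec r \<Longrightarrow> homogeneous (e k) (\<beta> k v)"
    and gen: "\<And>\<phi>. \<phi> \<in> ?Cov \<Longrightarrow> \<exists>c. (\<forall>k<\<mu>. c k \<in> subalg d \<theta>) \<and> (\<forall>v\<in>carrier_vec r. \<phi> v = (\<Sum>k<\<mu>. c k * \<beta> k v))"
    and free: "\<And>c k. (\<And>k. k < \<mu> \<Longrightarrow> c k \<in> subalg d \<theta>) \<Longrightarrow> (\<And>v. v \<in> carrier_vec r \<Longrightarrow> (\<Sum>k<\<mu>. c k * \<beta> k v) = 0) \<Longrightarrow> k < \<mu> \<Longrightarrow> c k = 0"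
    using basis unfolding homogeneous_covariant_basis_def by blast+
  have finK: "finite K"
  proof (rule finite_subset)
    show "K \<subseteq> {..<\<mu>} \<times> (\<Union>m'\<in>{..m}. exponents d deg m')" by (auto simp: K_def exponents_def)
    show "finite ({..<\<mu>} \<times> (\<Union>m'\<in>{..m}. exponents d deg m'))" using finite_exponents[OF \<theta>(4)] by auto
  qed
  have hom_term: "homogeneous (wt deg a + e k) (mon_val \<theta> a * \<beta> k v)" if "k < \<mu>" "keys a \<subseteq> {..<d}" "v \<in> carrier_vec r"
    for k a and v :: "complex vec"
    using that by (intro homogeneous_mult homogeneous_mon_val[of _ d] \<beta>(2) \<theta>(3)) auto
  have b_hom: "homogeneous m (b x v)" if "x \<in> K" "v \<in> carrier_vec r" for x and v :: "complex vec"
    using that hom_term by (auto simp: K_def b_def)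
  have b_cov: "b x \<in> ?Cov" if x: "x \<in> K" for x
  proof -
    obtain k a where ka: "x = (k,a)" "k < \<mu>" "keys a \<subseteq> {..<d}" using x by (auto simp: K_def)
    have inv: "sym_act (R g) (mon_val \<theta> a) = mon_val \<theta> a" if g: "g \<in> carrier G" for g
    proof -
      have "sym_act (R g) (mon_val \<theta> a) = mon_val (\<lambda>k. sym_act (R g) (\<theta> k)) a"
        unfolding sym_act_eq mon_val_def by (simp add: mpol_subst_prod mpol_subst_power)
      also have "\<dots> = mon_val \<theta> a" by (rule mon_val_cong[OF ka(3)]) (use \<theta>(2) g in auto)
      finally show ?thesis .
    qed
    have mv: "mon_val \<theta> a \<in> sym_alg d" by (rule sym_alg_mon_val[OF ka(3) \<theta>(1)])
    note c = covariantsD[OF \<beta>(1)[OF ka(2)]]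
    show ?thesis unfolding covariants_def ka(1) b_def
      using c mv inv by (auto simp: sym_alg_mult sym_act_linear(4) distrib_left mult.left_commute)
  qed
  have b_indep: "z x = 0" if z: "\<And>v. v \<in> carrier_vec r \<Longrightarrow> (\<Sum>x\<in>K. mpol_const (z x) * b x v) = 0" and x: "x \<in> K" for z x
  proof -
    define A where "A k = {a. (k,a) \<in> K}" for k
    have finA: "finite (A k)" for k
      by (rule finite_subset[of _ "snd ` K"]) (use finK in \<open>force simp: A_def\<close>)+
    have KS: "K = Sigma {..<\<mu>} A" by (auto simp: K_def A_def)
    \<comment> \<open>a relation over \<open>\<complex>\<close> between the \<open>\<theta>\<^sup>a \<beta>\<^sub>k\<close> is a relation between the \<open>\<beta>\<^sub>k\<close> with polynomials in \<open>\<theta>\<close> as coefficients\<close>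
    define p where "p k = (\<Sum>a\<in>A k. mpol_const (z (k,a)) * monomial a)" for k
    have p: "p k \<in> sym_alg d" for k unfolding p_def
      by (intro sym_alg_sum sym_alg_const_mult) (auto simp: sym_alg_mon A_def K_def)
    define c where "c k = mpol_subst \<theta> (p k)" for k
    have c: "c k = (\<Sum>a\<in>A k. mpol_const (z (k,a)) * mon_val \<theta> a)" for k
      by (simp add: c_def p_def mpol_subst_sum mpol_subst_const_mult)
    obtain k a where ka: "x = (k,a)" "k < \<mu>" "a \<in> A k" using x KS by auto
    have "c k = 0"
    proof (rule free[of c, OF _ _ ka(2)])
      show "c k \<in> subalg d \<theta>" for k using p by (auto simp: c_def subalg_def)
      fix v :: "complex vec" assume v: "v \<in> carrier_vec r"
      have "(\<Sum>k<\<mu>. c k * \<beta> k v) = (\<Sum>k<\<mu>. \<Sum>a\<in>A k. mpol_const (z (k,a)) * b (k,a) v)"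
        by (simp add: c sum_distrib_right b_def mult.assoc)
      also have "\<dots> = (\<Sum>x\<in>K. mpol_const (z x) * b x v)"
        unfolding KS by (subst sum.Sigma) (auto simp: finA)
      finally show "(\<Sum>k<\<mu>. c k * \<beta> k v) = 0" using z[OF v] by simp
    qed
    then have "p k = 0" using indep p by (simp add: c_def)
    then have "lookup (p k) a = 0" by simp
    moreover have "lookup (p k) a = z (k,a)"
      using finA ka(3) by (simp add: p_def lookup_sum lookup_const_mult lookup_mon if_distrib cong: if_cong)
    ultimately show ?thesis using ka(1) by simp
  qed
  have b_span: "\<exists>C. \<forall>v\<in>carrier_vec r. \<phi> v = (\<Sum>x\<in>K. mpol_const (C x) * b x v)"
    if \<phi>: "\<phi> \<in> ?Cov" and hom: "\<And>v. v \<in> carrier_vec r \<Longrightarrow> homogeneous m (\<phi> v)" for \<phi>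
  proof -
    obtain c where c: "\<And>k. k < \<mu> \<Longrightarrow> c k \<in> subalg d \<theta>" and \<phi>c: "\<And>v. v \<in> carrier_vec r \<Longrightarrow> \<phi> v = (\<Sum>k<\<mu>. c k * \<beta> k v)"
      using gen[OF \<phi>] by auto
    have "\<forall>k. \<exists>p. k < \<mu> \<longrightarrow> p \<in> sym_alg d \<and> c k = mpol_subst \<theta> p" using c by (auto simp: subalg_def)
    then obtain p where p: "\<And>k. k < \<mu> \<Longrightarrow> p k \<in> sym_alg d" "\<And>k. k < \<mu> \<Longrightarrow> c k = mpol_subst \<theta> (p k)" by metis
    \<comment> \<open>expand the coefficients into monomials in \<open>\<theta>\<close> and keep the terms of degree \<open>m\<close>\<close>
    define F where "F = Sigma {..<\<mu>} (\<lambda>k. keys (p k))"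
    define C where "C = (\<lambda>(k,a). lookup (p k) a)"
    have finF: "finite F" by (simp add: F_def)
    have "\<phi> v = (\<Sum>x\<in>K. mpol_const (C x) * b x v)" if v: "v \<in> carrier_vec r" for v
    proof -
      have "\<phi> v = (\<Sum>k<\<mu>. \<Sum>a\<in>keys (p k). mpol_const (C (k,a)) * b (k,a) v)"
        unfolding \<phi>c[OF v] using p(2)
        by (intro sum.cong refl) (simp add: mpol_subst_superset[OF finite_keys subset_refl] sum_distrib_right b_def C_def mult.assoc)
      also have "\<dots> = (\<Sum>x\<in>F. mpol_const (C x) * b x v)" unfolding F_def by (subst sum.Sigma) auto
      finally have eq: "\<phi> v = (\<Sum>x\<in>F. mpol_const (C x) * b x v)" .
      also have "\<dots> = (\<Sum>x | x \<in> F \<and> (case x of (k,a) \<Rightarrow> wt deg a + e k) = m. mpol_const (C x) * b x v)"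
      proof (rule homogeneous_component[OF finF])
        show "homogeneous m (\<Sum>x\<in>F. mpol_const (C x) * b x v)" using hom[OF v] eq by simp
        fix x assume "x \<in> F"
        then obtain k a where "x = (k,a)" "k < \<mu>" "a \<in> keys (p k)" by (auto simp: F_def)
        then show "homogeneous (case x of (k,a) \<Rightarrow> wt deg a + e k) (mpol_const (C x) * b x v)"
          using p(1)[of k] v by (auto simp: b_def sym_alg_def intro!: homogeneous_const_mult hom_term)
      qed
      also have "\<dots> = (\<Sum>x\<in>K. mpol_const (C x) * b x v)"
      proof (rule sum.mono_neutral_left[OF finK])
        show "{x \<in> F. (case x of (k,a) \<Rightarrow> wt deg a + e k) = m} \<subseteq> K"
          using p(1) by (force simp: F_def K_def sym_alg_def)
        show "\<forall>x\<in>K - {x \<in> F. (case x of (k,a) \<Rightarrow> wt deg a + e k) = m}. mpol_const (C x) * b x v = 0"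
          by (auto simp: F_def K_def C_def in_keys_iff mpol_const_hom)
      qed
      finally show ?thesis .
    qed
    then show ?thesis by blast
  qed
  have "\<forall>x. \<exists>C. x \<in> ?X \<longrightarrow> (\<forall>v\<in>carrier_vec r. avg_cov R \<sigma> (fst x) (snd x) v = (\<Sum>y\<in>K. mpol_const (C y) * b y v))"
  proof
    fix x
    show "\<exists>C. x \<in> ?X \<longrightarrow> (\<forall>v\<in>carrier_vec r. avg_cov R \<sigma> (fst x) (snd x) v = (\<Sum>y\<in>K. mpol_const (C y) * b y v))"
    proof (cases "x \<in> ?X")
      case True
      then have "fst x < r" "snd x \<in> mons d m" by auto
      from b_span[OF avg_cov_covariant[OF R \<sigma> this]] show ?thesis by blast
    qed simp
  qed
  from choice[OF this] obtain C where
    C': "\<forall>x. x \<in> ?X \<longrightarrow> (\<forall>v\<in>carrier_vec r. avg_cov R \<sigma> (fst x) (snd x) v = (\<Sum>y\<in>K. mpol_const (C x y) * b y v))" ..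
  have C: "\<And>x v. x \<in> ?X \<Longrightarrow> v \<in> carrier_vec r \<Longrightarrow> avg_cov R \<sigma> (fst x) (snd x) v = (\<Sum>y\<in>K. mpol_const (C x y) * b y v)"
    using C' by blast
  define L where "L y x = lookup (b y (unit_vec r (fst x))) (snd x)" for y x
  have one: "(\<Sum>x\<in>?X. L y x * C x y) = 1" if y: "y \<in> K" for y
  proof -
    define z where "z y' = (\<Sum>x\<in>?X. L y x * C x y') - (if y' = y then 1 else 0)" for y'
    have "z y = 0"
    proof (rule b_indep[OF _ y])
      fix v :: "complex vec" assume v: "v \<in> carrier_vec r"
      have "b y v = (\<Sum>x\<in>?X. mpol_const (L y x) * avg_cov R \<sigma> (fst x) (snd x) v)"
        using covariant_average[OF R \<sigma> b_cov[OF y] b_hom[OF y] v] by (simp add: L_def case_prod_unfold)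
      also have "\<dots> = (\<Sum>x\<in>?X. \<Sum>y'\<in>K. mpol_const (L y x * C x y') * b y' v)"
        by (intro sum.cong refl) (simp add: C[OF _ v] sum_distrib_left mpol_const_hom mult.assoc)
      also have "\<dots> = (\<Sum>y'\<in>K. mpol_const (\<Sum>x\<in>?X. L y x * C x y') * b y' v)"
        by (subst sum.swap) (simp add: mpol_const_sum sum_distrib_right)
      finally have *: "b y v = (\<Sum>y'\<in>K. mpol_const (\<Sum>x\<in>?X. L y x * C x y') * b y' v)" .
      have "(\<Sum>y'\<in>K. mpol_const (if y' = y then 1 else 0) * b y' v) = (\<Sum>y'\<in>K. if y' = y then b y v else 0)"
        by (intro sum.cong) (auto simp: mpol_const_hom)
      then have **: "(\<Sum>y'\<in>K. mpol_const (if y' = y then 1 else 0) * b y' v) = b y v" using finK y by simp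
      have "mpol_const (z y') = mpol_const (\<Sum>x\<in>?X. L y x * C x y') - mpol_const (if y' = y then 1 else 0)" for y'
        using mpol_const_hom(1)[of "z y'" "if y' = y then 1 else 0"] by (simp add: z_def)
      then show "(\<Sum>y'\<in>K. mpol_const (z y') * b y' v) = 0"
        using * ** by (simp add: left_diff_distrib sum_subtractf)
    qed
    then show ?thesis by (simp add: z_def)
  qed
  have "of_nat (card K) = (\<Sum>y\<in>K. \<Sum>x\<in>?X. L y x * C x y)" using one by simp
  also have "\<dots> = (\<Sum>x\<in>?X. \<Sum>y\<in>K. C x y * L y x)" by (subst sum.swap) (simp add: mult.commute)
  also have "\<dots> = (\<Sum>x\<in>?X. lookup (avg_cov R \<sigma> (fst x) (snd x) (unit_vec r (fst x))) (snd x))"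
    by (intro sum.cong refl) (simp add: C lookup_sum lookup_const_mult L_def)
  also have "\<dots> = (\<Sum>g\<in>carrier G. rep_char \<sigma> (inv g) * sym_trace d (R g) m) / of_nat (Coset.order G)"
    using avg_cov_trace[OF \<sigma>] by (simp add: case_prod_unfold)
  finally show ?thesis unfolding K_def .
qed

text \<open>Molien's formula for covariants: the sum over all degrees of \<open>covariant_count\<close>.\<close>

lemma covariant_hilbert_series:
  assumes R: "is_rep G d R" and \<sigma>: "is_rep G r \<sigma>"
    and hsop: "invariant_hsop G d R \<theta> deg"
    and basis: "homogeneous_covariant_basis G d R \<theta> r \<sigma> \<mu> \<beta> e"
  shows "(\<Sum>k<\<mu>. fps_X ^ e k) = (\<Prod>l<d. 1 - fps_X ^ deg l) *
    (\<Sum>g\<in>carrier G. fps_const (cnj (rep_char \<sigma> g) / of_nat (Coset.order G)) * Abs_fps (sym_trace d (R g)))"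
proof -
  have deg: "\<And>k. k < d \<Longrightarrow> deg k > 0" using hsop by (auto simp: invariant_hsop_def)
  define E :: "complex fps" where "E = Abs_fps (\<lambda>m. of_nat (card (exponents d deg m)))"
  have E: "E * (\<Prod>l<d. 1 - fps_X ^ deg l) = 1"
    using exponents_generating_function[of d deg "\<lambda>_. 1"] deg by (simp add: E_def)
  have "(\<Sum>k<\<mu>. fps_X ^ e k) * E =
     (\<Sum>g\<in>carrier G. fps_const (cnj (rep_char \<sigma> g) / of_nat (Coset.order G)) * Abs_fps (sym_trace d (R g)))"
  proof (rule fps_ext)
    fix m
    let ?K = "{(k,a). k < \<mu> \<and> keys a \<subseteq> {..<d} \<and> wt deg a + e k = m}"
    have K: "?K = Sigma {..<\<mu>} (\<lambda>k. if m < e k then {} else exponents d deg (m - e k))"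
      by (auto simp: exponents_def split: if_splits)
    have "fps_nth ((\<Sum>k<\<mu>. fps_X ^ e k) * E) m = (\<Sum>k<\<mu>. if m < e k then 0 else of_nat (card (exponents d deg (m - e k))))"
      by (auto simp: sum_distrib_right fps_sum_nth fps_X_power_mult_nth E_def intro!: sum.cong)
    also have "\<dots> = of_nat (card ?K)"
      unfolding K using finite_exponents[OF deg]
      by (subst card_SigmaI) (auto intro!: sum.cong)
    also have "\<dots> = (\<Sum>g\<in>carrier G. rep_char \<sigma> (inv g) * sym_trace d (R g) m) / of_nat (Coset.order G)"
      by (rule covariant_count[OF assms])
    also have "\<dots> = fps_nth (\<Sum>g\<in>carrier G. fps_const (cnj (rep_char \<sigma> g) / of_nat (Coset.order G)) * Abs_fps (sym_trace d (R g))) m"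
      by (simp add: fps_sum_nth rep_char_inv[OF \<sigma>] sum_divide_distrib)
    finally show "fps_nth ((\<Sum>k<\<mu>. fps_X ^ e k) * E) m = \<dots>" .
  qed
  then have "(\<Sum>k<\<mu>. fps_X ^ e k) * (E * (\<Prod>l<d. 1 - fps_X ^ deg l)) =
    (\<Sum>g\<in>carrier G. fps_const (cnj (rep_char \<sigma> g) / of_nat (Coset.order G)) * Abs_fps (sym_trace d (R g))) * (\<Prod>l<d. 1 - fps_X ^ deg l)"
    by (simp add: mult.assoc[symmetric])
  then show ?thesis unfolding E by (simp add: mult.commute)
qed

end


section \<open>Polynomials near q = 1\<close>

lemma higher_pderiv_at_zero_of_order:
  fixes C :: "complex poly"
  shows "poly ((pderiv ^^ n) ([:1, -1:] ^ n * C)) 1 = (-1) ^ n * fact n * poly C 1"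
proof (induction n arbitrary: C)
  case (Suc n)
  define L where "L = ([:1, -1:] :: complex poly)"
  let ?k = "of_nat (Suc n) :: complex"
  have dL: "pderiv L = -1" by (simp add: L_def pderiv_pCons one_pCons)
  have "pderiv (L ^ Suc n * C) = L ^ Suc n * pderiv C + C * (smult ?k (L ^ n) * pderiv L)"
    unfolding pderiv_mult pderiv_power_Suc ..
  also have "\<dots> = L ^ n * (L * pderiv C - smult ?k C)"
    unfolding dL by (simp add: algebra_simps)
  finally have "poly ((pderiv ^^ Suc n) (L ^ Suc n * C)) 1 = poly ((pderiv ^^ n) (L ^ n * (L * pderiv C - smult ?k C))) 1"
    by (simp only: funpow_Suc_right o_apply)
  also have "\<dots> = (-1) ^ n * fact n * poly (L * pderiv C - smult ?k C) 1"
    using Suc.IH by (simp only: L_def)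
  also have "\<dots> = (-1) ^ Suc n * fact (Suc n) * poly C 1"
    by (simp add: L_def algebra_simps)
  finally show ?case by (simp only: L_def)
qed simp

lemma fps_of_poly_one_minus: "fps_of_poly [:1, - c:] = 1 - fps_const c * fps_X" for c :: complex
  by (simp add: fps_of_poly_pCons fps_const_neg[symmetric] del: fps_const_neg)

text \<open>The polynomial \<open>D(R)\<close> of the Molien series, that is \<open>\<Prod>\<^sub>l (1 - q^(n l)) / (1 - q)^d\<close>.\<close>

definition parameter_cofactor :: "nat \<Rightarrow> (nat \<Rightarrow> nat) \<Rightarrow> complex poly" where
  "parameter_cofactor d n = (\<Prod>l<d. \<Sum>i<n l. [:0, 1:] ^ i)"

lemma parameter_cofactor:
  "(\<Prod>l<d. 1 - fps_X ^ n l) = fps_of_poly ([:1, -1:] ^ d * parameter_cofactor d n)"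
  "poly (parameter_cofactor d n) 1 = (\<Prod>l<d. of_nat (n l))"
proof -
  have L: "fps_of_poly [:1, -1 :: complex:] = 1 - fps_X"
    using fps_of_poly_one_minus[of 1] by simp
  have "(1 - fps_X ^ n l :: complex fps) = (1 - fps_X) * (\<Sum>i<n l. fps_X ^ i)" for l
    by (rule one_diff_power_eq)
  then show "(\<Prod>l<d. 1 - fps_X ^ n l) = fps_of_poly ([:1, -1:] ^ d * parameter_cofactor d n)"
    by (simp add: parameter_cofactor_def fps_of_poly_mult fps_of_poly_power fps_of_poly_prod fps_of_poly_sum L
        prod.distrib)
  show "poly (parameter_cofactor d n) 1 = (\<Prod>l<d. of_nat (n l))"
    by (simp add: parameter_cofactor_def poly_prod poly_sum)
qed

lemma common_denominator:
  fixes p :: "'g \<Rightarrow> complex poly" and T :: "'g \<Rightarrow> complex fps"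
  assumes fin: "finite S" and T: "\<And>g. g \<in> S \<Longrightarrow> T g * fps_of_poly (p g) = 1"
  shows "(\<Sum>g\<in>S. fps_const (w g) * T g) * fps_of_poly (\<Prod>g\<in>S. p g) =
    fps_of_poly (\<Sum>g\<in>S. smult (w g) (\<Prod>h\<in>S - {g}. p h))"
proof -
  have "T g * fps_of_poly (\<Prod>g\<in>S. p g) = fps_of_poly (\<Prod>h\<in>S - {g}. p h)" if g: "g \<in> S" for g
    using T[OF g] by (simp add: prod.remove[OF fin g] fps_of_poly_mult mult.assoc[symmetric])
  then show ?thesis
    by (simp add: sum_distrib_right fps_of_poly_sum fps_of_poly_smult mult.assoc)
qed

text \<open>The denominators \<open>p g\<close> can be cleared without affecting the order of vanishing at \<open>1\<close>. The zero of
  order \<open>d\<close> then comes from the factors \<open>1 - q^(n l)\<close>, each of which contributes a factor \<open>n l\<close> to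
  the coefficient.\<close>

lemma leading_coefficient_at_one:
  fixes p :: "'g \<Rightarrow> complex poly" and T :: "'g \<Rightarrow> complex fps"
  assumes fin: "finite S" and T: "\<And>g. g \<in> S \<Longrightarrow> T g * fps_of_poly (p g) = 1"
    and nz: "\<And>g. g \<in> S \<Longrightarrow> poly (p g) 1 \<noteq> 0"
    and D: "fps_of_poly D = (\<Prod>l<d. 1 - fps_X ^ n l) * (\<Sum>g\<in>S. fps_const (w g) * T g)"
  shows "(-1) ^ d / fact d * poly ((pderiv ^^ d) D) 1 = (\<Prod>l<d. of_nat (n l)) * (\<Sum>g\<in>S. w g / poly (p g) 1)"
proof -
  define Q where "Q = (\<Prod>g\<in>S. p g)"
  define E where "E = (\<Sum>g\<in>S. smult (w g) (\<Prod>h\<in>S - {g}. p h))"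
  let ?L = "[:1, -1:] :: complex poly" and ?U = "parameter_cofactor d n"
  have Q1: "poly Q 1 \<noteq> 0" using nz fin by (simp add: Q_def poly_prod)
  have QE: "(\<Sum>g\<in>S. fps_const (w g) * T g) * fps_of_poly Q = fps_of_poly E"
    unfolding Q_def E_def by (rule common_denominator[OF fin T])
  have "fps_of_poly (D * Q) = fps_of_poly (?L ^ d * ?U) * ((\<Sum>g\<in>S. fps_const (w g) * T g) * fps_of_poly Q)"
    unfolding fps_of_poly_mult[of D] D parameter_cofactor(1) by (rule mult.assoc)
  then have "fps_of_poly (D * Q) = fps_of_poly (?L ^ d * (?U * E))"
    unfolding QE by (simp only: fps_of_poly_mult mult.assoc)
  then have DQ: "D * Q = ?L ^ d * (?U * E)" by (simp only: fps_of_poly_eq_iff)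
  have L_dvd: "?L ^ d dvd q \<longleftrightarrow> [:-1, 1:] ^ d dvd q" for q
  proof -
    have "?L = smult (-1) [:-1, 1:]" by simp
    then have "?L ^ d = smult ((-1) ^ d) ([:-1, 1:] ^ d)" by (simp only: smult_power)
    then show ?thesis by (simp add: smult_dvd_iff)
  qed
  have "?L ^ d dvd D"
  proof (cases "D = 0")
    case False
    then have nz': "D * Q \<noteq> 0" using Q1 by auto
    have "?L ^ d dvd D * Q" unfolding DQ by simp
    then have "d \<le> order 1 (D * Q)" using nz' unfolding L_dvd by (simp add: order_divides)
    also have "\<dots> = order 1 D" using order_mult[OF nz'] Q1 order_root[of Q 1] by simp
    finally show ?thesis unfolding L_dvd by (simp add: order_divides)
  qed simp
  then obtain C where C: "D = ?L ^ d * C" by (auto elim: dvdE)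
  have "?L ^ d * (C * Q) = ?L ^ d * (?U * E)" using DQ by (simp add: C mult.assoc)
  then have CQ: "C * Q = ?U * E" by simp
  have E1: "poly E 1 = poly Q 1 * (\<Sum>g\<in>S. w g / poly (p g) 1)"
  proof -
    have "w g * (\<Prod>h\<in>S - {g}. poly (p h) 1) = poly Q 1 * (w g / poly (p g) 1)" if g: "g \<in> S" for g
      using nz[OF g] by (simp add: Q_def poly_prod prod.remove[OF fin g])
    then show ?thesis by (simp add: E_def poly_sum poly_prod sum_distrib_left)
  qed
  have "poly C 1 * poly Q 1 = poly ?U 1 * poly E 1"
    using arg_cong[OF CQ, of "\<lambda>x. poly x 1"] by simp
  then have "poly C 1 = poly ?U 1 * (\<Sum>g\<in>S. w g / poly (p g) 1)"
    using Q1 by (simp add: E1)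
  moreover have "(-1) ^ d / fact d * poly ((pderiv ^^ d) D) 1 = poly C 1"
    unfolding C higher_pderiv_at_zero_of_order by (simp add: power_mult_distrib[symmetric])
  ultimately show ?thesis by (simp add: parameter_cofactor(2))
qed

text \<open>The pole of \<open>T0\<close> at \<open>1\<close> has order \<open>d\<close> and cancels the zero of the product of the \<open>1 - q^(n l)\<close>, whereas
  the summands over \<open>S\<close> have no pole and are annihilated by this zero.\<close>

lemma value_at_one:
  fixes p :: "'g \<Rightarrow> complex poly" and T :: "'g \<Rightarrow> complex fps"
  assumes fin: "finite S" and T: "\<And>g. g \<in> S \<Longrightarrow> T g * fps_of_poly (p g) = 1"
    and nz: "\<And>g. g \<in> S \<Longrightarrow> poly (p g) 1 \<noteq> 0"
    and T0: "T0 * fps_of_poly ([:1, -1:] ^ d) = 1" and d: "d = 0 \<Longrightarrow> S = {}"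
    and D: "fps_of_poly D = (\<Prod>l<d. 1 - fps_X ^ n l) * (fps_const c * T0 + (\<Sum>g\<in>S. fps_const (w g) * T g))"
  shows "poly D 1 = c * (\<Prod>l<d. of_nat (n l))"
proof -
  define Q where "Q = (\<Prod>g\<in>S. p g)"
  define E where "E = (\<Sum>g\<in>S. smult (w g) (\<Prod>h\<in>S - {g}. p h))"
  let ?L = "[:1, -1:] :: complex poly" and ?U = "parameter_cofactor d n"
  have Q1: "poly Q 1 \<noteq> 0" using nz fin by (simp add: Q_def poly_prod)
  have QE: "(\<Sum>g\<in>S. fps_const (w g) * T g) * fps_of_poly Q = fps_of_poly E"
    unfolding Q_def E_def by (rule common_denominator[OF fin T])
  have "fps_of_poly (D * Q) = fps_const c * (T0 * fps_of_poly (?L ^ d)) * fps_of_poly (?U * Q) +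
      fps_of_poly (?L ^ d * ?U) * ((\<Sum>g\<in>S. fps_const (w g) * T g) * fps_of_poly Q)"
    unfolding fps_of_poly_mult[of D] D parameter_cofactor(1) by (simp add: fps_of_poly_mult algebra_simps)
  also have "\<dots> = fps_of_poly (smult c (?U * Q) + ?L ^ d * ?U * E)"
    unfolding T0 QE
    by (simp add: fps_of_poly_mult fps_of_poly_add fps_of_poly_smult)
  finally have "D * Q = smult c (?U * Q) + ?L ^ d * ?U * E" by (simp only: fps_of_poly_eq_iff)
  from arg_cong[OF this, of "\<lambda>x. poly x 1"]
  have "poly D 1 * poly Q 1 = c * (poly ?U 1 * poly Q 1) + 0 ^ d * poly ?U 1 * poly E 1" by simp
  also have "0 ^ d * poly ?U 1 * poly E 1 = 0" using d by (cases "d = 0") (auto simp: E_def)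
  finally have "poly D 1 * poly Q 1 = c * poly ?U 1 * poly Q 1" by (simp only: add_0_right mult.assoc)
  then show ?thesis using Q1 by (simp add: parameter_cofactor(2))
qed

lemma det_diag_of: "det (diag_of d ev) = (\<Prod>l<d. ev l)"
proof -
  have "upper_triangular (diag_of d ev)" by (auto simp: upper_triangular_def diag_of_def)
  then have "det (diag_of d ev) = prod_list (diag_mat (diag_of d ev))"
    using det_upper_triangular diag_of_carrier by blast
  then show ?thesis by (simp add: prod_list_diag_prod atLeast0LessThan) (simp add: diag_of_def)
qed

section \<open>The Euclidean Cartan matrix and its inverse\<close>

context finite_group
begin

lemma rep_char_one:
  assumes "is_rep G r \<sigma>" shows "rep_char \<sigma> \<one> = of_nat r"
  using assms by (simp add: rep_char_eq is_repD(2))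

lemma sym_trace_series:
  assumes R: "is_rep G d R" and g: "g \<in> carrier G"
  shows "\<exists>p. Abs_fps (sym_trace d (R g)) * fps_of_poly p = 1 \<and> poly p 1 = det (1\<^sub>m d - R g)"
proof -
  obtain P Q ev where P: "P \<in> carrier_mat d d" and Q: "Q \<in> carrier_mat d d" and PQ: "P * Q = 1\<^sub>m d" and QP: "Q * P = 1\<^sub>m d"
    and Rg: "R g = P * diag_of d ev * Q"
    using rep_diagonalizable[OF assms] by blast
  let ?p = "\<Prod>l<d. [:1, - ev l:]"
  have "fps_of_poly ?p = (\<Prod>l<d. 1 - fps_const (ev l) * fps_X)"
    by (simp add: fps_of_poly_prod fps_of_poly_one_minus)
  then have "Abs_fps (sym_trace d (R g)) * fps_of_poly ?p = 1"
    using sym_trace_generating_function[OF P Q QP] Rg by simp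
  moreover have "1\<^sub>m d - diag_of d ev = diag_of d (\<lambda>l. 1 - ev l)"
    by (rule eq_matI) (auto simp: diag_of_def)
  then have "det (1\<^sub>m d - R g) = poly ?p 1"
    using det_one_minus_similar[OF P Q PQ diag_of_carrier] det_diag_of Rg by (simp add: poly_prod)
  ultimately show ?thesis by metis
qed

lemma sym_trace_series_one:
  assumes R: "is_rep G d R"
  shows "Abs_fps (sym_trace d (R \<one>)) * fps_of_poly ([:1, -1:] ^ d) = 1"
proof -
  have "1\<^sub>m d = 1\<^sub>m d * diag_of d (\<lambda>_. 1) * 1\<^sub>m d" by (rule eq_matI) (auto simp: diag_of_def)
  then have series: "Abs_fps (sym_trace d (1\<^sub>m d)) * (\<Prod>l<d. 1 - fps_const 1 * fps_X) = 1"
    using sym_trace_generating_function[of "1\<^sub>m d" d "1\<^sub>m d" "\<lambda>_. 1"] by simp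
  have "fps_of_poly ([:1, -1:] ^ d) = (\<Prod>l<d. 1 - fps_const 1 * fps_X :: complex fps)"
    using fps_of_poly_one_minus[of 1] by (simp add: fps_of_poly_power)
  then show ?thesis unfolding is_repD(2)[OF R] using series by (simp only:)
qed

lemma det_one_minus_nonzero:
  assumes R: "is_rep G d R" and faithful: "faithful_rep G R" and free: "image_acts_freely G d R"
    and g: "g \<in> carrier G" "g \<noteq> \<one>"
  shows "det (1\<^sub>m d - R g) \<noteq> 0"
proof
  assume "det (1\<^sub>m d - R g) = 0"
  have Rc: "R g \<in> carrier_mat d d" by (rule is_repD(1)[OF R g(1)])
  have M: "1\<^sub>m d - R g \<in> carrier_mat d d" by (rule minus_carrier_mat[OF Rc])
  obtain v where v: "v \<in> carrier_vec d" "v \<noteq> 0\<^sub>v d" "(1\<^sub>m d - R g) *\<^sub>v v = 0\<^sub>v d"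
    using \<open>det (1\<^sub>m d - R g) = 0\<close> det_0_iff_vec_prod_zero[OF M] by auto
  have "v - R g *\<^sub>v v = 0\<^sub>v d"
    using v minus_mult_distrib_mat_vec[OF one_carrier_mat Rc v(1)] by simp
  then have "R g *\<^sub>v v = v"
    using vec_diff_zero_imp_eq[OF v(1) mult_mat_vec_carrier[OF Rc v(1)]] by simp
  then have "R g = 1\<^sub>m d"
    using free imageI[OF g(1), of R] v(1,2) unfolding image_acts_freely_def by blast
  then have "R g = R \<one>" by (simp add: is_repD(2)[OF R])
  then show False using faithful g by (auto simp: faithful_rep_def inj_on_def)
qed

lemma D_row0_series:
  assumes R: "is_rep G d R" and \<sigma>: "is_rep G r (irr j)"
    and hsop: "invariant_hsop G d R \<theta> deg"
    and basis: "homogeneous_covariant_basis G d R \<theta> r (irr j) (\<mu> j) (\<beta> j) (e j)"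
  shows "fps_of_poly (D_row0 \<mu> e j) = (\<Prod>l<d. 1 - fps_X ^ deg l) *
    (\<Sum>g\<in>carrier G. fps_const (cnj (rep_char (irr j) g) / of_nat (Coset.order G)) * Abs_fps (sym_trace d (R g)))"
  using covariant_hilbert_series[OF assms]
  by (simp add: D_row0_def fps_of_poly_sum fps_of_poly_monom)

lemma tensor_inner:
  assumes "\<And>g. g \<in> carrier G \<Longrightarrow> \<rho> g \<in> carrier_mat a a" "\<And>g. g \<in> carrier G \<Longrightarrow> \<sigma> g \<in> carrier_mat b b"
  shows "rep_inner G (tensor_rep \<rho> \<sigma>) \<tau> =
    (\<Sum>g\<in>carrier G. rep_char \<rho> g * rep_char \<sigma> g * cnj (rep_char \<tau> g)) / of_nat (Coset.order G)"
  unfolding rep_inner_def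
  by (intro arg_cong2[where f="(/)"] sum.cong refl) (simp add: tensor_char[of \<rho> _ a \<sigma> b] assms)

text \<open>The coefficients of the sum over \<open>k\<close> are, up to conjugation, those of the class function
  \<open>cnj (\<chi>\<^sub>i) \<chi>\<^sub>j\<close> with respect to the irreducible characters.\<close>

lemma D_poly_series:
  assumes sys: "irreducible_system G n dm irr" and i: "i \<le> n" and j: "j \<le> n"
    and row0: "\<And>k. k \<le> n \<Longrightarrow> fps_of_poly (D_row0 \<mu> e k) =
      P * (\<Sum>g\<in>carrier G. fps_const (cnj (rep_char (irr k) g) / of_nat (Coset.order G)) * T g)"
  shows "fps_of_poly (D_poly G n irr \<mu> e i j) =
      P * (\<Sum>g\<in>carrier G. fps_const (rep_char (irr i) g * cnj (rep_char (irr j) g) / of_nat (Coset.order G)) * T g)"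
proof -
  note irr = irreducible_systemD[OF sys]
  let ?N = "of_nat (Coset.order G) :: complex"
  define c where "c k = rep_inner G (tensor_rep (irr i) (irr k)) (irr j)" for k
  have c: "c k = (\<Sum>h\<in>carrier G. rep_char (irr i) h * rep_char (irr k) h * cnj (rep_char (irr j) h)) / ?N" if "k \<le> n" for k
    unfolding c_def by (rule tensor_inner[OF is_repD(1)[OF irr(2)[OF i]] is_repD(1)[OF irr(2)[OF that]]])
  have expand: "(\<Sum>k\<le>n. c k * cnj (rep_char (irr k) g)) = rep_char (irr i) g * cnj (rep_char (irr j) g)" if g: "g \<in> carrier G" for g
  proof -
    have "class_fun (\<lambda>h. cnj (rep_char (irr i) h) * rep_char (irr j) h)"
      using class_fun_char[OF irr(2)[OF i]] class_fun_char[OF irr(2)[OF j]] by (intro class_fun_intros)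
    from class_fun_expansion[OF sys this g]
    have "rep_char (irr i) g * cnj (rep_char (irr j) g) =
       cnj (\<Sum>k\<le>n. (\<Sum>h\<in>carrier G. cnj (rep_char (irr i) h) * rep_char (irr j) h * cnj (rep_char (irr k) h)) / ?N * rep_char (irr k) g)"
      by (metis complex_cnj_cnj complex_cnj_mult)
    also have "\<dots> = (\<Sum>k\<le>n. c k * cnj (rep_char (irr k) g))"
      by (simp add: c mult_ac)
    finally show ?thesis by simp
  qed
  have "fps_of_poly (D_poly G n irr \<mu> e i j) = (\<Sum>k\<le>n. fps_const (c k) * fps_of_poly (D_row0 \<mu> e k))"
    by (simp add: D_poly_def c_def fps_of_poly_sum fps_of_poly_smult)
  also have "\<dots> = (\<Sum>k\<le>n. P * (\<Sum>g\<in>carrier G. fps_const (c k * cnj (rep_char (irr k) g) / ?N) * T g))"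
    by (intro sum.cong refl) (simp add: row0 sum_distrib_left mult_ac fps_const_mult[symmetric] del: fps_const_mult, simp add: mult.assoc[symmetric])
  also have "\<dots> = P * (\<Sum>g\<in>carrier G. \<Sum>k\<le>n. fps_const (c k * cnj (rep_char (irr k) g) / ?N) * T g)"
    unfolding sum_distrib_left[symmetric] by (subst sum.swap) simp
  also have "(\<Sum>g\<in>carrier G. \<Sum>k\<le>n. fps_const (c k * cnj (rep_char (irr k) g) / ?N) * T g) =
     (\<Sum>g\<in>carrier G. fps_const (rep_char (irr i) g * cnj (rep_char (irr j) g) / ?N) * T g)"
  proof (rule sum.cong[OF refl])
    fix g assume g: "g \<in> carrier G"
    have "(\<Sum>k\<le>n. fps_const (c k * cnj (rep_char (irr k) g) / ?N)) = fps_const (\<Sum>k\<le>n. c k * cnj (rep_char (irr k) g) / ?N)"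
      by (rule fps_ext) (simp add: fps_sum_nth)
    also have "\<dots> = fps_const (rep_char (irr i) g * cnj (rep_char (irr j) g) / ?N)"
      using expand[OF g] by (simp add: sum_divide_distrib[symmetric])
    finally show "(\<Sum>k\<le>n. fps_const (c k * cnj (rep_char (irr k) g) / ?N) * T g) = fps_const (rep_char (irr i) g * cnj (rep_char (irr j) g) / ?N) * T g"
      by (simp add: sum_distrib_right[symmetric])
  qed
  finally show ?thesis .
qed

text \<open>This is the factorization \<open>1 - a - b + a b = (1 - a) (1 - b)\<close> under the sum over the group.\<close>

lemma D_comb_series:
  assumes sys: "irreducible_system G n dm irr" and i: "i \<le> n" and j: "j \<le> n"
    and row0: "\<And>k. k \<le> n \<Longrightarrow> fps_of_poly (D_row0 \<mu> e k) =
      P * (\<Sum>g\<in>carrier G. fps_const (cnj (rep_char (irr k) g) / of_nat (Coset.order G)) * T g)"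
  shows "fps_of_poly (D_comb G n dm irr \<mu> e i j) = P * (\<Sum>g\<in>carrier G.
     fps_const ((1 - rep_char (irr i) g / of_nat (dm i)) * (1 - cnj (rep_char (irr j) g) / of_nat (dm j)) / of_nat (Coset.order G)) * T g)"
proof -
  note irr = irreducible_systemD[OF sys]
  let ?N = "of_nat (Coset.order G) :: complex"
  let ?a = "1 / of_nat (dm i) :: complex" and ?b = "1 / of_nat (dm j) :: complex"
  define F where "F a = (\<Sum>g\<in>carrier G. fps_const (a g / ?N) * T g)" for a
  \<comment> \<open>\<open>F a\<close> is the series attached to a function \<open>a\<close> on the group; it is linear in \<open>a\<close>\<close>
  have F_lin: "F (\<lambda>g. a g - c * b g) = F a - fps_const c * F b" "F (\<lambda>g. a g + c * b g) = F a + fps_const c * F b" for a b c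
  proof -
    have "fps_const ((a g - c * b g) / ?N) * T g = fps_const (a g / ?N) * T g - fps_const c * (fps_const (b g / ?N) * T g)" for g
      by (simp add: mult.assoc[symmetric] left_diff_distrib[symmetric] diff_divide_distrib)
    then show "F (\<lambda>g. a g - c * b g) = F a - fps_const c * F b" by (simp add: F_def sum_distrib_left sum_subtractf)
    have "fps_const ((a g + c * b g) / ?N) * T g = fps_const (a g / ?N) * T g + fps_const c * (fps_const (b g / ?N) * T g)" for g
      by (simp add: mult.assoc[symmetric] distrib_right[symmetric] add_divide_distrib)
    then show "F (\<lambda>g. a g + c * b g) = F a + fps_const c * F b" by (simp add: F_def sum_distrib_left sum.distrib)
  qed
  have r0: "fps_of_poly (D_row0 \<mu> e k) = P * F (\<lambda>g. cnj (rep_char (irr k) g))" if "k \<le> n" for k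
    using row0[OF that] by (simp add: F_def)
  have dp: "fps_of_poly (D_poly G n irr \<mu> e i k) = P * F (\<lambda>g. rep_char (irr i) g * cnj (rep_char (irr k) g))" if "k \<le> n" for k
    using D_poly_series[OF sys i that row0] by (simp add: F_def)
  have F0: "F (\<lambda>g. cnj (rep_char (irr 0) g)) = F (\<lambda>g. 1)" "F (\<lambda>g. rep_char (irr i) g * cnj (rep_char (irr 0) g)) = F (rep_char (irr i))"
    unfolding F_def by (auto simp: irr(4) intro!: sum.cong)
  have "fps_of_poly (D_comb G n dm irr \<mu> e i j) = P * (F (\<lambda>g. 1) - fps_const ?a * F (rep_char (irr i))
     - fps_const ?b * F (\<lambda>g. cnj (rep_char (irr j) g)) + fps_const (?a * ?b) * F (\<lambda>g. rep_char (irr i) g * cnj (rep_char (irr j) g)))"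
    by (simp add: D_comb_def fps_of_poly_add fps_of_poly_diff fps_of_poly_smult r0 dp j F0 algebra_simps)
  also have "\<dots> = P * F (\<lambda>g. 1 - ?a * rep_char (irr i) g - ?b * cnj (rep_char (irr j) g) + (?a * ?b) * (rep_char (irr i) g * cnj (rep_char (irr j) g)))"
    unfolding F_lin ..
  also have "(\<lambda>g. 1 - ?a * rep_char (irr i) g - ?b * cnj (rep_char (irr j) g) + (?a * ?b) * (rep_char (irr i) g * cnj (rep_char (irr j) g))) =
     (\<lambda>g. (1 - rep_char (irr i) g / of_nat (dm i)) * (1 - cnj (rep_char (irr j) g) / of_nat (dm j)))"
    by (rule ext) (simp add: algebra_simps)
  finally show ?thesis by (simp add: F_def)
qed

lemma cartan_entry:
  assumes sys: "irreducible_system G n dm irr" and R: "is_rep G d R" and i: "i < n" and j: "j < n"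
  shows "euclidean_cartan G n irr d R $$ (i, j) =
    (\<Sum>g\<in>carrier G. det (1\<^sub>m d - R g) * rep_char (irr (Suc i)) g * cnj (rep_char (irr (Suc j)) g)) / of_nat (Coset.order G)"
proof -
  note irr = irreducible_systemD[OF sys]
  let ?N = "of_nat (Coset.order G) :: complex"
  let ?x = "\<lambda>m g. rep_char (exterior_rep d R m) g"
  have ext: "exterior_rep d R m g \<in> carrier_mat (length (wedge_basis d m)) (length (wedge_basis d m))" for m g
    by (simp add: exterior_rep_def Let_def)
  have inner: "rep_inner G (tensor_rep (exterior_rep d R m) (irr (Suc i))) (irr (Suc j)) =
      (\<Sum>g\<in>carrier G. ?x m g * rep_char (irr (Suc i)) g * cnj (rep_char (irr (Suc j)) g)) / ?N" for m
    by (rule tensor_inner[OF ext is_repD(1)[OF irr(2)]]) (use i in auto)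
  have "euclidean_cartan G n irr d R $$ (i, j) = poly (cg_exterior G n irr d R $$ (Suc i, Suc j)) 1"
    using i j by (simp add: euclidean_cartan_def mat_delete_def cg_exterior_def)
  also have "\<dots> = (\<Sum>m\<le>d. (-1) ^ m * rep_inner G (tensor_rep (exterior_rep d R m) (irr (Suc i))) (irr (Suc j)))"
    using i j by (simp add: cg_exterior_def cg_matrix_def poly_sum poly_monom)
  also have "\<dots> = (\<Sum>g\<in>carrier G. \<Sum>m\<le>d. (-1) ^ m * ?x m g * (rep_char (irr (Suc i)) g * cnj (rep_char (irr (Suc j)) g))) / ?N"
    unfolding inner by (subst sum.swap) (simp add: sum_divide_distrib sum_distrib_left mult.assoc)
  also have "\<dots> = (\<Sum>g\<in>carrier G. det (1\<^sub>m d - R g) * rep_char (irr (Suc i)) g * cnj (rep_char (irr (Suc j)) g)) / ?N"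
  proof (intro arg_cong2[where f="(/)"] sum.cong[OF refl] refl)
    fix g assume g: "g \<in> carrier G"
    show "(\<Sum>m\<le>d. (-1) ^ m * ?x m g * (rep_char (irr (Suc i)) g * cnj (rep_char (irr (Suc j)) g))) =
        det (1\<^sub>m d - R g) * rep_char (irr (Suc i)) g * cnj (rep_char (irr (Suc j)) g)"
      unfolding sum_distrib_right[symmetric] alternating_exterior_char[of R g d, OF is_repD(1)[OF R g]]
      by (rule mult.assoc[symmetric])
  qed
  finally show ?thesis .
qed

text \<open>The dimensions are subtracted so that the entries with \<open>i = 0\<close> or \<open>j = 0\<close> vanish; the
  element \<open>1\<close>, at which the determinant is zero, is left out.\<close>

definition cartan_inverse :: "nat \<Rightarrow> (nat \<Rightarrow> nat) \<Rightarrow> (nat \<Rightarrow> 'a \<Rightarrow> complex mat) \<Rightarrow> nat \<Rightarrow> ('a \<Rightarrow> complex mat) \<Rightarrow> nat \<Rightarrow> nat \<Rightarrow> complex" where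
  "cartan_inverse n dm irr d R i j = (\<Sum>g\<in>carrier G - {\<one>}.
     (rep_char (irr i) g - of_nat (dm i)) * (cnj (rep_char (irr j) g) - of_nat (dm j)) / det (1\<^sub>m d - R g)) / of_nat (Coset.order G)"

text \<open>Summation over \<open>j\<close> first gives the value at \<open>g\<close>, minus the value at \<open>1\<close>, of the expansion of
  \<open>f \<chi>\<^sub>i\<close> in irreducible characters, where \<open>f(g) = det (1 - R(g))\<close>. As \<open>f(1) = 0\<close>, the factor \<open>f(g)\<close>
  cancels against the denominator, and orthogonality of the characters finishes the computation.\<close>

lemma cartan_times_inverse:
  assumes sys: "irreducible_system G n dm irr" and R: "is_rep G d R"
    and nz: "\<And>g. g \<in> carrier G \<Longrightarrow> g \<noteq> \<one> \<Longrightarrow> det (1\<^sub>m d - R g) \<noteq> 0"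
    and d: "d = 0 \<Longrightarrow> n = 0"
    and i: "i < n" and k: "k < n"
  shows "(\<Sum>j<n. euclidean_cartan G n irr d R $$ (i, j) * cartan_inverse n dm irr d R (Suc j) (Suc k)) = (if i = k then 1 else 0)"
proof -
  note irr = irreducible_systemD[OF sys]
  let ?N = "of_nat (Coset.order G) :: complex"
  let ?f = "\<lambda>g. det (1\<^sub>m d - R g)"
  let ?\<chi> = "\<lambda>i g. rep_char (irr i) g"
  define M where "M j = (\<Sum>g\<in>carrier G. ?f g * ?\<chi> (Suc i) g * cnj (?\<chi> j g)) / ?N" for j
  have one: "?\<chi> j \<one> = of_nat (dm j)" if "j \<le> n" for j using rep_char_one[OF irr(2)[OF that]] .
  have f1: "?f \<one> = 0"
  proof -
    have "1\<^sub>m d - R \<one> = 0\<^sub>m d d" by (rule eq_matI) (auto simp: is_repD(2)[OF R])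
    then show ?thesis using d i by (cases "d = 0") auto
  qed
  have expand: "(\<Sum>j\<le>n. M j * ?\<chi> j g) = ?f g * ?\<chi> (Suc i) g" if "g \<in> carrier G" for g
    using class_fun_expansion[OF sys _ that, of "\<lambda>g. ?f g * ?\<chi> (Suc i) g"] class_fun_det[OF R] class_fun_char[OF irr(2)] i
    by (simp add: M_def class_fun_intros(1))
  \<comment> \<open>the term \<open>j = 0\<close> may be added, since the trivial character minus its dimension is zero\<close>
  have key: "(\<Sum>j<n. M (Suc j) * (?\<chi> (Suc j) g - of_nat (dm (Suc j)))) = ?f g * ?\<chi> (Suc i) g" if g: "g \<in> carrier G" for g
  proof -
    have "(\<Sum>j<n. M (Suc j) * (?\<chi> (Suc j) g - of_nat (dm (Suc j)))) = (\<Sum>j\<le>n. M j * (?\<chi> j g - of_nat (dm j)))"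
      unfolding lessThan_Suc_atMost[symmetric] sum.lessThan_Suc_shift using irr(3) irr(4)[OF g] by simp
    also have "\<dots> = (\<Sum>j\<le>n. M j * ?\<chi> j g) - (\<Sum>j\<le>n. M j * ?\<chi> j \<one>)"
      by (simp add: right_diff_distrib sum_subtractf one)
    also have "\<dots> = ?f g * ?\<chi> (Suc i) g" using expand[OF g] expand[OF one_closed] f1 by simp
    finally show ?thesis .
  qed
  let ?h = "\<lambda>g. (cnj (?\<chi> (Suc k) g) - of_nat (dm (Suc k)))"
  have "(\<Sum>j<n. euclidean_cartan G n irr d R $$ (i, j) * cartan_inverse n dm irr d R (Suc j) (Suc k)) =
     (\<Sum>j<n. \<Sum>g\<in>carrier G - {\<one>}. M (Suc j) * (?\<chi> (Suc j) g - of_nat (dm (Suc j))) * (?h g / ?f g / ?N))"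
    using i by (intro sum.cong refl) (simp add: cartan_entry[OF sys R] M_def cartan_inverse_def sum_divide_distrib sum_distrib_left mult_ac)
  also have "\<dots> = (\<Sum>g\<in>carrier G - {\<one>}. (\<Sum>j<n. M (Suc j) * (?\<chi> (Suc j) g - of_nat (dm (Suc j)))) * (?h g / ?f g / ?N))"
    by (subst sum.swap) (simp only: sum_distrib_right)
  also have "\<dots> = (\<Sum>g\<in>carrier G - {\<one>}. ?\<chi> (Suc i) g * ?h g / ?N)"
    using key nz by (intro sum.cong) auto
  also have "\<dots> = (\<Sum>g\<in>carrier G. ?\<chi> (Suc i) g * ?h g / ?N)"
    using fin k by (intro sum.mono_neutral_left) (auto simp: one)
  also have "\<dots> = ((\<Sum>g\<in>carrier G. ?\<chi> (Suc i) g * cnj (?\<chi> (Suc k) g)) - of_nat (dm (Suc k)) * (\<Sum>g\<in>carrier G. ?\<chi> (Suc i) g * cnj (?\<chi> 0 g))) / ?N"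
    by (simp add: irr(4) sum_divide_distrib[symmetric] sum_distrib_left sum_subtractf[symmetric] algebra_simps)
  also have "\<dots> = (if i = k then 1 else 0)"
    using irr_char_orthonormal[OF sys, of "Suc i" "Suc k"] irr_char_orthonormal[OF sys, of "Suc i" 0] i k order_pos by simp
  finally show ?thesis .
qed

lemma dimension_zero_trivial:
  assumes R: "is_rep G 0 R" and faithful: "faithful_rep G R"
  shows "carrier G = {\<one>}"
proof -
  have "R g = R \<one>" if "g \<in> carrier G" for g
    using is_repD(1)[OF R that] is_repD(1)[OF R one_closed] by (intro eq_matI) auto
  then have "g = \<one>" if "g \<in> carrier G" for g
    using faithful that unfolding faithful_rep_def by (blast dest: inj_onD)
  then show ?thesis by auto
qed

text \<open>On the trivial group two characters are orthogonal only if one of the dimensions is zero.\<close>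

lemma trivial_group_single_irreducible:
  assumes sys: "irreducible_system G n dm irr" and triv: "carrier G = {\<one>}"
  shows "n = 0"
proof (rule ccontr)
  assume n: "n \<noteq> 0"
  have "(\<Sum>g\<in>carrier G. rep_char (irr n) g * cnj (rep_char (irr 0) g)) = of_nat (dm n)"
    using irreducible_systemD(4)[OF sys, of \<one>] rep_char_one[OF irreducible_systemD(2)[OF sys, of n]] by (simp add: triv)
  then have "of_nat (dm n) = (0::complex)" using irr_char_orthonormal[OF sys, of n 0] n by simp
  then show False using irreducible_repD(2)[OF irreducible_systemD(1)[OF sys, of n]] by simp
qed

end

theorem mainTheorem6:
  fixes G :: "('g, 'b) monoid_scheme"
    and R :: "'g \<Rightarrow> complex mat" and d :: nat
    and irr :: "nat \<Rightarrow> 'g \<Rightarrow> complex mat" and dm :: "nat \<Rightarrow> nat" and n :: nat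
    and \<theta> :: "nat \<Rightarrow> mpol" and deg :: "nat \<Rightarrow> nat"
    and \<mu> :: "nat \<Rightarrow> nat" and \<beta> :: "nat \<Rightarrow> nat \<Rightarrow> complex vec \<Rightarrow> mpol" and e :: "nat \<Rightarrow> nat \<Rightarrow> nat"
  assumes "group G" and "finite (carrier G)"
    and "is_rep G d R" and "faithful_rep G R" and "image_acts_freely G d R"
    and "irreducible_system G n dm irr"
    and "invariant_hsop G d R \<theta> deg"
    and "\<And>j. j \<le> n \<Longrightarrow> homogeneous_covariant_basis G d R \<theta> (dm j) (irr j) (\<mu> j) (\<beta> j) (e j)"
  shows "\<exists>B\<in>carrier_mat n n.
      inverts_mat (euclidean_cartan G n irr d R) B \<and>
      inverts_mat B (euclidean_cartan G n irr d R) \<and>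
      (\<forall>i\<in>{1..n}. \<forall>j\<in>{1..n}.
         B $$ (i - 1, j - 1) =
           of_nat (dm i) * of_nat (dm j) / (of_nat (\<mu> 0) * of_nat (Coset.order G)) *
           ((-1) ^ d / fact d * poly ((pderiv ^^ d) (D_comb G n dm irr \<mu> e i j)) 1))"
proof -
  interpret finite_group G by (intro finite_group.intro finite_group_axioms.intro assms)
  note R = assms(3) and sys = assms(6) and hsop = assms(7)
  note irr = irreducible_systemD[OF sys]
  let ?N = "of_nat (Coset.order G) :: complex"
  let ?S = "carrier G - {\<one>\<^bsub>G\<^esub>}"
  let ?C = "euclidean_cartan G n irr d R"
  \<comment> \<open>the series \<open>1 / det (1 - q R(g))\<close>; its denominator is called \<open>p g\<close> below\<close>
  define T where "T g = Abs_fps (sym_trace d (R g))" for g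
  have nz: "det (1\<^sub>m d - R g) \<noteq> 0" if "g \<in> carrier G" "g \<noteq> \<one>\<^bsub>G\<^esub>" for g
    using det_one_minus_nonzero[OF R assms(4,5) that] .
  have "\<forall>g\<in>carrier G. \<exists>p. T g * fps_of_poly p = 1 \<and> poly p 1 = det (1\<^sub>m d - R g)"
    using sym_trace_series[OF R] by (simp add: T_def)
  then obtain p where p: "\<And>g. g \<in> carrier G \<Longrightarrow> T g * fps_of_poly (p g) = 1"
      "\<And>g. g \<in> carrier G \<Longrightarrow> poly (p g) 1 = det (1\<^sub>m d - R g)" by metis
  have d0: "carrier G = {\<one>\<^bsub>G\<^esub>}" if "d = 0" using dimension_zero_trivial[of R] R assms(4) that by simp
  have row0: "fps_of_poly (D_row0 \<mu> e j) = (\<Prod>l<d. 1 - fps_X ^ deg l) *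
      (\<Sum>g\<in>carrier G. fps_const (cnj (rep_char (irr j) g) / ?N) * T g)" if "j \<le> n" for j
    unfolding T_def
    by (rule D_row0_series[of d R "dm j" irr j \<theta> deg \<mu> \<beta> e, OF R irr(2)[OF that] hsop assms(8)[OF that]])
  have split: "(\<Sum>g\<in>carrier G. F g) = F \<one>\<^bsub>G\<^esub> + (\<Sum>g\<in>?S. F g)" for F :: "'g \<Rightarrow> complex fps"
    using fin by (intro sum.remove) auto
  have "poly (D_row0 \<mu> e 0) 1 = 1 / ?N * (\<Prod>l<d. of_nat (deg l))"
  proof (rule value_at_one[where S = ?S and T = T and p = p and ?T0.0 = "T \<one>\<^bsub>G\<^esub>"
        and w = "\<lambda>g. cnj (rep_char (irr 0) g) / ?N"])
    show "T \<one>\<^bsub>G\<^esub> * fps_of_poly ([:1, -1:] ^ d) = 1"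
      unfolding T_def by (rule sym_trace_series_one[OF R])
    show "fps_of_poly (D_row0 \<mu> e 0) = (\<Prod>l<d. 1 - fps_X ^ deg l) *
        (fps_const (1 / ?N) * T \<one>\<^bsub>G\<^esub> + (\<Sum>g\<in>?S. fps_const (cnj (rep_char (irr 0) g) / ?N) * T g))"
      using row0[of 0] by (simp add: split irr(4))
  qed (use fin p nz d0 in auto)
  moreover have "poly (D_row0 \<mu> e 0) 1 = of_nat (\<mu> 0)" by (simp add: D_row0_def poly_sum poly_monom)
  ultimately have \<mu>0: "of_nat (\<mu> 0) * ?N = (\<Prod>l<d. of_nat (deg l))" using order_pos by simp
  have degnz: "(\<Prod>l<d. of_nat (deg l) :: complex) \<noteq> 0"
    using hsop by (auto simp: invariant_hsop_def)
  define B where "B = mat n n (\<lambda>(i,j). cartan_inverse n dm irr d R (Suc i) (Suc j))"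
  have B: "B \<in> carrier_mat n n" by (simp add: B_def)
  have C: "?C \<in> carrier_mat n n" by (simp add: euclidean_cartan_def cg_exterior_def mat_delete_def)
  have CB: "?C * B = 1\<^sub>m n"
  proof (rule eq_matI)
    fix i k assume "i < dim_row (1\<^sub>m n :: complex mat)" "k < dim_col (1\<^sub>m n :: complex mat)"
    then have ik: "i < n" "k < n" by auto
    have "(?C * B) $$ (i, k) = (\<Sum>j<n. ?C $$ (i, j) * cartan_inverse n dm irr d R (Suc j) (Suc k))"
      unfolding mult_mat_entry[OF C B ik] using ik by (simp add: B_def)
    also have "\<dots> = (if i = k then 1 else 0)"
      by (rule cartan_times_inverse[OF sys R nz]) (use ik d0 trivial_group_single_irreducible[OF sys] in auto)
    finally show "(?C * B) $$ (i, k) = 1\<^sub>m n $$ (i, k)" using ik by simp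
  qed (use B C in auto)
  have BC: "B * ?C = 1\<^sub>m n" by (rule mat_mult_left_right_inverse[OF C B CB])
  have entry: "cartan_inverse n dm irr d R i j = of_nat (dm i) * of_nat (dm j) / (of_nat (\<mu> 0) * ?N) *
       ((-1) ^ d / fact d * poly ((pderiv ^^ d) (D_comb G n dm irr \<mu> e i j)) 1)"
    if i: "i \<le> n" and j: "j \<le> n" for i j
  proof -
    have dm: "dm i \<noteq> 0" "dm j \<noteq> 0" using irreducible_repD(2) irr(1) i j by auto
    define w where "w g = (1 - rep_char (irr i) g / of_nat (dm i)) * (1 - cnj (rep_char (irr j) g) / of_nat (dm j)) / ?N" for g
    \<comment> \<open>the pole at \<open>g = 1\<close> has coefficient zero\<close>
    have w1: "w \<one>\<^bsub>G\<^esub> = 0" using rep_char_one[OF irr(2)[OF i]] dm by (simp add: w_def)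
    have "fps_of_poly (D_comb G n dm irr \<mu> e i j) = (\<Prod>l<d. 1 - fps_X ^ deg l) * (\<Sum>g\<in>?S. fps_const (w g) * T g)"
      using D_comb_series[OF sys i j row0] unfolding w_def[symmetric] by (simp add: split w1)
    then have "(-1) ^ d / fact d * poly ((pderiv ^^ d) (D_comb G n dm irr \<mu> e i j)) 1 =
        (\<Prod>l<d. of_nat (deg l)) * (\<Sum>g\<in>?S. w g / poly (p g) 1)"
      by (rule leading_coefficient_at_one[rotated 3]) (use fin p nz in auto)
    moreover have "of_nat (dm i) * of_nat (dm j) * (\<Sum>g\<in>?S. w g / poly (p g) 1) = cartan_inverse n dm irr d R i j"
      unfolding cartan_inverse_def sum_distrib_left sum_divide_distrib
    proof (rule sum.cong[OF refl])
      fix g assume "g \<in> ?S"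
      then have "poly (p g) 1 = det (1\<^sub>m d - R g)" using p by simp
      moreover have "of_nat (dm i) * of_nat (dm j) *
          ((1 - rep_char (irr i) g / of_nat (dm i)) * (1 - cnj (rep_char (irr j) g) / of_nat (dm j))) =
          (rep_char (irr i) g - of_nat (dm i)) * (cnj (rep_char (irr j) g) - of_nat (dm j))"
        using dm by (simp add: field_simps)
      then have "of_nat (dm i) * of_nat (dm j) * w g =
          (rep_char (irr i) g - of_nat (dm i)) * (cnj (rep_char (irr j) g) - of_nat (dm j)) / ?N"
        unfolding w_def times_divide_eq_right by simp
      ultimately show "of_nat (dm i) * of_nat (dm j) * (w g / poly (p g) 1) =
          (rep_char (irr i) g - of_nat (dm i)) * (cnj (rep_char (irr j) g) - of_nat (dm j)) / det (1\<^sub>m d - R g) / ?N"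
        by (simp add: mult.assoc[symmetric])
    qed
    ultimately show ?thesis using \<mu>0 degnz by (simp add: mult_ac)
  qed
  show ?thesis
  proof (intro bexI[OF _ B] conjI ballI)
    show "inverts_mat ?C B" "inverts_mat B ?C" using CB BC B C by (auto simp: inverts_mat_def)
    fix i j assume ij: "i \<in> {1..n}" "j \<in> {1..n}"
    then have "B $$ (i - 1, j - 1) = cartan_inverse n dm irr d R i j" by (auto simp: B_def)
    then show "B $$ (i - 1, j - 1) = of_nat (dm i) * of_nat (dm j) / (of_nat (\<mu> 0) * ?N) *
       ((-1) ^ d / fact d * poly ((pderiv ^^ d) (D_comb G n dm irr \<mu> e i j)) 1)"
      using entry[of i j] ij by simp
  qed
qed

end
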